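(* Suppose that: (1) the undirected graph $\mathcal G$ is connected; (2) $\mathbb X^*\neq\emptyset$ and $f^*>-\infty$; (3) for every $i\in[n]$ and almost all $\xi_i$, $F_i(\cdot,\xi_i)$ is smooth with constant $L_f>0$, i.e., differentiable with $L_f$-Lipschitz gradient; (4) there exist constants $\sigma_0,\sigma_1$ such that $\mathbf E_{\xi_i}[\|\nabla_xF_i(x,\xi_i)-\nabla f_i(x)\|^2]\le\sigma_0^2\|\nabla f_i(x)\|^2+\sigma_1^2$ for all $i\in[n]$, $x\in\mathbb R^p$; (5) $f$ satisfies the Polyak–Łojasiewicz condition with constant $\nu>0$: $\frac12\|\nabla f(x)\|^2\ge\nu(f(x)-f^* )$ for all $x\in\mathbb R^p$, and $\nu$ is known in advance; (6) $f_i^*>-\infty$ for each $i\in[n]$, where $f_i^*=\min_{x\in\mathbb R^p}f_i(x)$. Let $\{x_{i,k}\}$ be the sequence generated by Algorithm 2 with $$\gamma\in(0,d_1),\quad\eta_k=\frac{\kappa_\eta}{k+t_1},\quad \delta_{i,k}\le\frac{\kappa_\delta\sqrt{p\eta_k}}{\sqrt{n+p}},\quad\forall k\in\mathbb N_0,$$ where $\kappa_\delta>0$, $\kappa_\eta\in(\frac8\nu,\frac{8d_3}\nu]$, $t_1>\check d_2(\gamma)$ and $d_3>1$. Then, for any $T\in\mathbb N_+$, $$\mathbf E\Big[\frac1n\sum_{i=1}^n\|x_{i,T}-\bar x_T\|^2\Big]=\mathcal O\Big(\frac p{T^2}\Big),\qquad\mathbf E[f(\bar x_T)-f^*]=\mathcal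 O\Big(\frac p{nT}\Big)+\mathcal O\Big(\frac p{T^2}\Big),$$ where $\bar x_k=\frac1n\sum_{i=1}^nx_{i,k}$. Moreover, the omitted constants in the first term $\mathcal O(\frac p{nT})$ on the right-hand side of the second bound do not depend on any parameters related to the communication network.
   Context: Problem: $n$ agents, $[n]=\{1,\dots,n\}$. For each $i\in[n]$, $\xi_i$ is a random variable and $F_i(\cdot,\xi_i):\mathbb R^p\to\mathbb R$ a stochastic function (not necessarily convex); $f_i(x)=\mathbf E_{\xi_i}[F_i(x,\xi_i)]$, $f(x)=\frac1n\sum_{i=1}^nf_i(x)$, $f^*=\min_{x\in\mathbb R^p}f(x)$, $\mathbb X^*$ is the set of minimizers of $f$. Network: $\mathcal G=([n],\mathcal E)$ is an undirected graph with symmetric weights $a_{ij}>0$ if $(i,j)\in\mathcal E$, $a_{ij}=0$ otherwise, $a_{ii}=0$; $L=(L_{ij})$ is the weighted Laplacian, $L=\mathrm{diag}(\sum_ja_{1j},\dots,\sum_ja_{nj})-(a_{ij})$. $\rho(\cdot)$ is the spectral radius and $\rho_2(L)$ the minimum positive eigenvalue of $L$. $\|\cdot\|$ is the Euclidean norm. $\mathbb N_+$: positive integers; $\mathbb N_0$: nonnegative integers. Algorithm 2 (distributed zeroth-order primal algorithm): given a constant $\gamma>0$, positive sequences $\{\eta_k\},\{\delta_{i,k}\}$ and initial points $x_{i,0}\in\mathbb R^p$, at each iteration $k$ each agent $i$ draws $u_{i,k}$ uniformly from the unit sphere $\mathbb S^p$ of $\mathbb R^p$ and $\xi_{i,k}$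 from the distribution of $\xi_i$ (all $u_{i,k},\xi_{j,l}$ mutually independent), sets $$g^e_{i,k}=\frac{p\,(F_i(x_{i,k}+\delta_{i,k}u_{i,k},\xi_{i,k})-F_i(x_{i,k},\xi_{i,k}))}{\delta_{i,k}}u_{i,k},$$ and updates $x_{i,k+1}=x_{i,k}-\gamma\sum_{j=1}^nL_{ij}x_{j,k}-\eta_kg^e_{i,k}$. Constants: $d_1=\frac{\rho_2(L)}{2\rho(L^2)}$, $\epsilon_1=\frac12\gamma\rho_2(L)-\gamma^2\rho(L^2)$, $\epsilon_2=\frac{1+2\gamma\rho_2(L)}{2\gamma\rho_2(L)}$, $\epsilon_{10}=8p(1+\sigma_0^2)(2\epsilon_2+\frac{L_f}n)L_f$, $\tilde d_2(\gamma)=\min\{\frac{\epsilon_1}{4L_f^2},\ \frac1{4p(1+\sigma_0^2)(2\epsilon_2+L_f)}\}$, $\check d_2(\gamma)=\max\{\frac1{\epsilon_1},\ \frac{\kappa_\eta}{\tilde d_2(\gamma)},\ \frac{4\kappa_\eta\epsilon_{10}}\nu\}$. *)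

theory Defs
  imports
    "HOL-Probability.Probability"
    "Jordan_Normal_Form.Spectral_Radius"
begin

text \<open>
  The bounds are uniform in the dimension \<open>p\<close> and in the number of agents \<open>n\<close>, so neither can be a
  type index: \<open>\<real>\<^sup>p\<close> is \<^term>\<open>carrier_vec p :: real Matrix.vec set\<close>, and agents are the numbers \<open>i < n\<close>.
\<close>

hide_type (open) Finite_Cartesian_Product.vec
hide_const (open) Finite_Cartesian_Product.vec Finite_Cartesian_Product.vec_nth
unbundle no vec_syntax and no inner_syntax

definition vnorm :: "real vec \<Rightarrow> real" where
  "vnorm x = sqrt (x \<bullet> x)"

definition has_gradient :: "nat \<Rightarrow> (real vec \<Rightarrow> real) \<Rightarrow> real vec \<Rightarrow> real vec \<Rightarrow> bool" where
  "has_gradient p h g x \<longleftrightarrow> g \<in> carrier_vec p \<and>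
     (\<forall>e>0. \<exists>d>0. \<forall>y\<in>carrier_vec p. vnorm (y - x) < d \<longrightarrow>
        \<bar>h y - h x - g \<bullet> (y - x)\<bar> \<le> e * vnorm (y - x))"

definition gradient :: "nat \<Rightarrow> (real vec \<Rightarrow> real) \<Rightarrow> real vec \<Rightarrow> real vec" where
  "gradient p h x = (THE g. has_gradient p h g x)"

definition smooth_with :: "nat \<Rightarrow> real \<Rightarrow> (real vec \<Rightarrow> real) \<Rightarrow> bool" where
  "smooth_with p L h \<longleftrightarrow>
     (\<forall>x\<in>carrier_vec p. \<exists>g. has_gradient p h g x) \<and>
     (\<forall>x\<in>carrier_vec p. \<forall>y\<in>carrier_vec p.
        vnorm (gradient p h x - gradient p h y) \<le> L * vnorm (x - y))"

definition minimizers :: "nat \<Rightarrow> (real vec \<Rightarrow> real) \<Rightarrow> real vec set" where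
  "minimizers p h = {x \<in> carrier_vec p. \<forall>y\<in>carrier_vec p. h x \<le> h y}"

definition min_value :: "nat \<Rightarrow> (real vec \<Rightarrow> real) \<Rightarrow> real" where
  "min_value p h = (INF x\<in>carrier_vec p. h x)"

definition polyak_lojasiewicz :: "nat \<Rightarrow> real \<Rightarrow> (real vec \<Rightarrow> real) \<Rightarrow> bool" where
  "polyak_lojasiewicz p \<nu> h \<longleftrightarrow>
     (\<forall>x\<in>carrier_vec p. (1/2) * (vnorm (gradient p h x))\<^sup>2 \<ge> \<nu> * (h x - min_value p h))"

definition borel_vec :: "nat \<Rightarrow> real vec measure" where
  "borel_vec p = vimage_algebra (carrier_vec p) (\<lambda>x. \<lambda>c\<in>{..<p}. x $ c) (\<Pi>\<^sub>M c\<in>{..<p}. borel)"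

text \<open>The uniform distribution on the unit sphere is that of \<open>x / \<parallel>x\<parallel>\<close> for \<open>x\<close> Lebesgue-uniform in
  the unit ball.\<close>

definition uniform_sphere :: "nat \<Rightarrow> real vec measure" where
  "uniform_sphere p =
     distr (uniform_measure (\<Pi>\<^sub>M c\<in>{..<p}. lborel) {x \<in> {..<p} \<rightarrow>\<^sub>E UNIV. L2_set x {..<p} \<le> 1})
       (borel_vec p) (\<lambda>x. Matrix.vec p (\<lambda>c. x c / L2_set x {..<p}))"

text \<open>\<open>F i x z\<close> is \<open>F\<^sub>i(x, z)\<close> and \<open>D i\<close> is the distribution of \<open>\<xi>\<^sub>i\<close>.\<close>

definition local_obj :: "(nat \<Rightarrow> 'b measure) \<Rightarrow> (nat \<Rightarrow> real vec \<Rightarrow> 'b \<Rightarrow> real) \<Rightarrow> nat \<Rightarrow> real vec \<Rightarrow> real" where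
  "local_obj D F i x = (\<integral>z. F i x z \<partial>D i)"

definition global_obj :: "nat \<Rightarrow> (nat \<Rightarrow> 'b measure) \<Rightarrow> (nat \<Rightarrow> real vec \<Rightarrow> 'b \<Rightarrow> real) \<Rightarrow> real vec \<Rightarrow> real" where
  "global_obj n D F x = (\<Sum>i<n. local_obj D F i x) / real n"

text \<open>Joint measurability and integrability are what makes the random variables occurring in the
  algorithm and the expectations defining the local objectives meaningful.\<close>

definition stochastic_functions ::
  "nat \<Rightarrow> nat \<Rightarrow> (nat \<Rightarrow> 'b measure) \<Rightarrow> (nat \<Rightarrow> real vec \<Rightarrow> 'b \<Rightarrow> real) \<Rightarrow> bool" where
  "stochastic_functions n p D F \<longleftrightarrow> (\<forall>i<n.
     prob_space (D i) \<and>
     (\<lambda>(x, z). F i x z) \<in> borel_measurable (borel_vec p \<Otimes>\<^sub>M D i) \<and>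
     (\<forall>x\<in>carrier_vec p. integrable (D i) (F i x)))"

text \<open>The Lebesgue integral of a nonnegative function is used, so that an infinite variance violates
  the bound.\<close>

definition gradient_variance_bound ::
  "nat \<Rightarrow> nat \<Rightarrow> (nat \<Rightarrow> 'b measure) \<Rightarrow> (nat \<Rightarrow> real vec \<Rightarrow> 'b \<Rightarrow> real) \<Rightarrow> real \<Rightarrow> real \<Rightarrow> bool" where
  "gradient_variance_bound n p D F \<sigma>\<^sub>0 \<sigma>\<^sub>1 \<longleftrightarrow> (\<forall>i<n. \<forall>x\<in>carrier_vec p.
     (\<integral>\<^sup>+z. ennreal ((vnorm (gradient p (\<lambda>y. F i y z) x - gradient p (local_obj D F i) x))\<^sup>2) \<partial>D i)
       \<le> ennreal (\<sigma>\<^sub>0\<^sup>2 * (vnorm (gradient p (local_obj D F i) x))\<^sup>2 + \<sigma>\<^sub>1\<^sup>2))"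

definition weighted_graph :: "nat \<Rightarrow> (nat \<times> nat) set \<Rightarrow> real mat \<Rightarrow> bool" where
  "weighted_graph n E A \<longleftrightarrow>
     E \<subseteq> {..<n} \<times> {..<n} \<and> sym E \<and> A \<in> carrier_mat n n \<and>
     (\<forall>i<n. A $$ (i, i) = 0) \<and>
     (\<forall>i<n. \<forall>j<n. A $$ (i, j) = A $$ (j, i) \<and>
        ((i, j) \<in> E \<longrightarrow> A $$ (i, j) > 0) \<and> ((i, j) \<notin> E \<longrightarrow> A $$ (i, j) = 0))"

definition connected_graph :: "nat \<Rightarrow> (nat \<times> nat) set \<Rightarrow> bool" where
  "connected_graph n E \<longleftrightarrow> (\<forall>i<n. \<forall>j<n. (i, j) \<in> E\<^sup>*)"

definition laplacian :: "nat \<Rightarrow> real mat \<Rightarrow> real mat" where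
  "laplacian n A = mat n n (\<lambda>(i, j). (if i = j then \<Sum>l<n. A $$ (i, l) else 0) - A $$ (i, j))"

definition spec_rad :: "real mat \<Rightarrow> real" where
  "spec_rad B = spectral_radius (map_mat complex_of_real B)"

definition min_pos_eigenvalue :: "real mat \<Rightarrow> real" where
  "min_pos_eigenvalue B = Min {l. eigenvalue B l \<and> l > 0}"

definition d1 :: "real mat \<Rightarrow> real" where
  "d1 L = min_pos_eigenvalue L / (2 * spec_rad (L * L))"

definition eps1 :: "real mat \<Rightarrow> real \<Rightarrow> real" where
  "eps1 L \<gamma> = (1/2) * \<gamma> * min_pos_eigenvalue L - \<gamma>\<^sup>2 * spec_rad (L * L)"

definition eps2 :: "real mat \<Rightarrow> real \<Rightarrow> real" where
  "eps2 L \<gamma> = (1 + 2 * \<gamma> * min_pos_eigenvalue L) / (2 * \<gamma> * min_pos_eigenvalue L)"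

definition eps10 :: "nat \<Rightarrow> nat \<Rightarrow> real mat \<Rightarrow> real \<Rightarrow> real \<Rightarrow> real \<Rightarrow> real" where
  "eps10 n p L L\<^sub>f \<sigma>\<^sub>0 \<gamma> =
     8 * real p * (1 + \<sigma>\<^sub>0\<^sup>2) * (2 * eps2 L \<gamma> + L\<^sub>f / real n) * L\<^sub>f"

definition d2_tilde :: "nat \<Rightarrow> real mat \<Rightarrow> real \<Rightarrow> real \<Rightarrow> real \<Rightarrow> real" where
  "d2_tilde p L L\<^sub>f \<sigma>\<^sub>0 \<gamma> =
     min (eps1 L \<gamma> / (4 * L\<^sub>f\<^sup>2)) (1 / (4 * real p * (1 + \<sigma>\<^sub>0\<^sup>2) * (2 * eps2 L \<gamma> + L\<^sub>f)))"

definition d2_check ::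
  "nat \<Rightarrow> nat \<Rightarrow> real mat \<Rightarrow> real \<Rightarrow> real \<Rightarrow> real \<Rightarrow> real \<Rightarrow> real \<Rightarrow> real" where
  "d2_check n p L L\<^sub>f \<sigma>\<^sub>0 \<nu> \<kappa>\<^sub>\<eta> \<gamma> =
     max (1 / eps1 L \<gamma>)
       (max (\<kappa>\<^sub>\<eta> / d2_tilde p L L\<^sub>f \<sigma>\<^sub>0 \<gamma>) (4 * \<kappa>\<^sub>\<eta> * eps10 n p L L\<^sub>f \<sigma>\<^sub>0 \<gamma> / \<nu>))"

definition zo_gradient ::
  "nat \<Rightarrow> (real vec \<Rightarrow> 'b \<Rightarrow> real) \<Rightarrow> real \<Rightarrow> real vec \<Rightarrow> 'b \<Rightarrow> real vec \<Rightarrow> real vec" where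
  "zo_gradient p h \<delta> u z x = (real p * (h (x + \<delta> \<cdot>\<^sub>v u) z - h x z) / \<delta>) \<cdot>\<^sub>v u"

text \<open>The iterates as a function of the realized draws \<open>u i k\<close> and \<open>z i k\<close>.\<close>

primrec zo_primal ::
  "nat \<Rightarrow> nat \<Rightarrow> real mat \<Rightarrow> (nat \<Rightarrow> real vec \<Rightarrow> 'b \<Rightarrow> real) \<Rightarrow> real \<Rightarrow> (nat \<Rightarrow> real) \<Rightarrow> (nat \<Rightarrow> nat \<Rightarrow> real)
     \<Rightarrow> (nat \<Rightarrow> real vec) \<Rightarrow> (nat \<Rightarrow> nat \<Rightarrow> real vec) \<Rightarrow> (nat \<Rightarrow> nat \<Rightarrow> 'b) \<Rightarrow> nat \<Rightarrow> (nat \<Rightarrow> real vec)" where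
  "zo_primal n p L F \<gamma> \<eta> \<delta> x0 u z 0 = x0"
| "zo_primal n p L F \<gamma> \<eta> \<delta> x0 u z (Suc k) =
     (let x = zo_primal n p L F \<gamma> \<eta> \<delta> x0 u z k in
       (\<lambda>i. Matrix.vec p (\<lambda>c. x i $ c - \<gamma> * (\<Sum>j<n. L $$ (i, j) * x j $ c)
              - \<eta> k * zo_gradient p (F i) (\<delta> i k) (u i k) (z i k) (x i) $ c)))"

text \<open>Independence is stated through the generated families of events because \<open>indep_vars\<close> requires
  all random variables to have the same range type.\<close>

definition independent_draws ::
  "'w measure \<Rightarrow> nat \<Rightarrow> nat \<Rightarrow> (nat \<Rightarrow> 'b measure) \<Rightarrow> (nat \<Rightarrow> nat \<Rightarrow> 'w \<Rightarrow> real vec)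
     \<Rightarrow> (nat \<Rightarrow> nat \<Rightarrow> 'w \<Rightarrow> 'b) \<Rightarrow> bool" where
  "independent_draws M n p D u \<xi> \<longleftrightarrow>
     prob_space M \<and>
     (\<forall>i<n. \<forall>k. u i k \<in> measurable M (borel_vec p) \<and>
        distr M (borel_vec p) (u i k) = uniform_sphere p \<and>
        \<xi> i k \<in> measurable M (D i) \<and> distr M (D i) (\<xi> i k) = D i) \<and>
     prob_space.indep_sets M
       (\<lambda>r. case r of
            Inl (i, k) \<Rightarrow> {u i k -` B \<inter> space M | B. B \<in> sets (borel_vec p)}
          | Inr (i, k) \<Rightarrow> {\<xi> i k -` B \<inter> space M | B. B \<in> sets (D i)})
       (({..<n} \<times> UNIV) <+> ({..<n} \<times> UNIV))"

definition avg :: "nat \<Rightarrow> nat \<Rightarrow> (nat \<Rightarrow> real vec) \<Rightarrow> real vec" where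
  "avg n p x = Matrix.vec p (\<lambda>c. (\<Sum>i<n. x i $ c) / real n)"

definition disagreement :: "nat \<Rightarrow> nat \<Rightarrow> (nat \<Rightarrow> real vec) \<Rightarrow> real" where
  "disagreement n p x = (\<Sum>i<n. (vnorm (x i - avg n p x))\<^sup>2) / real n"

end

theory Submission
  imports Defs
begin

text \<open>
  Let \<open>D\<^sub>k\<close> be the expected disagreement and \<open>W\<^sub>k\<close> the expected optimality gap of the average
  iterate. Given the past, the estimator of an agent has second moment of order
  \<open>p (\<parallel>\<nabla>f\<^sub>i\<parallel>\<^sup>2 + 1)\<close> and a bias of at most \<open>\<delta> L\<^sub>f\<close>, independently of \<open>p\<close>. The
  Laplacian contracts the disagreement by a factor \<open>1 - 2 \<epsilon>\<^sub>1\<close>, while the descent lemma, the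
  Polyak-Lojasiewicz condition and the independence of the agents give
  \<open>W\<^sub>k\<^sub>+\<^sub>1 \<le> (1 - c \<eta>\<^sub>k) W\<^sub>k + O(\<eta>\<^sub>k D\<^sub>k) + O(\<eta>\<^sub>k\<^sup>2 p / n)\<close>, with a last constant that does not
  see the network. The sum \<open>D\<^sub>k + W\<^sub>k\<close> is bounded because it grows by at most \<open>O(\<eta>\<^sub>k\<^sup>2)\<close> per step.
  Hence \<open>D\<^sub>k = O(\<eta>\<^sub>k\<^sup>2)\<close>, so that disagreement enters the recursion of \<open>W\<^sub>k\<close> only at order
  \<open>\<eta>\<^sub>k\<^sup>3\<close>.
\<close>

section \<open>Vectors and smooth functions\<close>

text \<open>What shapes the proof is uniformity: both rates are linear in \<open>p\<close>, and the
  constant of the \<open>p / (n T)\<close> term must not see the graph. Initial values and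
  everything that involves the graph are therefore pushed to order \<open>1 / T^2\<close>. A
  contraction \<open>1 - 3 / (k + t)\<close>, available because \<open>\<kappa>\<^sub>\<eta>\<close>
  exceeds \<open>8 / \<nu>\<close>, forgets the initial gap at that order and passes on only the
  noise of order \<open>\<eta>^2 p / n\<close>. The smoothing radius is tuned to this: the bias
  costs \<open>\<eta> \<delta>^2\<close>, and \<open>\<delta>^2\<close> of order
  \<open>p \<eta> / (n + p)\<close> makes that \<open>\<eta>^2 p / n\<close> too. The local
  gradients do not vanish at a minimizer of the average, so the noise does not vanish there either;
  finite local infima together with smoothness bound it by the optimality gap plus a fixed
  heterogeneity. Since \<open>p\<close> and \<open>n\<close> vary, vectors and matrices carry no
  dimension in their type: the symmetry of the sphere is derived from Fubini's theorem through
  shears, and the two spectral constants come from minimizing quadratic forms over a compact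
  sphere.\<close>

lemma scalar_prod_sum:
  fixes x y :: "real vec"
  assumes "y \<in> carrier_vec p"
  shows "x \<bullet> y = (\<Sum>c<p. x $ c * y $ c)"
  using assms by (simp add: scalar_prod_def lessThan_atLeast0)

lemma vnorm_eq_L2_set: "x \<in> carrier_vec p \<Longrightarrow> vnorm x = L2_set (\<lambda>c. x $ c) {..<p}"
  by (simp add: vnorm_def L2_set_def scalar_prod_sum[of x p] power2_eq_square)

lemma vnorm_power2_eq_sum: "x \<in> carrier_vec p \<Longrightarrow> (vnorm x)\<^sup>2 = (\<Sum>c<p. (x $ c)\<^sup>2)"
  unfolding vnorm_eq_L2_set L2_set_def by (simp add: sum_nonneg)

lemma vnorm_power2: "x \<in> carrier_vec p \<Longrightarrow> (vnorm x)\<^sup>2 = x \<bullet> x"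
  unfolding vnorm_power2_eq_sum by (simp add: scalar_prod_sum[of x p] power2_eq_square)

lemma vnorm_nonneg [simp]: "0 \<le> vnorm x"
  by (auto simp: vnorm_def scalar_prod_def intro: sum_nonneg)

lemma abs_scalar_prod_le:
  assumes "x \<in> carrier_vec p" "y \<in> carrier_vec p"
  shows "\<bar>x \<bullet> y\<bar> \<le> vnorm x * vnorm y"
proof -
  have "\<bar>x \<bullet> y\<bar> \<le> (\<Sum>c<p. \<bar>x $ c\<bar> * \<bar>y $ c\<bar>)"
    using assms by (simp add: scalar_prod_sum[of y p] abs_mult order_trans[OF sum_abs])
  also have "\<dots> \<le> vnorm x * vnorm y"
    using assms by (simp add: vnorm_eq_L2_set[of _ p] L2_set_mult_ineq)
  finally show ?thesis .
qed

lemma vnorm_add_le: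
  assumes "x \<in> carrier_vec p" "y \<in> carrier_vec p"
  shows "vnorm (x + y) \<le> vnorm x + vnorm y"
proof -
  have "L2_set (\<lambda>c. (x + y) $ c) {..<p} = L2_set (\<lambda>c. x $ c + y $ c) {..<p}"
    using assms by (intro L2_set_cong) auto
  then show ?thesis
    using assms L2_set_triangle_ineq[of "\<lambda>c. x $ c" "\<lambda>c. y $ c" "{..<p}"]
    by (simp add: vnorm_eq_L2_set[of _ p])
qed

lemma vnorm_smult: "vnorm (a \<cdot>\<^sub>v x) = \<bar>a\<bar> * vnorm x"
proof -
  have "(a \<cdot>\<^sub>v x) \<bullet> (a \<cdot>\<^sub>v x) = a\<^sup>2 * (x \<bullet> x)"
    by (simp add: scalar_prod_def sum_distrib_left power2_eq_square algebra_simps)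
  then show ?thesis by (simp add: vnorm_def real_sqrt_mult)
qed

lemma vnorm_minus_commute:
  assumes "x \<in> carrier_vec p" "y \<in> carrier_vec p"
  shows "vnorm (x - y) = vnorm (y - x)"
proof -
  have "x - y = (-1) \<cdot>\<^sub>v (y - x)" using assms by (intro eq_vecI) auto
  then show ?thesis by (simp add: vnorm_smult)
qed

lemma vnorm_power2_add_le:
  assumes "x \<in> carrier_vec p" "y \<in> carrier_vec p"
  shows "(vnorm (x + y))\<^sup>2 \<le> 2 * (vnorm x)\<^sup>2 + 2 * (vnorm y)\<^sup>2"
proof -
  have "(vnorm (x + y))\<^sup>2 \<le> (vnorm x + vnorm y)\<^sup>2"
    by (intro power_mono vnorm_add_le[OF assms]) auto
  also have "\<dots> \<le> 2 * (vnorm x)\<^sup>2 + 2 * (vnorm y)\<^sup>2"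
    using sum_squares_bound[of "vnorm x" "vnorm y"] by (simp add: power2_sum)
  finally show ?thesis .
qed

lemma vnorm_eq_0_imp:
  assumes "x \<in> carrier_vec p" "vnorm x = 0" shows "x = 0\<^sub>v p"
proof -
  have "(\<Sum>c<p. (x $ c)\<^sup>2) = 0" using assms vnorm_power2_eq_sum[of x p] by simp
  then have "\<forall>c<p. x $ c = 0" by (subst (asm) sum_nonneg_eq_0_iff) auto
  then show ?thesis using assms by (intro eq_vecI) auto
qed

text \<open>Norm by duality: the choice \<open>w = x\<close> gives the claim. It reduces norm bounds
  on vectors whose entries are integrals to bounds on scalar integrals against a fixed
  \<open>w\<close>.\<close>

lemma vnorm_le_of_scalar_prod_le:
  assumes x: "x \<in> carrier_vec p" and le: "\<And>w. w \<in> carrier_vec p \<Longrightarrow> x \<bullet> w \<le> B * vnorm w" and "0 \<le> B"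
  shows "vnorm x \<le> B"
proof (cases "vnorm x = 0")
  case False
  have "vnorm x * vnorm x \<le> B * vnorm x"
    using le[OF x] vnorm_power2[OF x] by (simp add: power2_eq_square)
  moreover have "0 < vnorm x" using False vnorm_nonneg[of x] by linarith
  ultimately show ?thesis by (rule mult_right_le_imp_le)
qed (use \<open>0 \<le> B\<close> in simp)

lemma abs_index_le_vnorm:
  assumes "x \<in> carrier_vec p" "c < p" shows "\<bar>x $ c\<bar> \<le> vnorm x"
proof -
  have "(x $ c)\<^sup>2 \<le> (\<Sum>c<p. (x $ c)\<^sup>2)"
    using assms(2) by (intro member_le_sum) auto
  then have "\<bar>x $ c\<bar>\<^sup>2 \<le> (vnorm x)\<^sup>2"
    using vnorm_power2_eq_sum[OF assms(1)] by simp
  then show ?thesis by (rule power2_le_imp_le) simp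
qed

text \<open>Makes the definite description in \<open>gradient\<close> meaningful. A short step along
  \<open>w = g - g'\<close> makes the two linear predictions differ by
  \<open>t \<parallel>w\<parallel>^2\<close>, while both are within
  \<open>e t \<parallel>w\<parallel>\<close> of the same increment;
  \<open>e = \<parallel>w\<parallel> / 4\<close> is too small for that.\<close>

lemma has_gradient_unique:
  assumes x: "x \<in> carrier_vec p" and g: "has_gradient p h g x" and g': "has_gradient p h g' x"
  shows "g = g'"
proof -
  have gc: "g \<in> carrier_vec p" "g' \<in> carrier_vec p" using g g' by (auto simp: has_gradient_def)
  define w where "w = g - g'"
  have w: "w \<in> carrier_vec p" using gc by (simp add: w_def)
  have "vnorm w = 0"
  proof (rule ccontr)
    assume "vnorm w \<noteq> 0"
    then have pos: "vnorm w > 0" using vnorm_nonneg[of w] by linarith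
    define e where "e = vnorm w / 4"
    have e: "e > 0" using pos by (simp add: e_def)
    obtain d1 where d1: "d1 > 0" "\<And>y. y \<in> carrier_vec p \<Longrightarrow> vnorm (y - x) < d1 \<Longrightarrow>
        \<bar>h y - h x - g \<bullet> (y - x)\<bar> \<le> e * vnorm (y - x)"
      using g e unfolding has_gradient_def by blast
    obtain d2 where d2: "d2 > 0" "\<And>y. y \<in> carrier_vec p \<Longrightarrow> vnorm (y - x) < d2 \<Longrightarrow>
        \<bar>h y - h x - g' \<bullet> (y - x)\<bar> \<le> e * vnorm (y - x)"
      using g' e unfolding has_gradient_def by blast
    define t where "t = min d1 d2 / (2 * vnorm w)"
    have t: "t > 0" "t * vnorm w < d1" "t * vnorm w < d2"
      using d1(1) d2(1) pos by (auto simp: t_def field_simps min_def)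
    define y where "y = x + t \<cdot>\<^sub>v w"
    have y: "y \<in> carrier_vec p" "y - x = t \<cdot>\<^sub>v w"
      using x w by (auto simp: y_def intro!: eq_vecI)
    have n: "vnorm (y - x) = t * vnorm w" using t by (simp add: y vnorm_smult)
    have "\<bar>h y - h x - g \<bullet> (y - x)\<bar> \<le> e * (t * vnorm w)" "\<bar>h y - h x - g' \<bullet> (y - x)\<bar> \<le> e * (t * vnorm w)"
      using d1(2)[of y] d2(2)[of y] y(1) n t by auto
    moreover have "g \<bullet> (y - x) - g' \<bullet> (y - x) = t * (vnorm w)\<^sup>2"
    proof -
      have "g \<bullet> (y - x) - g' \<bullet> (y - x) = w \<bullet> (t \<cdot>\<^sub>v w)"
        unfolding y w_def using gc by (subst minus_scalar_prod_distrib[of _ p]) auto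
      also have "\<dots> = t * (vnorm w)\<^sup>2" using w by (simp add: vnorm_power2)
      finally show ?thesis .
    qed
    ultimately have "t * (vnorm w)\<^sup>2 \<le> 2 * e * (t * vnorm w)" by linarith
    then have "t * vnorm w * vnorm w \<le> t * vnorm w * (vnorm w / 2)"
      by (simp add: e_def power2_eq_square)
    then show False using t(1) pos by simp
  qed
  then have w0: "w = 0\<^sub>v p" using vnorm_eq_0_imp[OF w] by simp
  show ?thesis
  proof (intro eq_vecI)
    fix c assume "c < dim_vec g'"
    then show "g $ c = g' $ c"
      using w0 gc index_minus_vec(1)[of c g' g] by (simp add: w_def)
  qed (use gc in auto)
qed

lemma gradient_eqI:
  assumes "x \<in> carrier_vec p" "has_gradient p h g x" shows "gradient p h x = g"
  unfolding gradient_def using has_gradient_unique[OF assms(1) _ assms(2)] assms(2) by blast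

text \<open>A quadratic remainder survives integration and averaging, unlike the bare definition of
  a gradient; this is how expectations and averages of smooth functions get theirs.\<close>

lemma has_gradient_quadraticI:
  assumes x: "x \<in> carrier_vec p" and g: "g \<in> carrier_vec p"
    and q: "\<And>d. d \<in> carrier_vec p \<Longrightarrow> \<bar>h (x + d) - h x - g \<bullet> d\<bar> \<le> K * (vnorm d)\<^sup>2"
  shows "has_gradient p h g x"
  unfolding has_gradient_def
proof (intro conjI allI impI g)
  fix e :: real assume e: "e > 0"
  \<comment> \<open>At least 1, so that the radius \<open>e / K'\<close> is positive for every
    \<open>K\<close>.\<close>
  define K' where "K' = max K 1"
  show "\<exists>d>0. \<forall>y\<in>carrier_vec p. vnorm (y - x) < d \<longrightarrow> \<bar>h y - h x - g \<bullet> (y - x)\<bar> \<le> e * vnorm (y - x)"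
  proof (intro exI[of _ "e / K'"] conjI ballI impI)
    show "0 < e / K'" using e by (simp add: K'_def)
    fix y assume y: "y \<in> carrier_vec p" and s: "vnorm (y - x) < e / K'"
    have "y = x + (y - x)" using x y by (intro eq_vecI) auto
    then have "\<bar>h y - h x - g \<bullet> (y - x)\<bar> \<le> K * (vnorm (y - x))\<^sup>2"
      using q[of "y - x"] x y by auto
    also have "\<dots> \<le> K' * (vnorm (y - x))\<^sup>2" by (intro mult_right_mono) (auto simp: K'_def)
    also have "\<dots> = K' * vnorm (y - x) * vnorm (y - x)" by (simp add: power2_eq_square)
    also have "\<dots> \<le> e * vnorm (y - x)"
    proof (rule mult_right_mono)
      have "K' > 0" by (simp add: K'_def)
      then show "K' * vnorm (y - x) \<le> e" using s by (simp add: pos_less_divide_eq mult.commute)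
    qed simp
    finally show "\<bar>h y - h x - g \<bullet> (y - x)\<bar> \<le> e * vnorm (y - x)" .
  qed
qed

lemma smooth_has_gradient:
  assumes "smooth_with p L h" "x \<in> carrier_vec p"
  shows "has_gradient p h (gradient p h x) x" "gradient p h x \<in> carrier_vec p"
proof -
  obtain g where "has_gradient p h g x" using assms unfolding smooth_with_def by blast
  then show "has_gradient p h (gradient p h x) x" using gradient_eqI[OF assms(2)] by simp
  then show "gradient p h x \<in> carrier_vec p" by (simp add: has_gradient_def)
qed

lemma smooth_lipschitz:
  assumes "smooth_with p L h" "x \<in> carrier_vec p" "y \<in> carrier_vec p"
  shows "vnorm (gradient p h x - gradient p h y) \<le> L * vnorm (x - y)"
  using assms unfolding smooth_with_def by blast

lemma has_gradient_line_derivative: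
  assumes x: "x \<in> carrier_vec p" and d: "d \<in> carrier_vec p"
    and g: "has_gradient p h g (x + t \<cdot>\<^sub>v d)"
  shows "((\<lambda>s. h (x + s \<cdot>\<^sub>v d)) has_real_derivative (g \<bullet> d)) (at t)"
proof -
  have gc: "g \<in> carrier_vec p" using g by (simp add: has_gradient_def)
  have eq: "(x + s \<cdot>\<^sub>v d) - (x + t \<cdot>\<^sub>v d) = (s - t) \<cdot>\<^sub>v d" for s
    using x d by (intro eq_vecI) (auto simp: algebra_simps)
  have "((\<lambda>s. (h (x + s \<cdot>\<^sub>v d) - h (x + t \<cdot>\<^sub>v d)) / (s - t)) \<longlongrightarrow> g \<bullet> d) (at t)"
    unfolding LIM_def
  proof (intro allI impI)
    fix r :: real assume r: "r > 0"
    \<comment> \<open>The added 1 keeps the quotient meaningful for \<open>d = 0\<close>.\<close>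
    define e where "e = r / (2 * (vnorm d + 1))"
    have nd: "vnorm d + 1 > 0" using vnorm_nonneg[of d] by linarith
    have e: "e > 0" using r nd by (simp add: e_def)
    obtain s0 where s0: "s0 > 0" "\<And>y. y \<in> carrier_vec p \<Longrightarrow> vnorm (y - (x + t \<cdot>\<^sub>v d)) < s0 \<Longrightarrow>
        \<bar>h y - h (x + t \<cdot>\<^sub>v d) - g \<bullet> (y - (x + t \<cdot>\<^sub>v d))\<bar> \<le> e * vnorm (y - (x + t \<cdot>\<^sub>v d))"
      using g e unfolding has_gradient_def by blast
    show "\<exists>s>0. \<forall>xa. xa \<noteq> t \<and> dist xa t < s \<longrightarrow>
        dist ((h (x + xa \<cdot>\<^sub>v d) - h (x + t \<cdot>\<^sub>v d)) / (xa - t)) (g \<bullet> d) < r"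
    proof (intro exI[of _ "s0 / (vnorm d + 1)"] conjI allI impI)
      show "0 < s0 / (vnorm d + 1)" using s0 nd by simp
      fix s assume s: "s \<noteq> t \<and> dist s t < s0 / (vnorm d + 1)"
      then have st: "\<bar>s - t\<bar> > 0" "\<bar>s - t\<bar> * (vnorm d + 1) < s0"
        using nd by (auto simp: dist_real_def pos_less_divide_eq)
      have "\<bar>s - t\<bar> * vnorm d < s0" using st by (smt (verit) mult_left_mono vnorm_nonneg)
      then have "\<bar>h (x + s \<cdot>\<^sub>v d) - h (x + t \<cdot>\<^sub>v d) - g \<bullet> ((s - t) \<cdot>\<^sub>v d)\<bar> \<le> e * (\<bar>s - t\<bar> * vnorm d)"
        using s0(2)[of "x + s \<cdot>\<^sub>v d"] x d by (simp add: eq vnorm_smult)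
      then have b: "\<bar>h (x + s \<cdot>\<^sub>v d) - h (x + t \<cdot>\<^sub>v d) - (s - t) * (g \<bullet> d)\<bar> \<le> e * vnorm d * \<bar>s - t\<bar>"
        using gc d by (simp add: mult_ac)
      have "dist ((h (x + s \<cdot>\<^sub>v d) - h (x + t \<cdot>\<^sub>v d)) / (s - t)) (g \<bullet> d)
          = \<bar>h (x + s \<cdot>\<^sub>v d) - h (x + t \<cdot>\<^sub>v d) - (s - t) * (g \<bullet> d)\<bar> / \<bar>s - t\<bar>"
        using s by (simp add: dist_real_def abs_divide[symmetric] diff_divide_distrib)
      also have "\<dots> \<le> e * vnorm d"
        using b st(1) by (simp add: pos_divide_le_eq)
      also have "\<dots> \<le> e * (vnorm d + 1)" using e by simp
      also have "\<dots> = r / 2" using nd by (simp add: e_def field_simps)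
      also have "\<dots> < r" using r by simp
      finally show "dist ((h (x + s \<cdot>\<^sub>v d) - h (x + t \<cdot>\<^sub>v d)) / (s - t)) (g \<bullet> d) < r" .
    qed
  qed
  then show ?thesis by (simp add: has_field_derivative_iff)
qed

text \<open>Serves the comparison of two points that both lie at distance \<open>\<delta>\<close>
  from the base point: there an error proportional to their mutual displacement is wanted, which
  expansion at the base point does not give.\<close>

lemma smooth_mean_value:
  assumes sm: "smooth_with p L h" and x: "x \<in> carrier_vec p" and d: "d \<in> carrier_vec p"
  obtains t where "0 < t" "t < 1" "h (x + d) - h x = gradient p h (x + t \<cdot>\<^sub>v d) \<bullet> d"
proof -
  have der: "((\<lambda>s. h (x + s \<cdot>\<^sub>v d)) has_real_derivative (gradient p h (x + t \<cdot>\<^sub>v d) \<bullet> d)) (at t)" for t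
    by (rule has_gradient_line_derivative[OF x d smooth_has_gradient(1)[OF sm]]) (use x d in auto)
  have "\<exists>z>0. z < 1 \<and> h (x + 1 \<cdot>\<^sub>v d) - h (x + 0 \<cdot>\<^sub>v d) = (1 - 0) * (gradient p h (x + z \<cdot>\<^sub>v d) \<bullet> d)"
    by (rule MVT2) (use der in auto)
  moreover have "x + 1 \<cdot>\<^sub>v d = x + d" "x + 0 \<cdot>\<^sub>v d = x"
    using x d by (auto intro!: eq_vecI)
  ultimately show ?thesis using that by auto
qed

text \<open>Along the segment the slope leaves \<open>g 0\<close> by at most
  \<open>L t \<parallel>d\<parallel>^2\<close>. Subtracting \<open>K / 2 * t^2\<close> from the
  linearization error, or adding it, therefore makes it monotone, which yields both sides without
  integrating the gradient.\<close>

lemma smooth_quadratic_bound: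
  assumes sm: "smooth_with p L h" and L: "0 \<le> L" and x: "x \<in> carrier_vec p" and d: "d \<in> carrier_vec p"
  shows "\<bar>h (x + d) - h x - gradient p h x \<bullet> d\<bar> \<le> L / 2 * (vnorm d)\<^sup>2"
proof -
  define g where "g t = gradient p h (x + t \<cdot>\<^sub>v d) \<bullet> d" for t
  have der: "((\<lambda>s. h (x + s \<cdot>\<^sub>v d)) has_real_derivative g t) (at t)" for t
    unfolding g_def
    by (rule has_gradient_line_derivative[OF x d smooth_has_gradient(1)[OF sm]]) (use x d in auto)
  have gd: "\<bar>g t - g 0\<bar> \<le> L * t * (vnorm d)\<^sup>2" if "0 \<le> t" for t
  proof -
    have c: "x + t \<cdot>\<^sub>v d \<in> carrier_vec p" "x + 0 \<cdot>\<^sub>v d \<in> carrier_vec p" using x d by auto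
    note gc = smooth_has_gradient(2)[OF sm c(1)] smooth_has_gradient(2)[OF sm c(2)]
    have "g t - g 0 = (gradient p h (x + t \<cdot>\<^sub>v d) - gradient p h (x + 0 \<cdot>\<^sub>v d)) \<bullet> d"
      unfolding g_def using gc d by (simp add: minus_scalar_prod_distrib[of _ p])
    also have "\<bar>\<dots>\<bar> \<le> vnorm (gradient p h (x + t \<cdot>\<^sub>v d) - gradient p h (x + 0 \<cdot>\<^sub>v d)) * vnorm d"
      by (rule abs_scalar_prod_le[of _ p]) (use gc d in auto)
    also have "\<dots> \<le> L * vnorm (x + t \<cdot>\<^sub>v d - (x + 0 \<cdot>\<^sub>v d)) * vnorm d"
      by (intro mult_right_mono smooth_lipschitz[OF sm c]) auto
    also have "x + t \<cdot>\<^sub>v d - (x + 0 \<cdot>\<^sub>v d) = t \<cdot>\<^sub>v d" using x d by (intro eq_vecI) auto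
    finally show ?thesis using that by (simp add: vnorm_smult power2_eq_square mult_ac)
  qed
  have e: "x + 1 \<cdot>\<^sub>v d = x + d" "x + 0 \<cdot>\<^sub>v d = x" using x d by (auto intro!: eq_vecI)
  define K where "K = L * (vnorm d)\<^sup>2"
  have "h (x + 1 \<cdot>\<^sub>v d) - g 0 * 1 - K / 2 * 1\<^sup>2 \<le> h (x + 0 \<cdot>\<^sub>v d) - g 0 * 0 - K / 2 * 0\<^sup>2"
  proof (rule DERIV_nonpos_imp_nonincreasing[of 0 1 "\<lambda>t. h (x + t \<cdot>\<^sub>v d) - g 0 * t - K / 2 * t\<^sup>2"])
    fix t :: real assume t: "0 \<le> t" "t \<le> 1"
    show "\<exists>y. ((\<lambda>t. h (x + t \<cdot>\<^sub>v d) - g 0 * t - K / 2 * t\<^sup>2) has_real_derivative y) (at t) \<and> y \<le> 0"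
      by (rule exI[of _ "g t - g 0 - K * t"])
        (use gd[OF t(1)] in \<open>auto intro!: derivative_eq_intros der simp: K_def algebra_simps\<close>)
  qed simp
  moreover have "h (x + 0 \<cdot>\<^sub>v d) - g 0 * 0 + K / 2 * 0\<^sup>2 \<le> h (x + 1 \<cdot>\<^sub>v d) - g 0 * 1 + K / 2 * 1\<^sup>2"
  proof (rule DERIV_nonneg_imp_nondecreasing[of 0 1 "\<lambda>t. h (x + t \<cdot>\<^sub>v d) - g 0 * t + K / 2 * t\<^sup>2"])
    fix t :: real assume t: "0 \<le> t" "t \<le> 1"
    show "\<exists>y. ((\<lambda>t. h (x + t \<cdot>\<^sub>v d) - g 0 * t + K / 2 * t\<^sup>2) has_real_derivative y) (at t) \<and> 0 \<le> y"
      by (rule exI[of _ "g t - g 0 + K * t"])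
        (use gd[OF t(1)] in \<open>auto intro!: derivative_eq_intros der simp: K_def algebra_simps\<close>)
  qed simp
  ultimately have "h (x + d) - g 0 - K / 2 \<le> h x" "h x \<le> h (x + d) - g 0 + K / 2"
    by (simp_all add: e)
  moreover have "g 0 = gradient p h x \<bullet> d" by (simp add: g_def e)
  moreover have "L / 2 * (vnorm d)\<^sup>2 = K / 2" by (simp add: K_def)
  ultimately show ?thesis by linarith
qed

text \<open>A gradient step with step size \<open>1 / L\<close> lowers \<open>h\<close> by at least
  \<open>\<parallel>g\<parallel>^2 / (2 L)\<close>, and it cannot go below \<open>m\<close>.\<close>

lemma smooth_self_bound:
  assumes sm: "smooth_with p L h" and L: "0 < L" and x: "x \<in> carrier_vec p"
    and lb: "\<And>y. y \<in> carrier_vec p \<Longrightarrow> m \<le> h y"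
  shows "(vnorm (gradient p h x))\<^sup>2 \<le> 2 * L * (h x - m)"
proof -
  define g where "g = gradient p h x"
  have g: "g \<in> carrier_vec p" using smooth_has_gradient(2)[OF sm x] by (simp add: g_def)
  have "h (x + (- 1 / L) \<cdot>\<^sub>v g) - h x - g \<bullet> ((- 1 / L) \<cdot>\<^sub>v g) \<le> L / 2 * (vnorm ((- 1 / L) \<cdot>\<^sub>v g))\<^sup>2"
    using abs_le_D1[OF smooth_quadratic_bound[OF sm _ x, of "(- 1 / L) \<cdot>\<^sub>v g"]] L g
    by (simp add: g_def)
  moreover have "m \<le> h (x + (- 1 / L) \<cdot>\<^sub>v g)" using x g by (intro lb) auto
  moreover have "g \<bullet> ((- 1 / L) \<cdot>\<^sub>v g) = - (vnorm g)\<^sup>2 / L"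
    using g by (simp add: vnorm_power2)
  moreover have "L / 2 * (vnorm ((- 1 / L) \<cdot>\<^sub>v g))\<^sup>2 = (vnorm g)\<^sup>2 / (2 * L)"
    using L by (simp add: vnorm_smult power_mult_distrib power2_eq_square)
  ultimately have "(vnorm g)\<^sup>2 / L - (vnorm g)\<^sup>2 / (2 * L) \<le> h x - m" by linarith
  moreover have "(vnorm g)\<^sup>2 / L - (vnorm g)\<^sup>2 / (2 * L) = (vnorm g)\<^sup>2 / (2 * L)"
    using L by (simp add: field_simps)
  ultimately show ?thesis using L by (simp add: g_def field_simps)
qed

lemma smooth_withI:
  assumes g: "\<And>x. x \<in> carrier_vec p \<Longrightarrow> g x \<in> carrier_vec p"
    and q: "\<And>x d. x \<in> carrier_vec p \<Longrightarrow> d \<in> carrier_vec p \<Longrightarrow>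
      \<bar>h (x + d) - h x - g x \<bullet> d\<bar> \<le> K * (vnorm d)\<^sup>2"
    and l: "\<And>x y. x \<in> carrier_vec p \<Longrightarrow> y \<in> carrier_vec p \<Longrightarrow> vnorm (g x - g y) \<le> L * vnorm (x - y)"
  shows "smooth_with p L h" "x \<in> carrier_vec p \<Longrightarrow> gradient p h x = g x"
proof -
  have hg: "has_gradient p h (g x) x" if "x \<in> carrier_vec p" for x
    using has_gradient_quadraticI[OF that g[OF that] q[OF that]] .
  have gr: "gradient p h x = g x" if "x \<in> carrier_vec p" for x
    using gradient_eqI[OF that hg[OF that]] .
  then show "x \<in> carrier_vec p \<Longrightarrow> gradient p h x = g x" .
  show "smooth_with p L h" unfolding smooth_with_def using hg gr l by metis
qed

text \<open>Describes the gradient by a fixed sequence of difference quotients. This is what makes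
  it measurable, both in the point and in the sample.\<close>

lemma smooth_gradient_limit:
  assumes sm: "smooth_with p L h" and L: "0 \<le> L" and x: "x \<in> carrier_vec p" and c: "c < p"
  shows "(\<lambda>m. (h (x + (1 / real (Suc m)) \<cdot>\<^sub>v unit_vec p c) - h x) * real (Suc m))
    \<longlonglongrightarrow> gradient p h x $ c"
proof (rule Lim_null_comparison[where g = "\<lambda>m. L / 2 * (1 / real (Suc m))", THEN LIM_zero_cancel])
  show "(\<lambda>m. L / 2 * (1 / real (Suc m))) \<longlonglongrightarrow> 0"
    using tendsto_mult_right_zero[OF LIMSEQ_inverse_real_of_nat, of "L/2"]
    by (simp add: inverse_eq_divide)
  show "\<forall>\<^sub>F m in sequentially. norm ((h (x + (1 / real (Suc m)) \<cdot>\<^sub>v unit_vec p c) - h x) * real (Suc m)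
      - gradient p h x $ c) \<le> L / 2 * (1 / real (Suc m))"
  proof (intro always_eventually allI)
    fix m
    define r where "r = real (Suc m)"
    have r: "r > 0" by (simp add: r_def)
    define v :: "real vec" where "v = (1 / r) \<cdot>\<^sub>v unit_vec p c"
    have v: "v \<in> carrier_vec p" by (simp add: v_def)
    have "gradient p h x \<bullet> v = gradient p h x $ c / r"
      using smooth_has_gradient(2)[OF sm x] c by (simp add: v_def)
    moreover have "vnorm (unit_vec p c :: real vec) = 1"
      using c by (simp add: vnorm_def)
    then have "vnorm v = 1 / r" using r by (simp add: v_def vnorm_smult)
    ultimately have "\<bar>h (x + v) - h x - gradient p h x $ c / r\<bar> \<le> L / 2 * (1 / r)\<^sup>2"
      using smooth_quadratic_bound[OF sm L x v] by simp
    then have "\<bar>h (x + v) - h x - gradient p h x $ c / r\<bar> * r \<le> L / 2 * (1 / r)\<^sup>2 * r"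
      using r by (intro mult_right_mono) auto
    moreover have "\<bar>h (x + v) - h x - gradient p h x $ c / r\<bar> * r = \<bar>(h (x + v) - h x) * r - gradient p h x $ c\<bar>"
      using r by (simp add: abs_mult_pos' abs_mult_pos algebra_simps)
    moreover have "L / 2 * (1 / r)\<^sup>2 * r = L / 2 * (1 / r)"
      using r by (simp add: power2_eq_square)
    ultimately show "norm ((h (x + (1 / real (Suc m)) \<cdot>\<^sub>v unit_vec p c) - h x) * real (Suc m)
        - gradient p h x $ c) \<le> L / 2 * (1 / real (Suc m))"
      unfolding r_def[symmetric] v_def[symmetric] by simp
  qed
qed

section \<open>Measurability of vectors\<close>

lemma space_borel_vec [simp]: "space (borel_vec p) = carrier_vec p"
  by (simp add: borel_vec_def)

lemma measurable_borel_vecI: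
  assumes "\<And>w. w \<in> space M \<Longrightarrow> f w \<in> carrier_vec p"
    and "\<And>c. c < p \<Longrightarrow> (\<lambda>w. f w $ c) \<in> borel_measurable M"
  shows "f \<in> measurable M (borel_vec p)"
  unfolding borel_vec_def
proof (rule measurable_vimage_algebra2)
  show "f \<in> space M \<rightarrow> carrier_vec p" using assms(1) by auto
  show "(\<lambda>x. \<lambda>c\<in>{..<p}. f x $ c) \<in> measurable M (\<Pi>\<^sub>M c\<in>{..<p}. borel)"
    using assms(2) by (intro measurable_restrict) auto
qed

lemma measurable_vec_index:
  assumes f: "f \<in> measurable M (borel_vec p)" and c: "c < p"
  shows "(\<lambda>w. f w $ c) \<in> borel_measurable M"
proof -
  have "(\<lambda>x. \<lambda>c\<in>{..<p}. x $ c) \<in> measurable (borel_vec p) (\<Pi>\<^sub>M c\<in>{..<p}. borel :: real measure)"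
    unfolding borel_vec_def by (rule measurable_vimage_algebra1) (auto simp: space_PiM)
  from measurable_compose[OF f measurable_compose[OF this measurable_component_singleton[of c]]]
  show ?thesis using c by simp
qed

lemma measurable_borel_vec_add:
  assumes "f \<in> measurable M (borel_vec p)" "g \<in> measurable M (borel_vec p)"
  shows "(\<lambda>w. f w + g w) \<in> measurable M (borel_vec p)"
proof (rule measurable_borel_vecI)
  have fg: "f w \<in> carrier_vec p" "g w \<in> carrier_vec p" if "w \<in> space M" for w
    using measurable_space[OF assms(1) that] measurable_space[OF assms(2) that] by auto
  then show "f w + g w \<in> carrier_vec p" if "w \<in> space M" for w using that by auto
  fix c assume c: "c < p"
  have "(\<lambda>w. f w $ c + g w $ c) \<in> borel_measurable M"
    using measurable_vec_index[OF assms(1) c] measurable_vec_index[OF assms(2) c] by measurable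
  then show "(\<lambda>w. (f w + g w) $ c) \<in> borel_measurable M"
    using fg(2)[THEN carrier_vecD] c by (subst measurable_cong[where g = "\<lambda>w. f w $ c + g w $ c"]) auto
qed

lemma measurable_borel_vec_smult:
  assumes "a \<in> borel_measurable M" "g \<in> measurable M (borel_vec p)"
  shows "(\<lambda>w. a w \<cdot>\<^sub>v g w) \<in> measurable M (borel_vec p)"
proof (rule measurable_borel_vecI)
  have fg: "g w \<in> carrier_vec p" if "w \<in> space M" for w
    using measurable_space[OF assms(2) that] by auto
  then show "a w \<cdot>\<^sub>v g w \<in> carrier_vec p" if "w \<in> space M" for w using that by auto
  fix c assume c: "c < p"
  have "(\<lambda>w. a w * g w $ c) \<in> borel_measurable M"
    using measurable_vec_index[OF assms(2) c] assms(1) by measurable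
  then show "(\<lambda>w. (a w \<cdot>\<^sub>v g w) $ c) \<in> borel_measurable M"
    using fg[THEN carrier_vecD] c by (subst measurable_cong[where g = "\<lambda>w. a w * g w $ c"]) auto
qed

lemma measurable_scalar_prod:
  assumes "f \<in> measurable M (borel_vec p)" "g \<in> measurable M (borel_vec p)"
  shows "(\<lambda>w. f w \<bullet> g w) \<in> borel_measurable M"
proof -
  have g: "g w \<in> carrier_vec p" if "w \<in> space M" for w
    using measurable_space[OF assms(2) that] by auto
  have "(\<lambda>w. \<Sum>c<p. f w $ c * g w $ c) \<in> borel_measurable M"
    using measurable_vec_index[OF assms(1)] measurable_vec_index[OF assms(2)]
    by (intro borel_measurable_sum borel_measurable_times) auto
  then show ?thesis
    by (subst measurable_cong[OF scalar_prod_sum[OF g]])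
qed

lemma measurable_vnorm:
  assumes "f \<in> measurable M (borel_vec p)" shows "(\<lambda>w. vnorm (f w)) \<in> borel_measurable M"
  unfolding vnorm_def using measurable_scalar_prod[OF assms assms] by measurable

lemma measurable_gradient:
  assumes sm: "smooth_with p L h" and L: "0 \<le> L" and h: "h \<in> borel_measurable (borel_vec p)"
  shows "gradient p h \<in> measurable (borel_vec p) (borel_vec p)"
proof (rule measurable_borel_vecI)
  show "w \<in> space (borel_vec p) \<Longrightarrow> gradient p h w \<in> carrier_vec p" for w
    using smooth_has_gradient(2)[OF sm] by simp
  fix c assume c: "c < p"
  show "(\<lambda>w. gradient p h w $ c) \<in> borel_measurable (borel_vec p)"
  proof (rule borel_measurable_LIMSEQ_real)
    fix x assume "x \<in> space (borel_vec p)"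
    then show "(\<lambda>m. (h (x + (1 / real (Suc m)) \<cdot>\<^sub>v unit_vec p c) - h x) * real (Suc m))
        \<longlonglongrightarrow> gradient p h x $ c"
      by (intro smooth_gradient_limit[OF sm L _ c]) auto
  next
    fix m
    have "(\<lambda>x. x + (1 / real (Suc m)) \<cdot>\<^sub>v unit_vec p c) \<in> measurable (borel_vec p) (borel_vec p)"
      by (intro measurable_borel_vec_add measurable_const) auto
    from measurable_compose[OF this h] h
    show "(\<lambda>x. (h (x + (1 / real (Suc m)) \<cdot>\<^sub>v unit_vec p c) - h x) * real (Suc m))
      \<in> borel_measurable (borel_vec p)" by measurable
  qed
qed

section \<open>The uniform distribution on the sphere\<close>

abbreviation lebesgue_PiM :: "nat \<Rightarrow> (nat \<Rightarrow> real) measure" where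
  "lebesgue_PiM p \<equiv> \<Pi>\<^sub>M c\<in>{..<p}. lborel"

lemma measurable_PiM_index [measurable]:
  "c < p \<Longrightarrow> (\<lambda>x. x c) \<in> borel_measurable (lebesgue_PiM p)"
  using measurable_component_singleton[of c "{..<p}" "\<lambda>_. lborel :: real measure"] by simp

lemma measurable_PiM_fun_upd:
  assumes c: "c < p" and f: "f \<in> borel_measurable (lebesgue_PiM p)"
  shows "(\<lambda>x. x(c := f x)) \<in> measurable (lebesgue_PiM p) (lebesgue_PiM p)"
  by (rule measurable_fun_upd[where J = "{..<p}"]) (use c f in auto)

text \<open>\<open>k\<close> plays the part of the absolute Jacobian determinant of
  \<open>T\<close>. Stating the change of variables for all nonnegative integrands makes it closed
  under composition at once.\<close>

definition scales_lebesgue :: "nat \<Rightarrow> real \<Rightarrow> ((nat \<Rightarrow> real) \<Rightarrow> (nat \<Rightarrow> real)) \<Rightarrow> bool" where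
  "scales_lebesgue p k T \<longleftrightarrow> 0 \<le> k \<and> T \<in> measurable (lebesgue_PiM p) (lebesgue_PiM p) \<and>
     (\<forall>g\<in>borel_measurable (lebesgue_PiM p).
        ennreal k * (\<integral>\<^sup>+x. g (T x) \<partial>lebesgue_PiM p) = (\<integral>\<^sup>+x. g x \<partial>lebesgue_PiM p))"

lemma scales_lebesgue_comp:
  assumes T: "scales_lebesgue p k T" and U: "scales_lebesgue p l U"
  shows "scales_lebesgue p (k * l) (\<lambda>x. T (U x))"
  unfolding scales_lebesgue_def
proof (intro conjI ballI)
  have mT: "T \<in> measurable (lebesgue_PiM p) (lebesgue_PiM p)"
    and mU: "U \<in> measurable (lebesgue_PiM p) (lebesgue_PiM p)"
    and kl: "0 \<le> k" "0 \<le> l"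
    using T U by (auto simp: scales_lebesgue_def)
  show "0 \<le> k * l" using kl by simp
  show "(\<lambda>x. T (U x)) \<in> measurable (lebesgue_PiM p) (lebesgue_PiM p)"
    by (rule measurable_compose[OF mU mT])
  fix g :: "_ \<Rightarrow> ennreal" assume g: "g \<in> borel_measurable (lebesgue_PiM p)"
  have gT: "(\<lambda>x. g (T x)) \<in> borel_measurable (lebesgue_PiM p)" by (rule measurable_compose[OF mT g])
  have "ennreal (k * l) * (\<integral>\<^sup>+x. g (T (U x)) \<partial>lebesgue_PiM p)
      = ennreal k * (ennreal l * (\<integral>\<^sup>+x. g (T (U x)) \<partial>lebesgue_PiM p))"
    using kl by (simp add: ennreal_mult mult.assoc)
  also have "ennreal l * (\<integral>\<^sup>+x. g (T (U x)) \<partial>lebesgue_PiM p) = (\<integral>\<^sup>+x. g (T x) \<partial>lebesgue_PiM p)"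
    using bspec[OF conjunct2[OF conjunct2[OF U[unfolded scales_lebesgue_def]]] gT] .
  also have "ennreal k * (\<integral>\<^sup>+x. g (T x) \<partial>lebesgue_PiM p) = (\<integral>\<^sup>+x. g x \<partial>lebesgue_PiM p)"
    using bspec[OF conjunct2[OF conjunct2[OF T[unfolded scales_lebesgue_def]]] g] .
  finally show "ennreal (k * l) * (\<integral>\<^sup>+x. g (T (U x)) \<partial>lebesgue_PiM p) = (\<integral>\<^sup>+x. g x \<partial>lebesgue_PiM p)" .
qed

text \<open>Integrate over coordinate \<open>c\<close> first: \<open>\<phi>\<close> does not see it,
  so for fixed other coordinates this is an affine substitution on the line.\<close>

lemma nn_integral_PiM_affine:
  assumes c: "c < p" and a: "a \<noteq> 0"
    and g [measurable]: "g \<in> borel_measurable (lebesgue_PiM p)"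
    and \<phi> [measurable]: "\<phi> \<in> borel_measurable (lebesgue_PiM p)"
    and \<phi>_upd: "\<And>x t. \<phi> (x(c := t)) = \<phi> x"
  shows "ennreal \<bar>a\<bar> * (\<integral>\<^sup>+x. g (x(c := a * x c + \<phi> x)) \<partial>lebesgue_PiM p) = (\<integral>\<^sup>+x. g x \<partial>lebesgue_PiM p)"
proof -
  interpret product_sigma_finite "\<lambda>_. lborel :: real measure" ..
  define I where "I = {..<p} - {c}"
  have I: "finite I" "c \<notin> I" "{..<p} = insert c I" using c by (auto simp: I_def)
  have "(\<lambda>x. x(c := a * x c + \<phi> x)) \<in> measurable (lebesgue_PiM p) (lebesgue_PiM p)"
    using c by (intro measurable_PiM_fun_upd) auto
  from measurable_compose[OF this g]
  have m: "(\<lambda>x. g (x(c := a * x c + \<phi> x))) \<in> borel_measurable (lebesgue_PiM p)" .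
  have "(\<integral>\<^sup>+x. g (x(c := a * x c + \<phi> x)) \<partial>lebesgue_PiM p)
      = (\<integral>\<^sup>+x. \<integral>\<^sup>+y. g (x(c := \<phi> x + a * y)) \<partial>lborel \<partial>(\<Pi>\<^sub>M c\<in>I. lborel))"
    using product_nn_integral_insert[OF I(1,2)] m I(3) by (simp add: \<phi>_upd add.commute)
  moreover have "(\<integral>\<^sup>+x. g x \<partial>lebesgue_PiM p)
      = (\<integral>\<^sup>+x. \<integral>\<^sup>+y. g (x(c := y)) \<partial>lborel \<partial>(\<Pi>\<^sub>M c\<in>I. lborel))"
    using product_nn_integral_insert[OF I(1,2)] g I(3) by simp
  moreover have "(\<integral>\<^sup>+y. g (x(c := y)) \<partial>lborel) = \<bar>a\<bar> * (\<integral>\<^sup>+y. g (x(c := \<phi> x + a * y)) \<partial>lborel)"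
    if x: "x \<in> space (\<Pi>\<^sub>M c\<in>I. lborel)" for x
  proof (rule nn_integral_real_affine[OF _ a])
    have "(\<lambda>y. x(c := y)) \<in> measurable lborel (lebesgue_PiM p)"
      using I by (intro measurable_fun_upd[where J = I] measurable_const) (auto intro: x)
    from measurable_compose[OF this g] show "(\<lambda>y. g (x(c := y))) \<in> borel_measurable borel" by simp
  qed
  ultimately show ?thesis
  proof -
    assume l: "(\<integral>\<^sup>+x. g (x(c := a * x c + \<phi> x)) \<partial>lebesgue_PiM p)
      = (\<integral>\<^sup>+x. \<integral>\<^sup>+y. g (x(c := \<phi> x + a * y)) \<partial>lborel \<partial>(\<Pi>\<^sub>M c\<in>I. lborel))"
      and r: "(\<integral>\<^sup>+x. g x \<partial>lebesgue_PiM p)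
      = (\<integral>\<^sup>+x. \<integral>\<^sup>+y. g (x(c := y)) \<partial>lborel \<partial>(\<Pi>\<^sub>M c\<in>I. lborel))"
      and e: "\<And>x. x \<in> space (\<Pi>\<^sub>M c\<in>I. lborel) \<Longrightarrow>
        (\<integral>\<^sup>+y. g (x(c := y)) \<partial>lborel) = \<bar>a\<bar> * (\<integral>\<^sup>+y. g (x(c := \<phi> x + a * y)) \<partial>lborel)"
    \<comment> \<open>\<open>\<phi>\<close> is known to be measurable on the full product; filling
      coordinate \<open>c\<close> with 0 transfers this to the product over \<open>I\<close> and, by
      \<open>\<phi>_upd\<close>, leaves the value unchanged.\<close>
    have "(\<lambda>(x, y). x(c := \<phi> (x(c := 0)) + a * y)) \<in> measurable ((\<Pi>\<^sub>M c\<in>I. lborel) \<Otimes>\<^sub>M lborel) (lebesgue_PiM p)"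
    proof -
      have "(\<lambda>x. x(c := 0)) \<in> measurable (\<Pi>\<^sub>M c\<in>I. lborel) (lebesgue_PiM p)"
        using I by (intro measurable_fun_upd[where J = I]) auto
      from measurable_compose[OF this \<phi>]
      have [measurable]: "(\<lambda>x. \<phi> (x(c := 0))) \<in> borel_measurable (\<Pi>\<^sub>M c\<in>I. lborel)" .
      show ?thesis
        unfolding split_beta' using I
        by (intro measurable_fun_upd[where J = I]) auto
    qed
    from measurable_compose[OF this g]
    have [measurable]: "(\<lambda>(x, y). g (x(c := \<phi> x + a * y))) \<in> borel_measurable ((\<Pi>\<^sub>M c\<in>I. lborel) \<Otimes>\<^sub>M lborel)"
      by (simp add: \<phi>_upd split_beta')
    show ?thesis
      unfolding l r
      by (subst nn_integral_cmult[symmetric])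
         (auto intro!: nn_integral_cong simp: e intro: lborel.borel_measurable_nn_integral)
  qed
qed

lemma scales_lebesgue_affine:
  assumes "c < p" "a \<noteq> 0" "\<phi> \<in> borel_measurable (lebesgue_PiM p)" "\<And>x t. \<phi> (x(c := t)) = \<phi> x"
  shows "scales_lebesgue p \<bar>a\<bar> (\<lambda>x. x(c := a * x c + \<phi> x))"
  unfolding scales_lebesgue_def
  using assms nn_integral_PiM_affine[of c p a _ \<phi>] by (auto intro!: measurable_PiM_fun_upd)

text \<open>One coordinate of \<open>J\<close> at a time. Coordinate \<open>c\<close> lies outside
  \<open>J\<close>, so every factor of the composition adds a multiple of the same
  \<open>x c\<close>.\<close>

lemma scales_lebesgue_shear:
  assumes c: "c < p" and J: "finite J" "J \<subseteq> {..<p} - {c}"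
  shows "scales_lebesgue p 1 (\<lambda>x j. if j \<in> J then x j + b j * x c else x j)"
  using J
proof (induction J rule: finite_induct)
  case empty
  then show ?case by (simp add: scales_lebesgue_def)
next
  case (insert i J)
  have i: "i < p" "i \<noteq> c" "J \<subseteq> {..<p} - {c}" using insert.prems by auto
  have "scales_lebesgue p \<bar>1\<bar> (\<lambda>x. x(i := 1 * x i + b i * x c))"
    using i c by (intro scales_lebesgue_affine) auto
  from scales_lebesgue_comp[OF this insert.IH[OF i(3)]]
  have "scales_lebesgue p 1 (\<lambda>x. (\<lambda>j. if j \<in> J then x j + b j * x c else x j)
     (i := 1 * (if i \<in> J then x i + b i * x c else x i) + b i * (if c \<in> J then x c + b c * x c else x c)))"
    by simp
  also have "(\<lambda>x. (\<lambda>j. if j \<in> J then x j + b j * x c else x j)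
     (i := 1 * (if i \<in> J then x i + b i * x c else x i) + b i * (if c \<in> J then x c + b c * x c else x c)))
     = (\<lambda>x j. if j \<in> insert i J then x j + b j * x c else x j)"
    using insert.hyps(2) i by (auto simp: fun_eq_iff)
  finally show ?case .
qed

text \<open>With \<open>t = \<langle>w, x\<rangle>\<close> in place of the coordinate \<open>x\<^sub>c\<close>, the reflection along \<open>w\<close> becomes
  the shear \<open>x\<^sub>j \<mapsto> x\<^sub>j - 2 w\<^sub>j t\<close> followed by \<open>t \<mapsto> - t\<close>.\<close>

lemma scales_lebesgue_reflection:
  assumes w: "(\<Sum>j<p. (w j)\<^sup>2) = 1"
  shows "\<exists>T. scales_lebesgue p 1 T \<and>
    (\<forall>x. \<forall>c<p. T x c = x c - 2 * (\<Sum>j<p. w j * x j) * w c)"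
proof -
  have "\<exists>c<p. w c \<noteq> 0"
  proof (rule ccontr)
    assume "\<not> (\<exists>c<p. w c \<noteq> 0)"
    then have "(\<Sum>j<p. (w j)\<^sup>2) = 0" by (intro sum.neutral) auto
    then show False using w by simp
  qed
  then obtain c where c: "c < p" "w c \<noteq> 0" by blast
  define I where "I = {..<p} - {c}"
  have I: "finite I" "c \<notin> I" "{..<p} = insert c I" using c by (auto simp: I_def)
  define s where "s x = (\<Sum>j\<in>I. w j * x j)" for x
  have s_upd: "s (x(c := t)) = s x" for x t
    unfolding s_def using I(2) by (intro sum.cong) auto
  have s_meas: "s \<in> borel_measurable (lebesgue_PiM p)"
    unfolding s_def by (intro borel_measurable_sum borel_measurable_times) (auto simp: I_def)
  have sum_I: "(\<Sum>j<p. w j * x j) = w c * x c + s x" for x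
    using I by (simp add: s_def)
  \<comment> \<open>\<open>A\<close> stores \<open>t\<close> in coordinate \<open>c\<close> and
    \<open>E\<close> solves for \<open>x c\<close> again; their factors
    \<open>\<bar>w c\<bar>\<close> and \<open>\<bar>1 / w c\<bar>\<close> cancel, while
    \<open>B\<close> and \<open>C\<close> have factor 1.\<close>
  define A where "A x = x(c := w c * x c + s x)" for x
  define B where "B x = (\<lambda>j. if j \<in> I then x j + (- 2 * w j) * x c else x j)" for x :: "nat \<Rightarrow> real"
  define C where "C x = x(c := (- 1) * x c + 0)" for x :: "nat \<Rightarrow> real"
  define E where "E x = x(c := (1 / w c) * x c + (- s x / w c))" for x
  have A: "scales_lebesgue p \<bar>w c\<bar> A" unfolding A_def
    by (rule scales_lebesgue_affine[OF c s_meas s_upd])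
  have B: "scales_lebesgue p 1 B" unfolding B_def
    by (rule scales_lebesgue_shear[OF c(1)]) (auto simp: I_def)
  have C: "scales_lebesgue p \<bar>- 1\<bar> C" unfolding C_def
    using c by (intro scales_lebesgue_affine) auto
  have E: "scales_lebesgue p \<bar>1 / w c\<bar> E" unfolding E_def
    using c s_meas by (intro scales_lebesgue_affine) (auto simp: s_upd)
  have sc: "scales_lebesgue p 1 (\<lambda>x. E (C (B (A x))))"
    using scales_lebesgue_comp[OF E scales_lebesgue_comp[OF C scales_lebesgue_comp[OF B A]]] c by simp
  have "E (C (B (A x))) i = x i - 2 * (\<Sum>j<p. w j * x j) * w i" if i: "i < p" for x i
  proof -
    define t where "t = w c * x c + s x"
    have A: "A x = x(c := t)" by (simp add: A_def t_def)
    have B: "B (A x) = (\<lambda>j. if j \<in> I then x j - 2 * w j * t else (A x) j)"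
      unfolding B_def using I(2) by (auto simp: A fun_eq_iff)
    have C: "C (B (A x)) = (B (A x))(c := - t)"
      unfolding C_def B using I(2) by (auto simp: A fun_eq_iff)
    have C: "C (B (A x)) = (\<lambda>j. if j \<in> I then x j - 2 * w j * t else (A x) j)(c := - t)"
      unfolding C unfolding B ..
    \<comment> \<open>The unit length of \<open>w\<close> enters here: the shear changes the rest of
      the scalar product by \<open>- 2 * t * (1 - (w c)^2)\<close>, from which \<open>E\<close>
      recovers exactly the reflected coordinate.\<close>
    have "s (C (B (A x))) = (\<Sum>j\<in>I. w j * x j - 2 * t * (w j)\<^sup>2)"
      unfolding s_def C using I(2) by (intro sum.cong) (auto simp: algebra_simps power2_eq_square)
    also have "\<dots> = s x - 2 * t * (\<Sum>j\<in>I. (w j)\<^sup>2)"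
      by (simp add: s_def sum_subtractf sum_distrib_left)
    also have "(\<Sum>j\<in>I. (w j)\<^sup>2) = 1 - (w c)\<^sup>2"
      using w I by simp
    finally have s': "s (C (B (A x))) = s x - 2 * t * (1 - (w c)\<^sup>2)" .
    show ?thesis
    proof (cases "i = c")
      case True
      have "E (C (B (A x))) i = (1 / w c) * (- t) + - (s x - 2 * t * (1 - (w c)\<^sup>2)) / w c"
        unfolding E_def s' using True by (simp add: C)
      also have "\<dots> = (- t - s x + 2 * t - 2 * t * (w c)\<^sup>2) / w c"
        by (simp add: diff_divide_distrib add_divide_distrib algebra_simps)
      also have "- t - s x + 2 * t - 2 * t * (w c)\<^sup>2 = (x c - 2 * t * w c) * w c"
        by (simp add: t_def power2_eq_square algebra_simps)
      finally show ?thesis using c True by (simp add: sum_I t_def)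
    next
      case False
      then have "i \<in> I" using i by (simp add: I_def)
      then show ?thesis using False by (simp add: E_def C sum_I t_def)
    qed
  qed
  then show ?thesis using sc by blast
qed

text \<open>For a unit vector \<open>w\<close>, the reflection in the hyperplane orthogonal to it.
  These are the only orthogonal maps that the moments on the sphere require.\<close>

definition reflect :: "real vec \<Rightarrow> real vec \<Rightarrow> real vec" where
  "reflect w u = u + (- 2 * (w \<bullet> u)) \<cdot>\<^sub>v w"

lemma reflect_carrier [simp]:
  "w \<in> carrier_vec p \<Longrightarrow> u \<in> carrier_vec p \<Longrightarrow> reflect w u \<in> carrier_vec p"
  by (simp add: reflect_def)

lemma reflect_index:
  "w \<in> carrier_vec p \<Longrightarrow> u \<in> carrier_vec p \<Longrightarrow> c < p \<Longrightarrow> reflect w u $ c = u $ c - 2 * (w \<bullet> u) * w $ c"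
  by (simp add: reflect_def)

lemma measurable_reflect:
  assumes "w \<in> carrier_vec p" shows "reflect w \<in> measurable (borel_vec p) (borel_vec p)"
  unfolding reflect_def[abs_def] using assms
  by (intro measurable_borel_vec_add measurable_borel_vec_smult borel_measurable_times
      measurable_const measurable_scalar_prod measurable_ident) auto

section \<open>Reflection invariance of the uniform distribution on the sphere\<close>

lemma sets_uniform_sphere [simp]: "sets (uniform_sphere p) = sets (borel_vec p)"
  by (simp add: uniform_sphere_def)

lemma space_uniform_sphere [simp]: "space (uniform_sphere p) = carrier_vec p"
  by (simp add: uniform_sphere_def)

lemma measurable_L2_set_PiM:
  "(\<lambda>x. L2_set x {..<p}) \<in> borel_measurable (lebesgue_PiM p)"
proof -
  have [measurable]: "(\<lambda>x. \<Sum>i<p. (x i)\<^sup>2) \<in> borel_measurable (lebesgue_PiM p)"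
    by (intro borel_measurable_sum borel_measurable_power) auto
  show ?thesis unfolding L2_set_def by measurable
qed

lemma sets_unit_ball_PiM:
  "{x \<in> {..<p} \<rightarrow>\<^sub>E UNIV. L2_set x {..<p} \<le> 1} \<in> sets (lebesgue_PiM p)"
proof -
  have "{x \<in> space (lebesgue_PiM p). L2_set x {..<p} \<le> 1} \<in> sets (lebesgue_PiM p)"
    using measurable_L2_set_PiM[of p] by measurable
  then show ?thesis by (simp add: space_PiM)
qed

lemma measurable_normalize:
  "(\<lambda>x. Matrix.vec p (\<lambda>c. x c / L2_set x {..<p})) \<in> measurable (lebesgue_PiM p) (borel_vec p)"
  using measurable_L2_set_PiM[of p]
  by (intro measurable_borel_vecI) (auto intro!: borel_measurable_divide)

lemma nn_integral_uniform_sphere: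
  assumes \<phi>: "\<phi> \<in> borel_measurable (borel_vec p)"
  shows "(\<integral>\<^sup>+u. \<phi> u \<partial>uniform_sphere p) =
    (\<integral>\<^sup>+x. \<phi> (Matrix.vec p (\<lambda>c. x c / L2_set x {..<p})) *
        indicator {x. L2_set x {..<p} \<le> 1} x \<partial>lebesgue_PiM p)
      / emeasure (lebesgue_PiM p) {x \<in> {..<p} \<rightarrow>\<^sub>E UNIV. L2_set x {..<p} \<le> 1}"
proof -
  have m: "(\<lambda>x. \<phi> (Matrix.vec p (\<lambda>c. x c / L2_set x {..<p}))) \<in> borel_measurable (lebesgue_PiM p)"
    by (rule measurable_compose[OF measurable_normalize \<phi>])
  have "(\<integral>\<^sup>+u. \<phi> u \<partial>uniform_sphere p) = (\<integral>\<^sup>+x. \<phi> (Matrix.vec p (\<lambda>c. x c / L2_set x {..<p}))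
    \<partial>uniform_measure (lebesgue_PiM p) {x \<in> {..<p} \<rightarrow>\<^sub>E UNIV. L2_set x {..<p} \<le> 1})"
    unfolding uniform_sphere_def
    by (subst nn_integral_distr) (use measurable_normalize[of p] \<phi> in \<open>auto simp: measurable_def\<close>)
  also have "\<dots> = (\<integral>\<^sup>+x. \<phi> (Matrix.vec p (\<lambda>c. x c / L2_set x {..<p})) *
        indicator {x \<in> {..<p} \<rightarrow>\<^sub>E UNIV. L2_set x {..<p} \<le> 1} x \<partial>lebesgue_PiM p)
      / emeasure (lebesgue_PiM p) {x \<in> {..<p} \<rightarrow>\<^sub>E UNIV. L2_set x {..<p} \<le> 1}"
    by (rule nn_integral_uniform_measure[OF m sets_unit_ball_PiM])
  also have "(\<integral>\<^sup>+x. \<phi> (Matrix.vec p (\<lambda>c. x c / L2_set x {..<p})) *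
        indicator {x \<in> {..<p} \<rightarrow>\<^sub>E UNIV. L2_set x {..<p} \<le> 1} x \<partial>lebesgue_PiM p)
     = (\<integral>\<^sup>+x. \<phi> (Matrix.vec p (\<lambda>c. x c / L2_set x {..<p})) *
        indicator {x. L2_set x {..<p} \<le> 1} x \<partial>lebesgue_PiM p)"
    by (intro nn_integral_cong) (auto simp: space_PiM split: split_indicator)
  finally show ?thesis .
qed

text \<open>The reflection preserves Lebesgue measure and \<open>L2_set\<close>. Hence it maps the
  ball to itself and commutes with the normalization.\<close>

lemma nn_integral_uniform_sphere_reflect:
  assumes w: "w \<in> carrier_vec p" "vnorm w = 1"
    and \<phi>: "\<phi> \<in> borel_measurable (borel_vec p)"
  shows "(\<integral>\<^sup>+u. \<phi> (reflect w u) \<partial>uniform_sphere p) = (\<integral>\<^sup>+u. \<phi> u \<partial>uniform_sphere p)"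
proof -
  have w2: "(\<Sum>j<p. (w $ j)\<^sup>2) = 1" using vnorm_power2_eq_sum[OF w(1)] w(2) by simp
  obtain T where T: "scales_lebesgue p 1 T"
    and T_ix: "\<And>x c. c < p \<Longrightarrow> T x c = x c - 2 * (\<Sum>j<p. w $ j * x j) * w $ c"
    using scales_lebesgue_reflection[OF w2] by blast
  have L2: "L2_set (T x) {..<p} = L2_set x {..<p}" for x
  proof -
    define t where "t = (\<Sum>j<p. w $ j * x j)"
    have "(\<Sum>j<p. (T x j)\<^sup>2) = (\<Sum>j<p. (x j)\<^sup>2 - 4 * t * (w $ j * x j) + 4 * t\<^sup>2 * (w $ j)\<^sup>2)"
    proof (intro sum.cong refl)
      fix j assume "j \<in> {..<p}"
      then have "T x j = x j - 2 * t * w $ j" by (simp add: T_ix t_def)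
      then show "(T x j)\<^sup>2 = (x j)\<^sup>2 - 4 * t * (w $ j * x j) + 4 * t\<^sup>2 * (w $ j)\<^sup>2"
        by (simp only:) (simp add: power2_eq_square algebra_simps)
    qed
    also have "\<dots> = (\<Sum>j<p. (x j)\<^sup>2) - 4 * t * (\<Sum>j<p. w $ j * x j) + 4 * t\<^sup>2 * (\<Sum>j<p. (w $ j)\<^sup>2)"
      by (simp add: sum.distrib sum_subtractf sum_distrib_left)
    also have "\<dots> = (\<Sum>j<p. (x j)\<^sup>2)" unfolding w2 t_def[symmetric] by (simp add: power2_eq_square)
    finally show ?thesis by (simp add: L2_set_def)
  qed
  have refl: "Matrix.vec p (\<lambda>c. T x c / L2_set (T x) {..<p}) = reflect w (Matrix.vec p (\<lambda>c. x c / L2_set x {..<p}))"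
    for x
  proof (intro eq_vecI)
    let ?v = "Matrix.vec p (\<lambda>c. x c / L2_set x {..<p})"
    fix c assume "c < dim_vec (reflect w ?v)"
    then have c: "c < p" using w by (simp add: reflect_def)
    have "w \<bullet> ?v = (\<Sum>j<p. w $ j * x j) / L2_set x {..<p}"
      by (simp add: scalar_prod_sum[of _ p] sum_divide_distrib)
    then show "Matrix.vec p (\<lambda>c. T x c / L2_set (T x) {..<p}) $ c = reflect w ?v $ c"
      using c w by (simp add: reflect_index[of _ p] T_ix L2 diff_divide_distrib)
  qed (use w in \<open>simp add: reflect_def\<close>)
  define g where "g x = \<phi> (Matrix.vec p (\<lambda>c. x c / L2_set x {..<p})) * indicator {x. L2_set x {..<p} \<le> 1} x" for x
  have ind: "indicator {x. L2_set x {..<p} \<le> 1} (T x) = (indicator {x. L2_set x {..<p} \<le> 1} x :: ennreal)" for x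
    by (simp add: indicator_def L2)
  have "g \<in> borel_measurable (lebesgue_PiM p)"
  proof -
    have "(\<lambda>x. indicator {x. L2_set x {..<p} \<le> 1} x :: ennreal) \<in> borel_measurable (lebesgue_PiM p)"
      using measurable_L2_set_PiM[of p] by measurable
    then show ?thesis
      unfolding g_def using measurable_compose[OF measurable_normalize \<phi>]
      by (intro borel_measurable_times_ennreal) auto
  qed
  then have "(\<integral>\<^sup>+x. g (T x) \<partial>lebesgue_PiM p) = (\<integral>\<^sup>+x. g x \<partial>lebesgue_PiM p)"
    using T by (auto simp: scales_lebesgue_def)
  then show ?thesis
    unfolding nn_integral_uniform_sphere[OF \<phi>]
      nn_integral_uniform_sphere[OF measurable_compose[OF measurable_reflect[OF w(1)] \<phi>]]
    by (simp add: g_def refl ind)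
qed

lemma distr_uniform_sphere_reflect:
  assumes w: "w \<in> carrier_vec p" "vnorm w = 1"
  shows "distr (uniform_sphere p) (borel_vec p) (reflect w) = uniform_sphere p"
proof (rule measure_eqI)
  have m: "reflect w \<in> measurable (uniform_sphere p) (borel_vec p)"
    using measurable_reflect[OF w(1)] by (simp add: measurable_def)
  fix A assume "A \<in> sets (distr (uniform_sphere p) (borel_vec p) (reflect w))"
  then have A: "A \<in> sets (borel_vec p)" by simp
  have "emeasure (distr (uniform_sphere p) (borel_vec p) (reflect w)) A
      = (\<integral>\<^sup>+u. indicator A u \<partial>distr (uniform_sphere p) (borel_vec p) (reflect w))"
    using A by simp
  also have "\<dots> = (\<integral>\<^sup>+u. indicator A (reflect w u) \<partial>uniform_sphere p)"
    using A m by (intro nn_integral_distr) auto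
  also have "\<dots> = (\<integral>\<^sup>+u. indicator A u \<partial>uniform_sphere p)"
    using A by (intro nn_integral_uniform_sphere_reflect[OF w]) auto
  also have "\<dots> = emeasure (uniform_sphere p) A" using A by simp
  finally show "emeasure (distr (uniform_sphere p) (borel_vec p) (reflect w)) A = emeasure (uniform_sphere p) A" .
qed simp

lemma integral_uniform_sphere_reflect:
  assumes w: "w \<in> carrier_vec p" "vnorm w = 1" and \<phi>: "\<phi> \<in> borel_measurable (borel_vec p)"
  shows "(\<integral>u. \<phi> (reflect w u) \<partial>uniform_sphere p) = (\<integral>u. \<phi> u \<partial>uniform_sphere p :: real)"
proof -
  have m: "reflect w \<in> measurable (uniform_sphere p) (borel_vec p)"
    using measurable_reflect[OF w(1)] by (simp add: measurable_def)
  show ?thesis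
    using integral_distr[OF m \<phi>] by (simp add: distr_uniform_sphere_reflect[OF w])
qed

text \<open>Normalization fails only at the origin, where division by zero gives the zero vector;
  the origin is a null set because \<open>p \<ge> 1\<close>.\<close>

lemma AE_uniform_sphere_vnorm:
  assumes p: "1 \<le> p"
  shows "AE u in uniform_sphere p. vnorm u = 1"
proof -
  interpret product_sigma_finite "\<lambda>_. lborel :: real measure" ..
  let ?Z = "{x \<in> space (lebesgue_PiM p). L2_set x {..<p} = 0}"
  have Z: "?Z = ({..<p} \<rightarrow>\<^sub>E {0})"
    by (auto simp: L2_set_eq_0_iff space_PiM PiE_iff intro: extensionalityI)
  have "emeasure (lebesgue_PiM p) ?Z = (\<Prod>c<p. emeasure lborel {0::real})"
    unfolding Z by (rule emeasure_PiM) auto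
  also have "\<dots> = 0" using p by simp
  finally have "AE x in lebesgue_PiM p. L2_set x {..<p} \<noteq> 0"
    using measurable_L2_set_PiM[of p] by (intro AE_I[where N = ?Z]) auto
  then have "AE x in uniform_measure (lebesgue_PiM p) {x \<in> {..<p} \<rightarrow>\<^sub>E UNIV. L2_set x {..<p} \<le> 1}.
      L2_set x {..<p} \<noteq> 0"
    by (intro AE_uniform_measureI[OF sets_unit_ball_PiM]) auto
  then have ae: "AE x in uniform_measure (lebesgue_PiM p) {x \<in> {..<p} \<rightarrow>\<^sub>E UNIV. L2_set x {..<p} \<le> 1}.
      vnorm (Matrix.vec p (\<lambda>c. x c / L2_set x {..<p})) = 1"
  proof eventually_elim
    case (elim x)
    have "(vnorm (Matrix.vec p (\<lambda>c. x c / L2_set x {..<p})))\<^sup>2 = (\<Sum>c<p. (x c)\<^sup>2) / (L2_set x {..<p})\<^sup>2"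
      by (simp add: vnorm_power2_eq_sum[of _ p] power_divide sum_divide_distrib)
    also have "\<dots> = 1" using elim by (simp add: L2_set_def sum_nonneg)
    finally show ?case by (metis vnorm_nonneg one_power2 power2_eq_iff_nonneg zero_le_one)
  qed
  have m: "{u \<in> space (borel_vec p). vnorm u = 1} \<in> sets (borel_vec p)"
  proof -
    have [measurable]: "vnorm \<in> borel_measurable (borel_vec p)"
      using measurable_vnorm[OF measurable_ident, of p] by simp
    show ?thesis by measurable
  qed
  show ?thesis unfolding uniform_sphere_def
    by (subst AE_distr_iff) (use ae m measurable_normalize[of p] in \<open>auto simp: measurable_def\<close>)
qed

text \<open>Total mass one is assumed rather than computed from the volume of the ball: it will
  follow from the measure being the distribution of a draw.\<close>

locale sphere =
  fixes p :: nat
  assumes p_ge_1: "1 \<le> p" and prob_uniform_sphere: "prob_space (uniform_sphere p)"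
begin

abbreviation "U \<equiv> uniform_sphere p"

sublocale U: prob_space U by (rule prob_uniform_sphere)

lemma measurable_U: "f \<in> borel_measurable (borel_vec p) \<Longrightarrow> f \<in> borel_measurable U"
  by (simp add: measurable_def)

lemma AE_U: "AE u in U. u \<in> carrier_vec p \<and> vnorm u = 1"
  using AE_uniform_sphere_vnorm[OF p_ge_1] AE_space by eventually_elim simp

lemma integrable_U:
  assumes f: "f \<in> borel_measurable (borel_vec p)"
    and b: "\<And>u. u \<in> carrier_vec p \<Longrightarrow> vnorm u = 1 \<Longrightarrow> \<bar>f u\<bar> \<le> (B::real)"
  shows "integrable U f"
proof (rule U.integrable_const_bound[where B = B])
  show "AE u in U. norm (f u) \<le> B" using AE_U by eventually_elim (use b in auto)
qed (rule measurable_U[OF f])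

lemma measurable_index_borel_vec: "c < p \<Longrightarrow> (\<lambda>u. u $ c) \<in> borel_measurable (borel_vec p)"
  using measurable_vec_index[OF measurable_ident, of c p] by simp

lemma measurable_scalar_prod_right: "w \<in> carrier_vec p \<Longrightarrow> (\<lambda>u. u \<bullet> w) \<in> borel_measurable (borel_vec p)"
  using measurable_scalar_prod[OF measurable_ident measurable_const, of w p] by simp

lemma integrable_index_mult: "a < p \<Longrightarrow> b < p \<Longrightarrow> integrable U (\<lambda>u. u $ a * u $ b)"
proof (rule integrable_U[where B = 1])
  fix u :: "real vec" assume u: "u \<in> carrier_vec p" "vnorm u = 1" and ab: "a < p" "b < p"
  have "\<bar>u $ a\<bar> * \<bar>u $ b\<bar> \<le> 1 * 1"
    using abs_index_le_vnorm[OF u(1)] ab u(2) by (intro mult_mono) auto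
  then show "\<bar>u $ a * u $ b\<bar> \<le> 1" by (simp add: abs_mult)
qed (auto intro!: borel_measurable_times measurable_index_borel_vec)

section \<open>Second moments and smoothing bias on the sphere\<close>

lemma unit_vec_norm: "a < p \<Longrightarrow> vnorm (unit_vec p a :: real vec) = 1"
  by (simp add: vnorm_def)

text \<open>Reflecting along the unit vector of \<open>a\<close> changes the sign of
  \<open>u $ a\<close> and of no other entry, so the integrand is odd.\<close>

lemma integral_index_mult_neq:
  assumes ab: "a < p" "b < p" "a \<noteq> b"
  shows "(\<integral>u. u $ a * u $ b \<partial>U) = 0"
proof -
  let ?w = "unit_vec p a :: real vec"
  have m: "(\<lambda>u. u $ a * u $ b) \<in> borel_measurable (borel_vec p)"
    using ab by (intro borel_measurable_times measurable_index_borel_vec)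
  have "(\<integral>u. u $ a * u $ b \<partial>U) = (\<integral>u. reflect ?w u $ a * reflect ?w u $ b \<partial>U)"
    using integral_uniform_sphere_reflect[OF _ unit_vec_norm m, of a] ab by simp
  also have "\<dots> = (\<integral>u. - (u $ a * u $ b) \<partial>U)"
    using ab by (intro Bochner_Integration.integral_cong)
      (auto simp: reflect_index[of _ p] scalar_prod_left_unit)
  finally show ?thesis by simp
qed

text \<open>The reflection along the normalized difference of the two unit vectors exchanges the
  coordinates \<open>a\<close> and \<open>b\<close>.\<close>

lemma integral_index_square_eq:
  assumes ab: "a < p" "b < p"
  shows "(\<integral>u. (u $ a)\<^sup>2 \<partial>U) = (\<integral>u. (u $ b)\<^sup>2 \<partial>U)"
proof (cases "a = b")
  case False
  define w :: "real vec" where "w = (1 / sqrt 2) \<cdot>\<^sub>v (unit_vec p a - unit_vec p b)"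
  have w: "w \<in> carrier_vec p" by (simp add: w_def)
  have w_ix: "w $ c = (if c = a then 1 / sqrt 2 else if c = b then - 1 / sqrt 2 else 0)" if "c < p" for c
    using that ab False by (auto simp: w_def)
  have wu: "w \<bullet> u = (u $ a - u $ b) / sqrt 2" if "u \<in> carrier_vec p" for u
  proof -
    have "w \<bullet> u = (1 / sqrt 2) * (unit_vec p a \<bullet> u - unit_vec p b \<bullet> u)"
      unfolding w_def using that by (simp add: minus_scalar_prod_distrib[of _ p])
    then show ?thesis using ab that by (simp add: scalar_prod_left_unit)
  qed
  have "(vnorm w)\<^sup>2 = 1"
    using wu[OF w] w_ix[of a] w_ix[of b] ab False by (simp add: vnorm_power2[OF w] field_simps)
  then have w1: "vnorm w = 1" using vnorm_nonneg[of w] by (simp add: power2_eq_1_iff)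
  have m: "(\<lambda>u. (u $ a)\<^sup>2) \<in> borel_measurable (borel_vec p)"
    using ab by (intro borel_measurable_power measurable_index_borel_vec)
  have "(\<integral>u. (u $ a)\<^sup>2 \<partial>U) = (\<integral>u. (reflect w u $ a)\<^sup>2 \<partial>U)"
    using integral_uniform_sphere_reflect[OF w w1 m] by simp
  also have "\<dots> = (\<integral>u. (u $ b)\<^sup>2 \<partial>U)"
  proof (intro Bochner_Integration.integral_cong refl)
    fix u assume "u \<in> space U"
    then have u: "u \<in> carrier_vec p" by simp
    have "reflect w u $ a = u $ a - 2 * ((u $ a - u $ b) / sqrt 2) * (1 / sqrt 2)"
      using ab w_ix[of a] by (simp add: reflect_index[OF w u] wu[OF u])
    also have "\<dots> = u $ b" by (simp add: field_simps)
    finally show "(reflect w u $ a)\<^sup>2 = (u $ b)\<^sup>2" by simp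
  qed
  finally show ?thesis .
qed simp

text \<open>On the diagonal, \<open>p\<close> equal second moments add up to the squared norm, which
  is 1.\<close>

lemma integral_index_mult:
  assumes ab: "a < p" "b < p"
  shows "(\<integral>u. u $ a * u $ b \<partial>U) = (if a = b then 1 / real p else 0)"
proof (cases "a = b")
  case True
  have "(\<Sum>c<p. \<integral>u. (u $ c)\<^sup>2 \<partial>U) = (\<integral>u. (\<Sum>c<p. (u $ c)\<^sup>2) \<partial>U)"
    using integrable_index_mult by (intro Bochner_Integration.integral_sum[symmetric]) (simp add: power2_eq_square)
  also have "\<dots> = (\<integral>u. 1 \<partial>U)"
  proof (rule integral_cong_AE)
    show "AE u in U. (\<Sum>c<p. (u $ c)\<^sup>2) = 1"
      using AE_U
    proof eventually_elim
      case (elim u)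
      then show ?case using vnorm_power2_eq_sum[of u p] by simp
    qed
    show "(\<lambda>u. \<Sum>c<p. (u $ c)\<^sup>2) \<in> borel_measurable U"
      by (intro measurable_U borel_measurable_sum borel_measurable_power measurable_index_borel_vec) auto
  qed simp
  also have "\<dots> = 1" using U.prob_space by simp
  finally have "(\<Sum>c<p. \<integral>u. (u $ c)\<^sup>2 \<partial>U) = 1" .
  moreover have "(\<Sum>c<p. \<integral>u. (u $ c)\<^sup>2 \<partial>U) = (\<Sum>c<p. \<integral>u. (u $ a)\<^sup>2 \<partial>U)"
    by (intro sum.cong refl integral_index_square_eq) (use ab in auto)
  ultimately show ?thesis using True p_ge_1 by (simp add: power2_eq_square field_simps)
qed (use integral_index_mult_neq[OF ab] in simp)

text \<open>Isotropy: the covariance matrix is the identity divided by \<open>p\<close>. This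
  \<open>1 / p\<close> is what tames the factor \<open>p\<close> in the estimator.\<close>

lemma integral_scalar_prods:
  assumes v: "v \<in> carrier_vec p" and w: "w \<in> carrier_vec p"
  shows "(\<integral>u. (u \<bullet> v) * (u \<bullet> w) \<partial>U) = (v \<bullet> w) / real p" "integrable U (\<lambda>u. (u \<bullet> v) * (u \<bullet> w))"
proof -
  have e: "(\<lambda>u. (u \<bullet> v) * (u \<bullet> w)) = (\<lambda>u. \<Sum>a<p. \<Sum>b<p. (v $ a * w $ b) * (u $ a * u $ b))"
    using v w by (simp add: scalar_prod_sum[of _ p] sum_product fun_eq_iff mult_ac)
  show i: "integrable U (\<lambda>u. (u \<bullet> v) * (u \<bullet> w))"
    unfolding e by (intro Bochner_Integration.integrable_sum integrable_mult_right integrable_index_mult) auto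
  have "(\<integral>u. (u \<bullet> v) * (u \<bullet> w) \<partial>U) = (\<Sum>a<p. \<integral>u. (\<Sum>b<p. (v $ a * w $ b) * (u $ a * u $ b)) \<partial>U)"
    unfolding e by (rule Bochner_Integration.integral_sum) (auto intro!: Bochner_Integration.integrable_sum simp: integrable_index_mult)
  also have "\<dots> = (\<Sum>a<p. \<Sum>b<p. \<integral>u. (v $ a * w $ b) * (u $ a * u $ b) \<partial>U)"
    by (intro sum.cong refl Bochner_Integration.integral_sum) (auto simp: integrable_index_mult)
  also have "\<dots> = (\<Sum>a<p. \<Sum>b<p. (v $ a * w $ b) * (\<integral>u. u $ a * u $ b \<partial>U))" by simp
  also have "\<dots> = (\<Sum>a<p. \<Sum>b<p. if a = b then v $ a * w $ b / real p else 0)"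
    by (intro sum.cong) (auto simp: integral_index_mult)
  also have "\<dots> = (v \<bullet> w) / real p"
    using w by (simp add: sum.delta scalar_prod_sum[of _ p] sum_divide_distrib)
  finally show "(\<integral>u. (u \<bullet> v) * (u \<bullet> w) \<partial>U) = (v \<bullet> w) / real p" .
qed

lemma nn_integral_scalar_prod_power2:
  assumes v: "v \<in> carrier_vec p"
  shows "(\<integral>\<^sup>+u. ennreal ((u \<bullet> v)\<^sup>2) \<partial>U) = ennreal ((vnorm v)\<^sup>2 / real p)"
  using integral_scalar_prods[OF v v]
  by (subst nn_integral_eq_integral) (auto simp: power2_eq_square vnorm_power2[OF v, symmetric])

lemma vnorm_reflect:
  assumes "w \<in> carrier_vec p" "vnorm w = 1" "u \<in> carrier_vec p"
  shows "vnorm (reflect w u) = vnorm u" "reflect w u \<bullet> w = - (u \<bullet> w)"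
    "vnorm (u - reflect w u) = 2 * \<bar>u \<bullet> w\<bar>"
proof -
  have ww: "w \<bullet> w = 1" using vnorm_power2[OF assms(1)] assms(2) by simp
  have c: "w \<bullet> u = u \<bullet> w" using assms by (intro comm_scalar_prod)
  show rw: "reflect w u \<bullet> w = - (u \<bullet> w)"
    using assms c ww by (simp add: reflect_def add_scalar_prod_distrib[of _ p])
  have "(vnorm (reflect w u))\<^sup>2 = reflect w u \<bullet> (u + (- 2 * (w \<bullet> u)) \<cdot>\<^sub>v w)"
    using assms by (simp add: vnorm_power2[of _ p]) (simp add: reflect_def)
  also have "\<dots> = reflect w u \<bullet> u + (- 2 * (w \<bullet> u)) * (reflect w u \<bullet> w)"
    using assms by (subst scalar_prod_add_distrib[of _ p]) auto
  also have "reflect w u \<bullet> u = u \<bullet> u - 2 * (w \<bullet> u) * (w \<bullet> u)"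
    using assms by (simp add: reflect_def add_scalar_prod_distrib[of _ p])
  finally have "(vnorm (reflect w u))\<^sup>2 = (vnorm u)\<^sup>2"
    using assms(3) by (simp add: rw c vnorm_power2)
  then show "vnorm (reflect w u) = vnorm u" by simp
  have "u - reflect w u = (2 * (w \<bullet> u)) \<cdot>\<^sub>v w"
    using assms by (intro eq_vecI) (auto simp: reflect_def)
  then show "vnorm (u - reflect w u) = 2 * \<bar>u \<bullet> w\<bar>"
    using assms(2) by (simp add: vnorm_smult c abs_mult)
qed

text \<open>Comparing \<open>u\<close> with its reflection along \<open>w\<close> keeps the smoothing bias free of the dimension:
  the linearization error is odd up to \<open>\<delta>\<^sup>2 L \<bar>\<langle>u, w\<rangle>\<bar>\<close>, which gains the factor \<open>1/p\<close> from
  the second moment of \<open>\<langle>u, w\<rangle>\<close>.\<close>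

lemma smoothing_bias_unit:
  assumes sm: "smooth_with p L h" and L: "0 \<le> L" and h: "h \<in> borel_measurable (borel_vec p)"
    and x: "x \<in> carrier_vec p" and \<delta>: "0 < \<delta>"
    and w: "w \<in> carrier_vec p" "vnorm w = 1"
  shows "integrable U (\<lambda>u. (h (x + \<delta> \<cdot>\<^sub>v u) - h x) * (u \<bullet> w))"
    "\<bar>real p / \<delta> * (\<integral>u. (h (x + \<delta> \<cdot>\<^sub>v u) - h x) * (u \<bullet> w) \<partial>U) - gradient p h x \<bullet> w\<bar> \<le> \<delta> * L"
proof -
  define g where "g = gradient p h x"
  have g: "g \<in> carrier_vec p" using smooth_has_gradient(2)[OF sm x] by (simp add: g_def)
  define r where "r u = h (x + \<delta> \<cdot>\<^sub>v u) - h x - \<delta> * (u \<bullet> g)" for u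
  have hm: "(\<lambda>u. h (x + \<delta> \<cdot>\<^sub>v u)) \<in> borel_measurable (borel_vec p)"
    by (rule measurable_compose[OF measurable_borel_vec_add[OF measurable_const
          measurable_borel_vec_smult[OF measurable_const measurable_ident, simplified]] h])
      (use x in auto)
  have rm: "r \<in> borel_measurable (borel_vec p)"
    unfolding r_def[abs_def] using hm measurable_scalar_prod_right[OF g] by measurable
  have rwm: "(\<lambda>u. r u * (u \<bullet> w)) \<in> borel_measurable (borel_vec p)"
    by (intro borel_measurable_times rm measurable_scalar_prod_right w)
  have uw: "\<bar>u \<bullet> w\<bar> \<le> 1" if "u \<in> carrier_vec p" "vnorm u = 1" for u
    using abs_scalar_prod_le[OF that(1) w(1)] that w by simp
  have rb: "\<bar>r u\<bar> \<le> L / 2 * \<delta>\<^sup>2" if u: "u \<in> carrier_vec p" "vnorm u = 1" for u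
    using smooth_quadratic_bound[OF sm L x, of "\<delta> \<cdot>\<^sub>v u"] u g \<delta>
    by (simp add: r_def g_def vnorm_smult comm_scalar_prod[of u p])
  have ri: "integrable U (\<lambda>u. r u * (u \<bullet> w))"
  proof (rule integrable_U[OF rwm, of "L / 2 * \<delta>\<^sup>2 * 1"])
    fix u :: "real vec" assume u: "u \<in> carrier_vec p" "vnorm u = 1"
    show "\<bar>r u * (u \<bullet> w)\<bar> \<le> L / 2 * \<delta>\<^sup>2 * 1"
      unfolding abs_mult using rb[OF u] uw[OF u] L by (intro mult_mono) auto
  qed
  \<comment> \<open>The linear part integrates to \<open>\<delta> * (g \<bullet> w) / p\<close>,
    which the factor \<open>p / \<delta>\<close> turns into exactly \<open>g \<bullet> w\<close>;
    all of the bias sits in the remainder \<open>r\<close>.\<close>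
  have eq: "(h (x + \<delta> \<cdot>\<^sub>v u) - h x) * (u \<bullet> w) = r u * (u \<bullet> w) + \<delta> * ((u \<bullet> g) * (u \<bullet> w))" for u
    by (simp add: r_def algebra_simps)
  note gw = integral_scalar_prods[OF g w(1)]
  show "integrable U (\<lambda>u. (h (x + \<delta> \<cdot>\<^sub>v u) - h x) * (u \<bullet> w))"
    unfolding eq using ri gw(2) by (intro Bochner_Integration.integrable_add integrable_mult_right)
  define J where "J = (\<integral>u. r u * (u \<bullet> w) \<partial>U)"
  have I: "(\<integral>u. (h (x + \<delta> \<cdot>\<^sub>v u) - h x) * (u \<bullet> w) \<partial>U) = J + \<delta> * ((g \<bullet> w) / real p)"
    unfolding eq J_def using ri gw by simp
  have rrm: "(\<lambda>u. r (reflect w u)) \<in> borel_measurable (borel_vec p)"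
    by (rule measurable_compose[OF measurable_reflect[OF w(1)] rm])
  have rri: "integrable U (\<lambda>u. r (reflect w u) * (u \<bullet> w))"
  proof (rule integrable_U[of _ "L / 2 * \<delta>\<^sup>2 * 1"])
    show "(\<lambda>u. r (reflect w u) * (u \<bullet> w)) \<in> borel_measurable (borel_vec p)"
      by (intro borel_measurable_times rrm measurable_scalar_prod_right w)
    fix u :: "real vec" assume u: "u \<in> carrier_vec p" "vnorm u = 1"
    show "\<bar>r (reflect w u) * (u \<bullet> w)\<bar> \<le> L / 2 * \<delta>\<^sup>2 * 1"
      unfolding abs_mult using rb[of "reflect w u"] uw[OF u] L u w
      by (intro mult_mono) (auto simp: vnorm_reflect)
  qed
  have "J = (\<integral>u. r (reflect w u) * (reflect w u \<bullet> w) \<partial>U)"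
    unfolding J_def using integral_uniform_sphere_reflect[OF w rwm] by simp
  also have "\<dots> = (\<integral>u. - (r (reflect w u) * (u \<bullet> w)) \<partial>U)"
    using w by (intro Bochner_Integration.integral_cong) (auto simp: vnorm_reflect)
  finally have "J = - (\<integral>u. r (reflect w u) * (u \<bullet> w) \<partial>U)" by simp
  \<comment> \<open>Averaging \<open>J\<close> with its reflected form leaves only the part of
    \<open>r\<close> that is odd under the reflection, and this part is small where \<open>u\<close>
    is nearly orthogonal to \<open>w\<close>.\<close>
  then have J2: "2 * J = (\<integral>u. (r u - r (reflect w u)) * (u \<bullet> w) \<partial>U)"
    using ri rri by (simp add: J_def left_diff_distrib)
  have pt: "\<bar>(r u - r (reflect w u)) * (u \<bullet> w)\<bar> \<le> 2 * L * \<delta>\<^sup>2 * ((u \<bullet> w) * (u \<bullet> w))"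
    if u: "u \<in> carrier_vec p" "vnorm u = 1" for u
  proof -
    define v where "v = reflect w u"
    have v: "v \<in> carrier_vec p" "vnorm v = 1" "vnorm (u - v) = 2 * \<bar>u \<bullet> w\<bar>"
      using u w vnorm_reflect[OF w u(1)] by (auto simp: v_def)
    define a where "a = x + \<delta> \<cdot>\<^sub>v v"
    define d where "d = \<delta> \<cdot>\<^sub>v (u - v)"
    have ad: "a \<in> carrier_vec p" "d \<in> carrier_vec p" using x u v by (auto simp: a_def d_def)
    \<comment> \<open>Mean value form between the reflected point and the original one. The
      intermediate point is a convex combination of points at distance \<open>\<delta>\<close> from
      \<open>x\<close>, so the gradient there is within \<open>L * \<delta>\<close> of
      \<open>g\<close>, and \<open>\<parallel>d\<parallel>\<close> is
      \<open>2 * \<delta> * \<bar>u \<bullet> w\<bar>\<close>.\<close>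
    obtain t where t: "0 < t" "t < 1" "h (a + d) - h a = gradient p h (a + t \<cdot>\<^sub>v d) \<bullet> d"
      using smooth_mean_value[OF sm ad] by blast
    have "a + d = x + \<delta> \<cdot>\<^sub>v u" using x u v by (intro eq_vecI) (auto simp: a_def d_def algebra_simps)
    then have "r u - r v = gradient p h (a + t \<cdot>\<^sub>v d) \<bullet> d - \<delta> * (u \<bullet> g - v \<bullet> g)"
      using t(3) by (simp add: r_def a_def algebra_simps)
    also have "\<delta> * (u \<bullet> g - v \<bullet> g) = g \<bullet> d"
      unfolding d_def using u v g
      by (simp add: minus_scalar_prod_distrib[of _ p, symmetric] comm_scalar_prod[of g p])
    also have "gradient p h (a + t \<cdot>\<^sub>v d) \<bullet> d - g \<bullet> d = (gradient p h (a + t \<cdot>\<^sub>v d) - g) \<bullet> d"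
      using ad g smooth_has_gradient(2)[OF sm, of "a + t \<cdot>\<^sub>v d"]
      by (subst minus_scalar_prod_distrib[of _ p]) auto
    also have "\<bar>\<dots>\<bar> \<le> vnorm (gradient p h (a + t \<cdot>\<^sub>v d) - g) * vnorm d"
      using ad g smooth_has_gradient(2)[OF sm, of "a + t \<cdot>\<^sub>v d"] by (intro abs_scalar_prod_le[of _ p]) auto
    also have "\<dots> \<le> (L * vnorm (a + t \<cdot>\<^sub>v d - x)) * vnorm d"
      unfolding g_def using ad x by (intro mult_right_mono smooth_lipschitz[OF sm]) auto
    also have "\<dots> \<le> (L * \<delta>) * vnorm d"
    proof (intro mult_right_mono mult_left_mono)
      have "a + t \<cdot>\<^sub>v d - x = ((1 - t) * \<delta>) \<cdot>\<^sub>v v + (t * \<delta>) \<cdot>\<^sub>v u"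
        using x u v by (intro eq_vecI) (auto simp: a_def d_def algebra_simps)
      also have "vnorm \<dots> \<le> vnorm (((1 - t) * \<delta>) \<cdot>\<^sub>v v) + vnorm ((t * \<delta>) \<cdot>\<^sub>v u)"
        using u v by (intro vnorm_add_le[of _ p]) auto
      also have "\<dots> = \<delta>" using t \<delta> u v by (simp add: vnorm_smult abs_mult algebra_simps)
      finally show "vnorm (a + t \<cdot>\<^sub>v d - x) \<le> \<delta>" .
    qed (use L in auto)
    also have "vnorm d = \<delta> * (2 * \<bar>u \<bullet> w\<bar>)" using \<delta> v by (simp add: d_def vnorm_smult)
    finally have "\<bar>r u - r v\<bar> \<le> 2 * L * \<delta>\<^sup>2 * \<bar>u \<bullet> w\<bar>" by (simp add: power2_eq_square mult_ac)
    then have "\<bar>r u - r v\<bar> * \<bar>u \<bullet> w\<bar> \<le> 2 * L * \<delta>\<^sup>2 * \<bar>u \<bullet> w\<bar> * \<bar>u \<bullet> w\<bar>" by (intro mult_right_mono) auto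
    then show ?thesis by (simp add: v_def abs_mult mult.assoc)
  qed
  note ww = integral_scalar_prods[OF w(1) w(1)]
  have "\<bar>2 * J\<bar> \<le> (\<integral>u. \<bar>(r u - r (reflect w u)) * (u \<bullet> w)\<bar> \<partial>U)"
    unfolding J2 by (rule integral_abs_bound)
  also have "\<dots> \<le> (\<integral>u. 2 * L * \<delta>\<^sup>2 * ((u \<bullet> w) * (u \<bullet> w)) \<partial>U)"
  proof (rule integral_mono_AE)
    show "integrable U (\<lambda>u. \<bar>(r u - r (reflect w u)) * (u \<bullet> w)\<bar>)"
      using Bochner_Integration.integrable_diff[OF ri rri] by (intro integrable_abs) (simp add: left_diff_distrib)
    show "integrable U (\<lambda>u. 2 * L * \<delta>\<^sup>2 * ((u \<bullet> w) * (u \<bullet> w)))"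
      using ww(2) by (rule integrable_mult_right)
    show "AE u in U. \<bar>(r u - r (reflect w u)) * (u \<bullet> w)\<bar> \<le> 2 * L * \<delta>\<^sup>2 * ((u \<bullet> w) * (u \<bullet> w))"
      using AE_U by eventually_elim (use pt in auto)
  qed
  also have "\<dots> = 2 * L * \<delta>\<^sup>2 / real p"
    using ww vnorm_power2[OF w(1)] w(2) by simp
  finally have "\<bar>J\<bar> \<le> L * \<delta>\<^sup>2 / real p" by simp
  then have "real p / \<delta> * \<bar>J\<bar> \<le> real p / \<delta> * (L * \<delta>\<^sup>2 / real p)"
    using \<delta> by (intro mult_left_mono) auto
  also have "\<dots> = \<delta> * L" using \<delta> p_ge_1 by (simp add: power2_eq_square)
  finally have "real p / \<delta> * \<bar>J\<bar> \<le> \<delta> * L" .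
  moreover have "real p / \<delta> * (J + \<delta> * ((g \<bullet> w) / real p)) - g \<bullet> w = real p / \<delta> * J"
    using \<delta> p_ge_1 by (simp add: field_simps)
  ultimately show "\<bar>real p / \<delta> * (\<integral>u. (h (x + \<delta> \<cdot>\<^sub>v u) - h x) * (u \<bullet> w) \<partial>U) - gradient p h x \<bullet> w\<bar> \<le> \<delta> * L"
    using \<delta> unfolding I g_def[symmetric] by (simp add: abs_mult)
qed

text \<open>Homogeneity in \<open>w\<close> reduces this to a unit vector; only the zero vector
  cannot be normalized, and there both terms vanish.\<close>

lemma smoothing_bias:
  assumes sm: "smooth_with p L h" and L: "0 \<le> L" and h: "h \<in> borel_measurable (borel_vec p)"
    and x: "x \<in> carrier_vec p" and \<delta>: "0 < \<delta>" and w: "w \<in> carrier_vec p"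
  shows "\<bar>real p / \<delta> * (\<integral>u. (h (x + \<delta> \<cdot>\<^sub>v u) - h x) * (u \<bullet> w) \<partial>U) - gradient p h x \<bullet> w\<bar> \<le> \<delta> * L * vnorm w"
proof (cases "vnorm w = 0")
  case True
  then have w0: "w = 0\<^sub>v p" using vnorm_eq_0_imp[OF w] by simp
  have "gradient p h x \<bullet> w = 0" using smooth_has_gradient(2)[OF sm x] by (simp add: w0)
  moreover have "(\<integral>u. (h (x + \<delta> \<cdot>\<^sub>v u) - h x) * (u \<bullet> w) \<partial>U) = (\<integral>u. 0 \<partial>U)"
    by (intro Bochner_Integration.integral_cong) (auto simp: w0)
  ultimately show ?thesis using L \<delta> by simp
next
  case False
  then have pos: "vnorm w > 0" using vnorm_nonneg[of w] by linarith
  define v where "v = (1 / vnorm w) \<cdot>\<^sub>v w"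
  have v: "v \<in> carrier_vec p" "vnorm v = 1" using w pos by (auto simp: v_def vnorm_smult)
  have wv: "w = vnorm w \<cdot>\<^sub>v v" using pos w by (intro eq_vecI) (auto simp: v_def)
  have uw: "u \<bullet> w = vnorm w * (u \<bullet> v)" if "u \<in> carrier_vec p" for u
    by (subst wv) (use v that in simp)
  have "(\<integral>u. (h (x + \<delta> \<cdot>\<^sub>v u) - h x) * (u \<bullet> w) \<partial>U) = (\<integral>u. vnorm w * ((h (x + \<delta> \<cdot>\<^sub>v u) - h x) * (u \<bullet> v)) \<partial>U)"
    by (intro Bochner_Integration.integral_cong) (auto simp: uw)
  also have "\<dots> = vnorm w * (\<integral>u. (h (x + \<delta> \<cdot>\<^sub>v u) - h x) * (u \<bullet> v) \<partial>U)" by simp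
  finally have e: "real p / \<delta> * (\<integral>u. (h (x + \<delta> \<cdot>\<^sub>v u) - h x) * (u \<bullet> w) \<partial>U) - gradient p h x \<bullet> w
      = vnorm w * (real p / \<delta> * (\<integral>u. (h (x + \<delta> \<cdot>\<^sub>v u) - h x) * (u \<bullet> v) \<partial>U) - gradient p h x \<bullet> v)"
    using uw[OF smooth_has_gradient(2)[OF sm x]] by (simp add: algebra_simps)
  show ?thesis unfolding e abs_mult
    using mult_left_mono[OF smoothing_bias_unit(2)[OF sm L h x \<delta> v], of "vnorm w"]
    by (simp add: mult_ac)
qed

end

section \<open>The gradient estimator of one agent\<close>

lemma integral_abs_le_const:
  assumes "prob_space M" "AE z in M. \<bar>h z\<bar> \<le> (B::real)" "0 \<le> B"
  shows "\<bar>\<integral>z. h z \<partial>M\<bar> \<le> B"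
proof -
  interpret prob_space M by fact
  show ?thesis
  proof (cases "integrable M h")
    case True
    have "\<bar>\<integral>z. h z \<partial>M\<bar> \<le> (\<integral>z. \<bar>h z\<bar> \<partial>M)" by (rule integral_abs_bound)
    also have "\<dots> \<le> (\<integral>z. B \<partial>M)"
      using True assms(2) by (intro integral_mono_AE) auto
    finally show ?thesis by (simp add: prob_space)
  next
    \<comment> \<open>The integral then has its default value 0, which the bound covers because
      \<open>0 \<le> B\<close>.\<close>
    case False
    then show ?thesis using assms(3) by (simp add: not_integrable_integral_eq)
  qed
qed

locale agent = sphere p for p +
  fixes D :: "'b measure" and F :: "real vec \<Rightarrow> 'b \<Rightarrow> real" and L \<sigma>\<^sub>0 \<sigma>\<^sub>1 :: real and f :: "real vec \<Rightarrow> real"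
  assumes prob_D: "prob_space D"
    and F_measurable: "(\<lambda>(x, z). F x z) \<in> borel_measurable (borel_vec p \<Otimes>\<^sub>M D)"
    and F_integrable: "\<And>x. x \<in> carrier_vec p \<Longrightarrow> integrable D (F x)"
    and L_pos: "0 < L"
    and F_smooth: "AE z in D. smooth_with p L (\<lambda>y. F y z)"
    and f_def: "f = (\<lambda>x. \<integral>z. F x z \<partial>D)"
    and variance: "\<And>x. x \<in> carrier_vec p \<Longrightarrow>
      (\<integral>\<^sup>+z. ennreal ((vnorm (gradient p (\<lambda>y. F y z) x - gradient p f x))\<^sup>2) \<partial>D)
        \<le> ennreal (\<sigma>\<^sub>0\<^sup>2 * (vnorm (gradient p f x))\<^sup>2 + \<sigma>\<^sub>1\<^sup>2)"
begin

sublocale D: prob_space D by (rule prob_D)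

text \<open>Unlike \<open>gradient\<close>, this is measurable in \<open>z\<close> also where \<open>F (\<cdot>, z)\<close> is not smooth.\<close>

definition limit_gradient :: "real vec \<Rightarrow> 'b \<Rightarrow> real vec" where
  "limit_gradient x z = Matrix.vec p (\<lambda>c. lim (\<lambda>m.
     (F (x + (1 / real (Suc m)) \<cdot>\<^sub>v unit_vec p c) z - F x z) * real (Suc m)))"

lemma limit_gradient_carrier [simp]: "limit_gradient x z \<in> carrier_vec p"
  by (simp add: limit_gradient_def)

lemma F_measurable_fixed: "x \<in> carrier_vec p \<Longrightarrow> F x \<in> borel_measurable D"
  using F_integrable by auto

lemma measurable_limit_gradient:
  assumes x: "x \<in> carrier_vec p" shows "limit_gradient x \<in> measurable D (borel_vec p)"
proof (rule measurable_borel_vecI)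
  fix c assume c: "c < p"
  have "(\<lambda>z. lim (\<lambda>m. (F (x + (1 / real (Suc m)) \<cdot>\<^sub>v unit_vec p c) z - F x z) * real (Suc m)))
    \<in> borel_measurable D"
    using x by (intro borel_measurable_lim_metric borel_measurable_times borel_measurable_diff F_measurable_fixed) auto
  then show "(\<lambda>z. limit_gradient x z $ c) \<in> borel_measurable D"
    using c by (simp add: limit_gradient_def)
qed simp

lemma limit_gradient_eq:
  assumes "smooth_with p L (\<lambda>y. F y z)" "x \<in> carrier_vec p"
  shows "limit_gradient x z = gradient p (\<lambda>y. F y z) x"
proof (intro eq_vecI)
  have g: "gradient p (\<lambda>y. F y z) x \<in> carrier_vec p" by (rule smooth_has_gradient(2)[OF assms])
  fix c assume "c < dim_vec (gradient p (\<lambda>y. F y z) x)"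
  then have c: "c < p" using g by simp
  show "limit_gradient x z $ c = gradient p (\<lambda>y. F y z) x $ c"
    using limI[OF smooth_gradient_limit[OF assms(1) _ assms(2) c]] L_pos c by (simp add: limit_gradient_def)
qed (use smooth_has_gradient(2)[OF assms] in \<open>simp add: limit_gradient_def\<close>)

lemma F_quadratic_bound:
  assumes "x \<in> carrier_vec p" "d \<in> carrier_vec p"
  shows "AE z in D. \<bar>F (x + d) z - F x z - limit_gradient x z \<bullet> d\<bar> \<le> L / 2 * (vnorm d)\<^sup>2"
  using F_smooth
proof eventually_elim
  case (elim z)
  then show ?case
    using smooth_quadratic_bound[OF elim _ assms] L_pos assms by (simp add: limit_gradient_eq)
qed

text \<open>The quadratic bound along a coordinate vector bounds the partial derivative by two
  integrable function values and a constant.\<close>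

lemma integrable_limit_gradient:
  assumes x: "x \<in> carrier_vec p" and c: "c < p"
  shows "integrable D (\<lambda>z. limit_gradient x z $ c)"
proof (rule Bochner_Integration.integrable_bound)
  have x': "x + unit_vec p c \<in> carrier_vec p" using x by simp
  show "integrable D (\<lambda>z. \<bar>F (x + unit_vec p c) z\<bar> + \<bar>F x z\<bar> + L / 2)"
    by (intro Bochner_Integration.integrable_add integrable_abs F_integrable x x') simp
  show "(\<lambda>z. limit_gradient x z $ c) \<in> borel_measurable D"
    by (rule measurable_vec_index[OF measurable_limit_gradient[OF x] c])
  show "AE z in D. norm (limit_gradient x z $ c) \<le> norm (\<bar>F (x + unit_vec p c) z\<bar> + \<bar>F x z\<bar> + L / 2)"
    using F_quadratic_bound[OF x unit_vec_carrier[of p c]]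
  proof eventually_elim
    case (elim z)
    then have "\<bar>F (x + unit_vec p c) z - F x z - limit_gradient x z $ c\<bar> \<le> L / 2"
      using c by (simp add: unit_vec_norm scalar_prod_right_unit[of _ p])
    then have "\<bar>limit_gradient x z $ c\<bar> \<le> \<bar>F (x + unit_vec p c) z\<bar> + \<bar>F x z\<bar> + L / 2" by linarith
    then show ?case by simp
  qed
qed

definition mean_gradient :: "real vec \<Rightarrow> real vec" where
  "mean_gradient x = Matrix.vec p (\<lambda>c. \<integral>z. limit_gradient x z $ c \<partial>D)"

lemma mean_gradient_scalar_prod:
  assumes x: "x \<in> carrier_vec p" and w: "w \<in> carrier_vec p"
  shows "mean_gradient x \<bullet> w = (\<integral>z. limit_gradient x z \<bullet> w \<partial>D)"
    "integrable D (\<lambda>z. limit_gradient x z \<bullet> w)"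
proof -
  show i: "integrable D (\<lambda>z. limit_gradient x z \<bullet> w)"
    unfolding scalar_prod_sum[OF w] using integrable_limit_gradient[OF x]
    by (intro Bochner_Integration.integrable_sum integrable_mult_left) auto
  show "mean_gradient x \<bullet> w = (\<integral>z. limit_gradient x z \<bullet> w \<partial>D)"
    unfolding scalar_prod_sum[OF w] using integrable_limit_gradient[OF x]
    by (subst Bochner_Integration.integral_sum) (auto simp: mean_gradient_def intro!: integrable_mult_left)
qed

text \<open>Integrating the quadratic bound and the Lipschitz inequality preserves both, so
  \<open>mean_gradient\<close> is the gradient of \<open>f\<close> and inherits the constant. No
  limit has to be exchanged with the expectation.\<close>

lemma local_smooth: "smooth_with p L f"
proof -
  have c: "mean_gradient x \<in> carrier_vec p" for x by (simp add: mean_gradient_def)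
  have q: "\<bar>f (x + d) - f x - mean_gradient x \<bullet> d\<bar> \<le> L / 2 * (vnorm d)\<^sup>2"
    if x: "x \<in> carrier_vec p" and d: "d \<in> carrier_vec p" for x d
  proof -
    have xd: "x + d \<in> carrier_vec p" using x d by simp
    note ints = F_integrable[OF x] F_integrable[OF xd] mean_gradient_scalar_prod(2)[OF x d]
    have "f (x + d) - f x - mean_gradient x \<bullet> d = (\<integral>z. F (x + d) z - F x z - limit_gradient x z \<bullet> d \<partial>D)"
      using ints by (simp add: f_def mean_gradient_scalar_prod(1)[OF x d])
    then show ?thesis
      using integral_abs_le_const[OF prob_D F_quadratic_bound[OF x d]] L_pos by simp
  qed
  have l: "vnorm (mean_gradient x - mean_gradient y) \<le> L * vnorm (x - y)"
    if x: "x \<in> carrier_vec p" and y: "y \<in> carrier_vec p" for x y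
  proof (rule vnorm_le_of_scalar_prod_le[of _ p])
    fix w :: "real vec" assume w: "w \<in> carrier_vec p"
    have "(mean_gradient x - mean_gradient y) \<bullet> w = (\<integral>z. limit_gradient x z \<bullet> w - limit_gradient y z \<bullet> w \<partial>D)"
      using w c mean_gradient_scalar_prod[OF x w] mean_gradient_scalar_prod[OF y w]
      by (simp add: minus_scalar_prod_distrib[of _ p])
    moreover have "AE z in D. \<bar>limit_gradient x z \<bullet> w - limit_gradient y z \<bullet> w\<bar> \<le> L * vnorm (x - y) * vnorm w"
      using F_smooth
    proof eventually_elim
      case (elim z)
      let ?G = "gradient p (\<lambda>y. F y z)"
      have "\<bar>(?G x - ?G y) \<bullet> w\<bar> \<le> vnorm (?G x - ?G y) * vnorm w"
        using smooth_has_gradient(2)[OF elim] x y w by (intro abs_scalar_prod_le[of _ p]) auto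
      also have "\<dots> \<le> L * vnorm (x - y) * vnorm w"
        by (intro mult_right_mono smooth_lipschitz[OF elim x y]) auto
      finally show ?case
        using smooth_has_gradient(2)[OF elim] x y w
        by (simp add: limit_gradient_eq[OF elim] minus_scalar_prod_distrib[of _ p])
    qed
    then have "\<bar>\<integral>z. limit_gradient x z \<bullet> w - limit_gradient y z \<bullet> w \<partial>D\<bar> \<le> L * vnorm (x - y) * vnorm w"
      using L_pos by (intro integral_abs_le_const[OF prob_D]) auto
    ultimately show "(mean_gradient x - mean_gradient y) \<bullet> w \<le> L * vnorm (x - y) * vnorm w" by simp
  qed (use c L_pos in auto)
  show ?thesis
    using smooth_withI(1)[of p mean_gradient f "L/2" L, OF c q l] by auto
qed

lemma f_measurable: "f \<in> borel_measurable (borel_vec p)"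
  unfolding f_def using F_measurable by (rule D.borel_measurable_lebesgue_integral)

text \<open>The factors 2 come from separating the deviation, which \<open>variance\<close>
  controls, from the gradient of \<open>f\<close>.\<close>

lemma gradient_second_moment:
  assumes x: "x \<in> carrier_vec p"
  shows "(\<integral>\<^sup>+z. ennreal ((vnorm (limit_gradient x z))\<^sup>2) \<partial>D)
    \<le> ennreal (2 * (1 + \<sigma>\<^sub>0\<^sup>2) * (vnorm (gradient p f x))\<^sup>2 + 2 * \<sigma>\<^sub>1\<^sup>2)"
proof -
  define g where "g = gradient p f x"
  have g: "g \<in> carrier_vec p" using smooth_has_gradient(2)[OF local_smooth x] by (simp add: g_def)
  have m: "(\<lambda>z. limit_gradient x z + (- 1) \<cdot>\<^sub>v g) \<in> measurable D (borel_vec p)"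
    using g by (intro measurable_borel_vec_add measurable_limit_gradient x measurable_const) auto
  have "(\<integral>\<^sup>+z. ennreal ((vnorm (limit_gradient x z))\<^sup>2) \<partial>D)
      \<le> (\<integral>\<^sup>+z. ennreal (2 * (vnorm (limit_gradient x z + (- 1) \<cdot>\<^sub>v g))\<^sup>2 + 2 * (vnorm g)\<^sup>2) \<partial>D)"
  proof (intro nn_integral_mono ennreal_leI)
    fix z
    have "limit_gradient x z = (limit_gradient x z + (- 1) \<cdot>\<^sub>v g) + g"
      using g by (intro eq_vecI) (auto simp: limit_gradient_def)
    then show "(vnorm (limit_gradient x z))\<^sup>2 \<le> 2 * (vnorm (limit_gradient x z + (- 1) \<cdot>\<^sub>v g))\<^sup>2 + 2 * (vnorm g)\<^sup>2"
      using vnorm_power2_add_le[of "limit_gradient x z + (- 1) \<cdot>\<^sub>v g" p g] g by simp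
  qed
  also have "\<dots> = (\<integral>\<^sup>+z. 2 * ennreal ((vnorm (limit_gradient x z + (- 1) \<cdot>\<^sub>v g))\<^sup>2) + ennreal (2 * (vnorm g)\<^sup>2) \<partial>D)"
    by (intro nn_integral_cong) (simp add: ennreal_mult)
  also have "\<dots> = 2 * (\<integral>\<^sup>+z. ennreal ((vnorm (limit_gradient x z + (- 1) \<cdot>\<^sub>v g))\<^sup>2) \<partial>D) + ennreal (2 * (vnorm g)\<^sup>2)"
    using measurable_vnorm[OF m]
    by (subst nn_integral_add) (auto simp: nn_integral_cmult D.emeasure_space_1)
  also have "(\<integral>\<^sup>+z. ennreal ((vnorm (limit_gradient x z + (- 1) \<cdot>\<^sub>v g))\<^sup>2) \<partial>D)
      = (\<integral>\<^sup>+z. ennreal ((vnorm (gradient p (\<lambda>y. F y z) x - g))\<^sup>2) \<partial>D)"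
  proof (rule nn_integral_cong_AE)
    show "AE z in D. ennreal ((vnorm (limit_gradient x z + (- 1) \<cdot>\<^sub>v g))\<^sup>2)
        = ennreal ((vnorm (gradient p (\<lambda>y. F y z) x - g))\<^sup>2)"
      using F_smooth
    proof eventually_elim
      case (elim z)
      have "limit_gradient x z + (- 1) \<cdot>\<^sub>v g = gradient p (\<lambda>y. F y z) x - g"
        unfolding limit_gradient_eq[OF elim x] using g smooth_has_gradient(2)[OF elim x]
        by (intro eq_vecI) auto
      then show ?case by simp
    qed
  qed
  also have "2 * \<dots> + ennreal (2 * (vnorm g)\<^sup>2)
      \<le> 2 * ennreal (\<sigma>\<^sub>0\<^sup>2 * (vnorm g)\<^sup>2 + \<sigma>\<^sub>1\<^sup>2) + ennreal (2 * (vnorm g)\<^sup>2)"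
    unfolding g_def by (intro add_right_mono mult_left_mono variance x) simp
  also have "\<dots> = ennreal (2 * (\<sigma>\<^sub>0\<^sup>2 * (vnorm g)\<^sup>2 + \<sigma>\<^sub>1\<^sup>2) + 2 * (vnorm g)\<^sup>2)"
    by (simp add: ennreal_mult)
  also have "2 * (\<sigma>\<^sub>0\<^sup>2 * (vnorm g)\<^sup>2 + \<sigma>\<^sub>1\<^sup>2) + 2 * (vnorm g)\<^sup>2 = 2 * (1 + \<sigma>\<^sub>0\<^sup>2) * (vnorm g)\<^sup>2 + 2 * \<sigma>\<^sub>1\<^sup>2"
    by (simp add: algebra_simps)
  finally show ?thesis by (simp add: g_def)
qed

section \<open>Second moment and bias of the two-point estimator\<close>

abbreviation "zo \<delta> x s \<equiv> zo_gradient p F \<delta> (fst s) (snd s) x"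

lemma measurable_zo:
  "(\<lambda>(x, s). zo \<delta> x s) \<in> measurable (borel_vec p \<Otimes>\<^sub>M (borel_vec p \<Otimes>\<^sub>M D)) (borel_vec p)"
proof -
  let ?M = "borel_vec p \<Otimes>\<^sub>M (borel_vec p \<Otimes>\<^sub>M D)"
  have x: "fst \<in> measurable ?M (borel_vec p)" and u: "(\<lambda>w. fst (snd w)) \<in> measurable ?M (borel_vec p)"
    and z: "(\<lambda>w. snd (snd w)) \<in> measurable ?M D" by measurable
  have "(\<lambda>w. (fst w + \<delta> \<cdot>\<^sub>v fst (snd w), snd (snd w))) \<in> measurable ?M (borel_vec p \<Otimes>\<^sub>M D)"
    by (intro measurable_Pair z measurable_borel_vec_add x measurable_borel_vec_smult u) simp
  from measurable_compose[OF this F_measurable]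
  have 1: "(\<lambda>w. F (fst w + \<delta> \<cdot>\<^sub>v fst (snd w)) (snd (snd w))) \<in> borel_measurable ?M" by simp
  have "(\<lambda>w. (fst w, snd (snd w))) \<in> measurable ?M (borel_vec p \<Otimes>\<^sub>M D)"
    by (intro measurable_Pair z x)
  from measurable_compose[OF this F_measurable]
  have 2: "(\<lambda>w. F (fst w) (snd (snd w))) \<in> borel_measurable ?M" by simp
  show ?thesis unfolding zo_gradient_def split_beta'
    by (intro measurable_borel_vec_smult u borel_measurable_divide borel_measurable_times
        borel_measurable_diff 1 2 measurable_const) auto
qed

lemma sets_UD: "sets (U \<Otimes>\<^sub>M D) = sets (borel_vec p \<Otimes>\<^sub>M D)"
  by (intro sets_pair_measure_cong) auto

lemma measurable_zo_fixed:
  assumes x: "x \<in> carrier_vec p" shows "zo \<delta> x \<in> measurable (U \<Otimes>\<^sub>M D) (borel_vec p)"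
proof -
  have "(\<lambda>s. (x, s)) \<in> measurable (U \<Otimes>\<^sub>M D) (borel_vec p \<Otimes>\<^sub>M (borel_vec p \<Otimes>\<^sub>M D))"
    using x by (intro measurable_Pair measurable_const) (auto simp: measurable_cong_sets[OF sets_UD])
  from measurable_compose[OF this measurable_zo] show ?thesis by simp
qed

sublocale UD: pair_prob_space U D ..

text \<open>For a fixed sample the squared norm is \<open>p^2\<close> times a squared difference
  quotient. Its linear part has mean \<open>\<parallel>G\<parallel>^2 / p\<close> over the sphere,
  which saves one factor \<open>p\<close>. Only the remainder, bounded pointwise by
  \<open>L * \<delta> / 2\<close>, keeps \<open>p^2\<close>; the smallness of
  \<open>\<delta>\<close> pays for that later.\<close>

lemma zo_second_moment:
  assumes x: "x \<in> carrier_vec p" and \<delta>: "0 < \<delta>"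
  shows "(\<integral>\<^sup>+s. ennreal ((vnorm (zo \<delta> x s))\<^sup>2) \<partial>(U \<Otimes>\<^sub>M D))
    \<le> ennreal (4 * p * (1 + \<sigma>\<^sub>0\<^sup>2) * (vnorm (gradient p f x))\<^sup>2 + 4 * p * \<sigma>\<^sub>1\<^sup>2 + p\<^sup>2 * L\<^sup>2 * \<delta>\<^sup>2 / 2)"
proof -
  define K where "K = p\<^sup>2 * L\<^sup>2 * \<delta>\<^sup>2 / 2"
  have K: "0 \<le> K" by (simp add: K_def)
  have m: "(\<lambda>s. ennreal ((vnorm (zo \<delta> x s))\<^sup>2)) \<in> borel_measurable (U \<Otimes>\<^sub>M D)"
    using measurable_vnorm[OF measurable_zo_fixed[OF x]] by measurable
  have "(\<integral>\<^sup>+s. ennreal ((vnorm (zo \<delta> x s))\<^sup>2) \<partial>(U \<Otimes>\<^sub>M D))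
      = (\<integral>\<^sup>+z. \<integral>\<^sup>+u. ennreal ((vnorm (zo \<delta> x (u, z)))\<^sup>2) \<partial>U \<partial>D)"
    using UD.nn_integral_snd[of "\<lambda>s. ennreal ((vnorm (zo \<delta> x s))\<^sup>2)"] m by simp
  also have "\<dots> \<le> (\<integral>\<^sup>+z. 2 * real p * ennreal ((vnorm (limit_gradient x z))\<^sup>2) + ennreal K \<partial>D)"
  proof (rule nn_integral_mono_AE)
    show "AE z in D. (\<integral>\<^sup>+u. ennreal ((vnorm (zo \<delta> x (u, z)))\<^sup>2) \<partial>U)
        \<le> 2 * real p * ennreal ((vnorm (limit_gradient x z))\<^sup>2) + ennreal K"
      using F_smooth
    proof eventually_elim
      case (elim z)
      define G where "G = limit_gradient x z"
      have G: "G \<in> carrier_vec p" "G = gradient p (\<lambda>y. F y z) x"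
        unfolding G_def by (rule limit_gradient_carrier, rule limit_gradient_eq[OF elim x])
      have pt: "(vnorm (zo \<delta> x (u, z)))\<^sup>2 \<le> 2 * p\<^sup>2 * (u \<bullet> G)\<^sup>2 + K"
        if u: "u \<in> carrier_vec p" "vnorm u = 1" for u
      proof -
        define r where "r = F (x + \<delta> \<cdot>\<^sub>v u) z - F x z - \<delta> * (u \<bullet> G)"
        have "\<bar>r\<bar> \<le> L / 2 * \<delta>\<^sup>2"
          using smooth_quadratic_bound[OF elim _ x, of "\<delta> \<cdot>\<^sub>v u"] L_pos u G \<delta> smooth_has_gradient(2)[OF elim x]
          by (simp add: r_def vnorm_smult comm_scalar_prod[of u p])
        then have "\<bar>r\<bar> / \<delta> \<le> L / 2 * \<delta>\<^sup>2 / \<delta>" using \<delta> by (intro divide_right_mono) auto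
        then have "\<bar>r / \<delta>\<bar> \<le> L * \<delta> / 2" using \<delta> by (simp add: power2_eq_square)
        then have r2: "(r / \<delta>)\<^sup>2 \<le> (L * \<delta> / 2)\<^sup>2" by (metis abs_ge_zero power2_abs power_mono)
        have "(F (x + \<delta> \<cdot>\<^sub>v u) z - F x z) / \<delta> = u \<bullet> G + r / \<delta>"
          using \<delta> by (simp add: r_def field_simps)
        then have "(vnorm (zo \<delta> x (u, z)))\<^sup>2 = p\<^sup>2 * (u \<bullet> G + r / \<delta>)\<^sup>2"
          using u by (simp add: zo_gradient_def vnorm_smult power_mult_distrib[symmetric] times_divide_eq_right[symmetric]
              del: times_divide_eq_right)
        also have "\<dots> \<le> p\<^sup>2 * (2 * (u \<bullet> G)\<^sup>2 + 2 * (L * \<delta> / 2)\<^sup>2)"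
          using r2 sum_squares_bound[of "u \<bullet> G" "r / \<delta>"]
          by (intro mult_left_mono) (auto simp: power2_sum)
        also have "\<dots> = 2 * p\<^sup>2 * (u \<bullet> G)\<^sup>2 + K"
          by (simp add: K_def power2_eq_square algebra_simps)
        finally show ?thesis .
      qed
      have "(\<integral>\<^sup>+u. ennreal ((vnorm (zo \<delta> x (u, z)))\<^sup>2) \<partial>U) \<le> (\<integral>\<^sup>+u. ennreal (2 * p\<^sup>2 * (u \<bullet> G)\<^sup>2 + K) \<partial>U)"
      proof (rule nn_integral_mono_AE)
        show "AE u in U. ennreal ((vnorm (zo \<delta> x (u, z)))\<^sup>2) \<le> ennreal (2 * p\<^sup>2 * (u \<bullet> G)\<^sup>2 + K)"
          using AE_U by eventually_elim (use pt in \<open>auto intro!: ennreal_leI\<close>)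
      qed
      also have "\<dots> = (\<integral>\<^sup>+u. ennreal (2 * p\<^sup>2) * ennreal ((u \<bullet> G)\<^sup>2) + ennreal K \<partial>U)"
        using K by (intro nn_integral_cong) (simp add: ennreal_mult[symmetric])
      also have "\<dots> = ennreal (2 * p\<^sup>2) * (\<integral>\<^sup>+u. ennreal ((u \<bullet> G)\<^sup>2) \<partial>U) + ennreal K"
        using measurable_U[OF measurable_scalar_prod_right[OF G(1)]]
        by (subst nn_integral_add) (auto simp: nn_integral_cmult U.emeasure_space_1[simplified])
      also have "ennreal (2 * p\<^sup>2) * (\<integral>\<^sup>+u. ennreal ((u \<bullet> G)\<^sup>2) \<partial>U) = ennreal (2 * p * (vnorm G)\<^sup>2)"
        unfolding nn_integral_scalar_prod_power2[OF G(1)]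
        using p_ge_1 by (simp add: ennreal_mult[symmetric] power2_eq_square)
      also have "\<dots> = 2 * real p * ennreal ((vnorm (limit_gradient x z))\<^sup>2)"
        by (simp add: G_def ennreal_mult)
      finally show ?case .
    qed
  qed
  also have "\<dots> = 2 * real p * (\<integral>\<^sup>+z. ennreal ((vnorm (limit_gradient x z))\<^sup>2) \<partial>D) + ennreal K"
    using measurable_vnorm[OF measurable_limit_gradient[OF x]]
    by (subst nn_integral_add) (auto simp: nn_integral_cmult D.emeasure_space_1)
  also have "\<dots> \<le> 2 * real p * ennreal (2 * (1 + \<sigma>\<^sub>0\<^sup>2) * (vnorm (gradient p f x))\<^sup>2 + 2 * \<sigma>\<^sub>1\<^sup>2) + ennreal K"
    by (intro add_right_mono mult_left_mono gradient_second_moment x) simp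
  also have "\<dots> = ennreal (2 * real p * (2 * (1 + \<sigma>\<^sub>0\<^sup>2) * (vnorm (gradient p f x))\<^sup>2 + 2 * \<sigma>\<^sub>1\<^sup>2) + K)"
    using K by (simp add: ennreal_mult[symmetric] ennreal_plus[symmetric] del: ennreal_plus)
  also have "2 * real p * (2 * (1 + \<sigma>\<^sub>0\<^sup>2) * (vnorm (gradient p f x))\<^sup>2 + 2 * \<sigma>\<^sub>1\<^sup>2) + K
      = 4 * p * (1 + \<sigma>\<^sub>0\<^sup>2) * (vnorm (gradient p f x))\<^sup>2 + 4 * p * \<sigma>\<^sub>1\<^sup>2 + p\<^sup>2 * L\<^sup>2 * \<delta>\<^sup>2 / 2"
    by (simp add: K_def algebra_simps)
  finally show ?thesis .
qed

definition zo_mean :: "real \<Rightarrow> real vec \<Rightarrow> real vec" where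
  "zo_mean \<delta> x = Matrix.vec p (\<lambda>c. \<integral>s. zo \<delta> x s $ c \<partial>(U \<Otimes>\<^sub>M D))"

lemma zo_mean_carrier [simp]: "zo_mean \<delta> x \<in> carrier_vec p"
  by (simp add: zo_mean_def)

lemma measurable_zo_mean: "zo_mean \<delta> \<in> measurable (borel_vec p) (borel_vec p)"
proof (rule measurable_borel_vecI)
  fix c assume c: "c < p"
  have s: "sets (borel_vec p \<Otimes>\<^sub>M (U \<Otimes>\<^sub>M D)) = sets (borel_vec p \<Otimes>\<^sub>M (borel_vec p \<Otimes>\<^sub>M D))"
    by (intro sets_pair_measure_cong sets_UD refl)
  have "(\<lambda>(x, s). zo \<delta> x s $ c) \<in> borel_measurable (borel_vec p \<Otimes>\<^sub>M (U \<Otimes>\<^sub>M D))"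
    using measurable_vec_index[OF measurable_zo c, of \<delta>]
    unfolding measurable_cong_sets[OF s refl] by (simp add: split_beta')
  then have "(\<lambda>x. \<integral>s. zo \<delta> x s $ c \<partial>(U \<Otimes>\<^sub>M D)) \<in> borel_measurable (borel_vec p)"
    by (rule UD.borel_measurable_lebesgue_integral)
  then show "(\<lambda>x. zo_mean \<delta> x $ c) \<in> borel_measurable (borel_vec p)"
    using c by (simp add: zo_mean_def)
qed simp

lemma zo_carrier: "x \<in> carrier_vec p \<Longrightarrow> s \<in> space (U \<Otimes>\<^sub>M D) \<Longrightarrow> zo \<delta> x s \<in> carrier_vec p"
  using measurable_space[OF measurable_zo_fixed] by auto

lemma integrable_zo:
  assumes x: "x \<in> carrier_vec p" and \<delta>: "0 < \<delta>" and c: "c < p"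
  shows "integrable (U \<Otimes>\<^sub>M D) (\<lambda>s. zo \<delta> x s $ c)"
proof (rule Bochner_Integration.integrable_bound)
  have m: "(\<lambda>s. (vnorm (zo \<delta> x s))\<^sup>2) \<in> borel_measurable (U \<Otimes>\<^sub>M D)"
    using measurable_vnorm[OF measurable_zo_fixed[OF x]] by measurable
  have "(\<integral>\<^sup>+s. ennreal ((vnorm (zo \<delta> x s))\<^sup>2) \<partial>(U \<Otimes>\<^sub>M D)) < \<infinity>"
    using zo_second_moment[OF x \<delta>] by (rule le_less_trans) simp
  then have "integrable (U \<Otimes>\<^sub>M D) (\<lambda>s. (vnorm (zo \<delta> x s))\<^sup>2)"
    using m by (intro integrableI_bounded) auto
  then show "integrable (U \<Otimes>\<^sub>M D) (\<lambda>s. 1 + (vnorm (zo \<delta> x s))\<^sup>2)" by simp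
  show "(\<lambda>s. zo \<delta> x s $ c) \<in> borel_measurable (U \<Otimes>\<^sub>M D)"
    by (rule measurable_vec_index[OF measurable_zo_fixed[OF x] c])
  have "norm (zo \<delta> x s $ c) \<le> norm (1 + (vnorm (zo \<delta> x s))\<^sup>2)" if "s \<in> space (U \<Otimes>\<^sub>M D)" for s
  proof -
    have "\<bar>zo \<delta> x s $ c\<bar> \<le> vnorm (zo \<delta> x s)" by (rule abs_index_le_vnorm[OF zo_carrier[OF x that] c])
    also have "\<dots> \<le> 1 + (vnorm (zo \<delta> x s))\<^sup>2"
    proof -
      have "2 * vnorm (zo \<delta> x s) \<le> 1 + (vnorm (zo \<delta> x s))\<^sup>2"
        using sum_squares_bound[of 1 "vnorm (zo \<delta> x s)"] by simp
      then show ?thesis using vnorm_nonneg[of "zo \<delta> x s"] by linarith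
    qed
    finally show ?thesis by simp
  qed
  then show "AE s in U \<Otimes>\<^sub>M D. norm (zo \<delta> x s $ c) \<le> norm (1 + (vnorm (zo \<delta> x s))\<^sup>2)" by simp
qed

text \<open>Integrating out the sample first leaves the difference quotient of \<open>f\<close>
  itself, to which the bound on the sphere applies. Working by duality avoids adding up
  coordinatewise errors, which would cost a power of \<open>p\<close>.\<close>

lemma zo_bias:
  assumes x: "x \<in> carrier_vec p" and \<delta>: "0 < \<delta>"
  shows "vnorm (zo_mean \<delta> x - gradient p f x) \<le> \<delta> * L"
proof -
  define g where "g = gradient p f x"
  have g: "g \<in> carrier_vec p" using smooth_has_gradient(2)[OF local_smooth x] by (simp add: g_def)
  have comp: "zo_mean \<delta> x $ c = real p / \<delta> * (\<integral>u. (f (x + \<delta> \<cdot>\<^sub>v u) - f x) * u $ c \<partial>U)"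
    and int: "integrable U (\<lambda>u. (f (x + \<delta> \<cdot>\<^sub>v u) - f x) * u $ c)" if c: "c < p" for c
  proof -
    have "(\<integral>s. zo \<delta> x s $ c \<partial>(U \<Otimes>\<^sub>M D)) = (\<integral>u. \<integral>z. zo \<delta> x (u, z) $ c \<partial>D \<partial>U)"
      using UD.integral_fst'[OF integrable_zo[OF x \<delta> c]] by simp
    also have "\<dots> = (\<integral>u. real p / \<delta> * ((f (x + \<delta> \<cdot>\<^sub>v u) - f x) * u $ c) \<partial>U)"
    proof (intro Bochner_Integration.integral_cong refl)
      fix u assume "u \<in> space U"
      then have u: "u \<in> carrier_vec p" by simp
      have "x + \<delta> \<cdot>\<^sub>v u \<in> carrier_vec p" using x u by simp
      note ints = F_integrable[OF this] F_integrable[OF x]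
      have "(\<integral>z. zo \<delta> x (u, z) $ c \<partial>D) = (\<integral>z. real p / \<delta> * u $ c * (F (x + \<delta> \<cdot>\<^sub>v u) z - F x z) \<partial>D)"
        using u c by (intro Bochner_Integration.integral_cong) (auto simp: zo_gradient_def)
      also have "\<dots> = real p / \<delta> * u $ c * (f (x + \<delta> \<cdot>\<^sub>v u) - f x)"
        using ints by (simp add: f_def)
      finally show "(\<integral>z. zo \<delta> x (u, z) $ c \<partial>D) = real p / \<delta> * ((f (x + \<delta> \<cdot>\<^sub>v u) - f x) * u $ c)"
        by (simp add: mult_ac)
    qed
    finally show "zo_mean \<delta> x $ c = real p / \<delta> * (\<integral>u. (f (x + \<delta> \<cdot>\<^sub>v u) - f x) * u $ c \<partial>U)"
      using c by (simp add: zo_mean_def)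
    have "integrable U (\<lambda>u. (f (x + \<delta> \<cdot>\<^sub>v u) - f x) * (u \<bullet> unit_vec p c))"
      using c L_pos by (intro smoothing_bias_unit(1)[OF local_smooth _ f_measurable x \<delta>]) (auto simp: unit_vec_norm)
    then show "integrable U (\<lambda>u. (f (x + \<delta> \<cdot>\<^sub>v u) - f x) * u $ c)"
      using c by (subst Bochner_Integration.integrable_cong[OF refl, where g = "\<lambda>u. (f (x + \<delta> \<cdot>\<^sub>v u) - f x) * (u \<bullet> unit_vec p c)"])
        (auto simp: scalar_prod_right_unit[of _ p])
  qed
  show ?thesis
  proof (rule vnorm_le_of_scalar_prod_le[of _ p])
    fix w :: "real vec" assume w: "w \<in> carrier_vec p"
    have "zo_mean \<delta> x \<bullet> w = (\<Sum>c<p. real p / \<delta> * (\<integral>u. (f (x + \<delta> \<cdot>\<^sub>v u) - f x) * u $ c \<partial>U) * w $ c)"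
      using w comp by (simp add: scalar_prod_sum[of w p])
    also have "\<dots> = real p / \<delta> * (\<Sum>c<p. (\<integral>u. (f (x + \<delta> \<cdot>\<^sub>v u) - f x) * u $ c * w $ c \<partial>U))"
      unfolding sum_distrib_left by (intro sum.cong refl) (subst integral_mult_left_zero, rule mult.assoc)
    also have "(\<Sum>c<p. (\<integral>u. (f (x + \<delta> \<cdot>\<^sub>v u) - f x) * u $ c * w $ c \<partial>U))
        = (\<integral>u. (\<Sum>c<p. (f (x + \<delta> \<cdot>\<^sub>v u) - f x) * u $ c * w $ c) \<partial>U)"
      using int by (intro Bochner_Integration.integral_sum[symmetric] integrable_mult_left) auto
    also have "\<dots> = (\<integral>u. (f (x + \<delta> \<cdot>\<^sub>v u) - f x) * (u \<bullet> w) \<partial>U)"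
      using w by (simp add: scalar_prod_sum[of w p] sum_distrib_left mult.assoc)
    finally have "zo_mean \<delta> x \<bullet> w - g \<bullet> w \<le> \<delta> * L * vnorm w"
      using smoothing_bias[OF local_smooth _ f_measurable x \<delta> w] L_pos by (simp add: g_def abs_le_iff)
    then show "(zo_mean \<delta> x - gradient p f x) \<bullet> w \<le> \<delta> * L * vnorm w"
      using w g by (simp add: minus_scalar_prod_distrib[of _ p] g_def)
  qed (use g \<delta> L_pos in \<open>auto simp: g_def\<close>)
qed

end

section \<open>Spectral bounds for the graph Laplacian\<close>

text \<open>Vectors of variable length are sequences here, so compactness of a box is Tychonoff's
  theorem.\<close>

lemma compact_product_intervals:
  fixes l u :: "nat \<Rightarrow> real"
  shows "compact (\<Pi>\<^sub>E i\<in>UNIV. {l i..u i})"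
proof -
  have "compactin (product_topology (\<lambda>i. euclidean) UNIV) (\<Pi>\<^sub>E i\<in>UNIV. {l i..u i})"
    by (subst compactin_PiE) auto
  then show ?thesis by (simp add: euclidean_product_topology)
qed

lemma continuous_on_index [continuous_intros]: "continuous_on S (\<lambda>y :: nat \<Rightarrow> real. y i)"
  by (rule continuous_on_subset[OF continuous_on_product_coordinates]) auto

definition quad_form :: "nat \<Rightarrow> (nat \<Rightarrow> nat \<Rightarrow> real) \<Rightarrow> (nat \<Rightarrow> real) \<Rightarrow> real" where
  "quad_form n B y = (\<Sum>i<n. \<Sum>j<n. B i j * y i * y j)"

text \<open>A minimizer \<open>y\<close> on the unit sphere of the complement of \<open>w\<close> is
  an eigenvector because its residual \<open>v\<close> is an admissible direction; symmetry and
  \<open>ker\<close> make \<open>v\<close> orthogonal to \<open>w\<close>. With \<open>w = 1\<close>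
  this yields the spectral gap of the Laplacian, and \<open>w = 0\<close> drops the
  constraint.\<close>

lemma rayleigh_minimum:
  fixes B :: "nat \<Rightarrow> nat \<Rightarrow> real" and w :: "nat \<Rightarrow> real"
  assumes sym: "\<And>i j. i < n \<Longrightarrow> j < n \<Longrightarrow> B i j = B j i"
    and ker: "\<And>i. i < n \<Longrightarrow> (\<Sum>j<n. B i j * w j) = 0"
    and ne: "(\<Sum>i<n. (z i)\<^sup>2) > 0" "(\<Sum>i<n. z i * w i) = 0"
  shows "\<exists>y \<mu>. (\<Sum>i<n. (y i)\<^sup>2) = 1 \<and> (\<Sum>i<n. y i * w i) = 0 \<and>
    (\<forall>i<n. (\<Sum>j<n. B i j * y j) = \<mu> * y i) \<and>
    (\<forall>x. (\<Sum>i<n. x i * w i) = 0 \<longrightarrow> \<mu> * (\<Sum>i<n. (x i)\<^sup>2) \<le> quad_form n B x)"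
proof -
  \<comment> \<open>Zero bounds from \<open>n\<close> on pin the idle entries, so that
    \<open>K\<close> is a compact copy of the constrained sphere.\<close>
  define b where "b i = (if i < n then 1 else 0 :: real)" for i
  define K where "K = (\<Pi>\<^sub>E i\<in>UNIV. {- b i..b i}) \<inter> {y. (\<Sum>i<n. (y i)\<^sup>2) = 1} \<inter> {y. (\<Sum>i<n. y i * w i) = 0}"
  have "compact K" unfolding K_def
    by (intro compact_Int_closed compact_product_intervals closed_Collect_eq continuous_intros)
  have normalize: "\<exists>y\<in>K. \<exists>s>0. (\<forall>i<n. y i = x i / s) \<and> s\<^sup>2 = (\<Sum>i<n. (x i)\<^sup>2)"
    if x: "(\<Sum>i<n. (x i)\<^sup>2) > 0" "(\<Sum>i<n. x i * w i) = 0" for x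
  proof -
    define s where "s = sqrt (\<Sum>i<n. (x i)\<^sup>2)"
    have s: "s > 0" "s\<^sup>2 = (\<Sum>i<n. (x i)\<^sup>2)" using x by (auto simp: s_def)
    define y where "y i = (if i < n then x i / s else 0)" for i
    have y1: "(\<Sum>i<n. (y i)\<^sup>2) = 1"
    proof -
      have "(\<Sum>i<n. (y i)\<^sup>2) = (\<Sum>i<n. (x i)\<^sup>2) / s\<^sup>2"
        by (simp add: y_def power_divide sum_divide_distrib)
      then show ?thesis using s x by simp
    qed
    have "(\<Sum>i<n. y i * w i) = (\<Sum>i<n. x i * w i) / s"
      by (simp add: y_def sum_divide_distrib)
    then have "(\<Sum>i<n. y i * w i) = 0" using x by simp
    moreover have "\<bar>y i\<bar> \<le> b i" for i
    proof (cases "i < n")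
      case True
      have "(y i)\<^sup>2 \<le> (\<Sum>i<n. (y i)\<^sup>2)" using True by (intro member_le_sum) auto
      then show ?thesis using True y1 by (simp add: b_def abs_square_le_1)
    qed (simp add: y_def b_def)
    then have "y \<in> (\<Pi>\<^sub>E i\<in>UNIV. {- b i..b i})" by (auto simp: abs_le_iff minus_le_iff)
    ultimately have "y \<in> K" using y1 by (simp add: K_def)
    then show ?thesis using s by (intro bexI[of _ y] exI[of _ s]) (auto simp: y_def)
  qed
  have "K \<noteq> {}" using normalize[OF ne] by blast
  moreover have "continuous_on K (quad_form n B)"
    unfolding quad_form_def[abs_def] by (intro continuous_intros)
  ultimately obtain y where y: "y \<in> K" "\<And>x. x \<in> K \<Longrightarrow> quad_form n B y \<le> quad_form n B x"
    using continuous_attains_inf[OF \<open>compact K\<close>] by blast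
  define \<mu> where "\<mu> = quad_form n B y"
  have y1: "(\<Sum>i<n. (y i)\<^sup>2) = 1" and yw: "(\<Sum>i<n. y i * w i) = 0" using y(1) by (auto simp: K_def)
  have min: "\<mu> * (\<Sum>i<n. (x i)\<^sup>2) \<le> quad_form n B x" if xw: "(\<Sum>i<n. x i * w i) = 0" for x
  proof (cases "(\<Sum>i<n. (x i)\<^sup>2) > 0")
    case True
    then obtain y' s where s: "y' \<in> K" "s > 0" "\<And>i. i < n \<Longrightarrow> y' i = x i / s" "s\<^sup>2 = (\<Sum>i<n. (x i)\<^sup>2)"
      using normalize[OF True xw] by blast
    have "quad_form n B y' = quad_form n B x / s\<^sup>2"
      unfolding quad_form_def sum_divide_distrib
      by (intro sum.cong refl) (auto simp: s(3) power2_eq_square)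
    then have "\<mu> \<le> quad_form n B x / s\<^sup>2" using y(2)[OF s(1)] by (simp add: \<mu>_def)
    then show ?thesis using True by (simp add: s(4) pos_le_divide_eq)
  next
    case False
    then have "(\<Sum>i<n. (x i)\<^sup>2) = 0" using sum_nonneg[of "{..<n}" "\<lambda>i. (x i)\<^sup>2"] by simp
    then have "\<forall>i\<in>{..<n}. (x i)\<^sup>2 = 0" by (subst (asm) sum_nonneg_eq_0_iff) auto
    then have "quad_form n B x = 0" by (auto simp: quad_form_def intro!: sum.neutral)
    then show ?thesis using \<open>(\<Sum>i<n. (x i)\<^sup>2) = 0\<close> by simp
  qed
  define v where "v i = (\<Sum>j<n. B i j * y j) - \<mu> * y i" for i
  have vw: "(\<Sum>i<n. v i * w i) = 0"
  proof -
    have "(\<Sum>i<n. (\<Sum>j<n. B i j * y j) * w i) = (\<Sum>i<n. \<Sum>j<n. B i j * y j * w i)"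
      by (simp add: sum_distrib_right)
    also have "\<dots> = (\<Sum>j<n. \<Sum>i<n. B i j * y j * w i)" by (rule sum.swap)
    also have "\<dots> = (\<Sum>j<n. y j * (\<Sum>i<n. B j i * w i))"
      unfolding sum_distrib_left by (intro sum.cong refl) (auto simp: sym mult_ac)
    also have "\<dots> = 0" by (simp add: ker)
    finally have "(\<Sum>i<n. (\<Sum>j<n. B i j * y j) * w i) = 0" .
    moreover have "(\<Sum>i<n. v i * w i) = (\<Sum>i<n. (\<Sum>j<n. B i j * y j) * w i) - \<mu> * (\<Sum>i<n. y i * w i)"
      unfolding v_def by (simp add: left_diff_distrib sum_subtractf sum_distrib_left mult.assoc)
    ultimately show ?thesis using yw by simp
  qed
  define V where "V = (\<Sum>i<n. (v i)\<^sup>2)"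
  \<comment> \<open>Minimality at \<open>y + t * v\<close>. The terms containing the scalar product
    of \<open>y\<close> and \<open>v\<close> cancel, and the first-order coefficient is twice the
    squared residual.\<close>
  have lin: "0 \<le> 2 * t * V + t\<^sup>2 * (quad_form n B v - \<mu> * V)" for t
  proof -
    have "(\<Sum>i<n. (y i + t * v i) * w i) = (\<Sum>i<n. y i * w i) + t * (\<Sum>i<n. v i * w i)"
      by (simp add: distrib_right sum.distrib sum_distrib_left mult.assoc)
    then have w0: "(\<Sum>i<n. (y i + t * v i) * w i) = 0" using vw yw by simp
    have "(\<Sum>i<n. (y i + t * v i)\<^sup>2) = (\<Sum>i<n. (y i)\<^sup>2 + 2 * t * (y i * v i) + t\<^sup>2 * (v i)\<^sup>2)"
      by (intro sum.cong refl) (simp add: power2_eq_square algebra_simps)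
    also have "\<dots> = 1 + 2 * t * (\<Sum>i<n. y i * v i) + t\<^sup>2 * V"
      by (simp add: sum.distrib sum_distrib_left V_def y1[symmetric])
    finally have e1: "(\<Sum>i<n. (y i + t * v i)\<^sup>2) = 1 + 2 * t * (\<Sum>i<n. y i * v i) + t\<^sup>2 * V" .
    have c: "(\<Sum>i<n. \<Sum>j<n. B i j * v i * y j) = (\<Sum>i<n. \<Sum>j<n. B i j * y i * v j)"
      by (subst sum.swap) (intro sum.cong refl, auto simp: sym mult_ac)
    have "quad_form n B (\<lambda>i. y i + t * v i)
        = (\<Sum>i<n. \<Sum>j<n. B i j * y i * y j + t * (B i j * v i * y j) + t * (B i j * y i * v j) + t\<^sup>2 * (B i j * v i * v j))"
      unfolding quad_form_def by (intro sum.cong refl) (simp add: power2_eq_square algebra_simps)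
    also have "\<dots> = \<mu> + 2 * t * (\<Sum>i<n. \<Sum>j<n. B i j * v i * y j) + t\<^sup>2 * quad_form n B v"
      using c by (simp add: sum.distrib sum_distrib_left[symmetric] \<mu>_def quad_form_def)
    also have "(\<Sum>i<n. \<Sum>j<n. B i j * v i * y j) = (\<Sum>i<n. v i * (v i + \<mu> * y i))"
    proof (rule sum.cong[OF refl])
      fix i
      have "(\<Sum>j<n. B i j * v i * y j) = v i * (\<Sum>j<n. B i j * y j)"
        by (simp add: sum_distrib_left mult_ac)
      then show "(\<Sum>j<n. B i j * v i * y j) = v i * (v i + \<mu> * y i)" by (simp add: v_def)
    qed
    also have "\<dots> = V + \<mu> * (\<Sum>i<n. y i * v i)"
      by (simp add: V_def distrib_left sum.distrib sum_distrib_left power2_eq_square mult_ac)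
    finally have "quad_form n B (\<lambda>i. y i + t * v i) = \<mu> + 2 * t * (V + \<mu> * (\<Sum>i<n. y i * v i)) + t\<^sup>2 * quad_form n B v" .
    then show ?thesis using min[OF w0] unfolding e1 by (simp add: algebra_simps)
  qed
  have "V = 0"
  proof (rule ccontr)
    assume "V \<noteq> 0"
    then have V: "V > 0" using sum_nonneg[of "{..<n}" "\<lambda>i. (v i)\<^sup>2"] by (simp add: V_def)
    define c where "c = max 1 (quad_form n B v - \<mu> * V)"
    have c: "c \<ge> 1" "quad_form n B v - \<mu> * V \<le> c" by (auto simp: c_def)
    \<comment> \<open>The minimizer of \<open>2 * t * V + t^2 * c\<close>, which would make the
      right-hand side negative; \<open>c \<ge> 1\<close> keeps the quotient defined.\<close>
    define t where "t = - V / c"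
    have "t\<^sup>2 * (quad_form n B v - \<mu> * V) \<le> t\<^sup>2 * c" using c by (intro mult_left_mono) auto
    then have "0 \<le> 2 * t * V + t\<^sup>2 * c" using lin[of t] by linarith
    also have "2 * t * V + t\<^sup>2 * c = - (V * V / c)"
      using c(1) by (simp add: t_def power2_eq_square field_simps)
    finally have "V * V / c \<le> 0" by simp
    moreover have "0 < V * V / c" using V c(1) by simp
    ultimately show False by simp
  qed
  then have "\<forall>i\<in>{..<n}. (v i)\<^sup>2 = 0" unfolding V_def by (subst (asm) sum_nonneg_eq_0_iff) auto
  then have "\<forall>i<n. (\<Sum>j<n. B i j * y j) = \<mu> * y i" by (simp add: v_def)
  then show ?thesis using y1 yw min by blast
qed

lemma eigenvalueI_sum:
  fixes B :: "'a :: field mat"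
  assumes B: "B \<in> carrier_mat n n" and k: "k < n" "y k \<noteq> 0"
    and e: "\<And>i. i < n \<Longrightarrow> (\<Sum>j<n. B $$ (i, j) * y j) = \<mu> * y i"
  shows "eigenvalue B \<mu>"
proof -
  have "Matrix.vec n y \<noteq> 0\<^sub>v n"
  proof
    assume a: "Matrix.vec n y = 0\<^sub>v n"
    show False using arg_cong[OF a, of "\<lambda>v. v $ k"] k by simp
  qed
  moreover have "B *\<^sub>v Matrix.vec n y = \<mu> \<cdot>\<^sub>v Matrix.vec n y"
  proof (intro eq_vecI)
    fix i assume "i < dim_vec (\<mu> \<cdot>\<^sub>v Matrix.vec n y)"
    then have i: "i < n" by simp
    then show "(B *\<^sub>v Matrix.vec n y) $ i = (\<mu> \<cdot>\<^sub>v Matrix.vec n y) $ i"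
      using B e[OF i] by (simp add: scalar_prod_def lessThan_atLeast0)
  qed (use B in auto)
  ultimately show ?thesis
    unfolding eigenvalue_def eigenvector_def using B by (intro exI[of _ "Matrix.vec n y"]) auto
qed

text \<open>\<open>spec_rad\<close> is taken over complex eigenvalues; a real eigenvector remains
  one after embedding.\<close>

lemma abs_eigenvalue_le_spec_rad:
  assumes B: "B \<in> carrier_mat n n" and k: "k < n" "y k \<noteq> 0"
    and e: "\<And>i. i < n \<Longrightarrow> (\<Sum>j<n. B $$ (i, j) * y j) = \<mu> * y i"
  shows "\<bar>\<mu>\<bar> \<le> spec_rad B"
proof -
  have "eigenvalue (map_mat complex_of_real B) (complex_of_real \<mu>)"
  proof (rule eigenvalueI_sum[of _ n k "\<lambda>i. complex_of_real (y i)"])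
    fix i assume i: "i < n"
    have "(\<Sum>j<n. map_mat complex_of_real B $$ (i, j) * complex_of_real (y j)) = complex_of_real (\<Sum>j<n. B $$ (i, j) * y j)"
      using B i by simp
    then show "(\<Sum>j<n. map_mat complex_of_real B $$ (i, j) * complex_of_real (y j)) = complex_of_real \<mu> * complex_of_real (y i)"
      using e[OF i] by simp
  qed (use B k in auto)
  then have "norm (complex_of_real \<mu>) \<in> norm ` spectrum (map_mat complex_of_real B)"
    by (intro imageI) (simp add: spectrum_def)
  then show ?thesis
    using spectral_radius_mem_max(2)[of "map_mat complex_of_real B" n] B k by (auto simp: spec_rad_def)
qed

lemma sum_squares_eq_0_imp:
  fixes x :: "nat \<Rightarrow> real"
  assumes "\<not> (\<Sum>i<n. (x i)\<^sup>2) > 0" "i < n" shows "x i = 0"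
proof -
  have "(\<Sum>i<n. (x i)\<^sup>2) = 0" using assms(1) sum_nonneg[of "{..<n}" "\<lambda>i. (x i)\<^sup>2"] by simp
  then have "\<forall>i\<in>{..<n}. (x i)\<^sup>2 = 0" by (subst (asm) sum_nonneg_eq_0_iff) auto
  then show ?thesis using assms(2) by simp
qed

locale network =
  fixes n :: nat and E :: "(nat \<times> nat) set" and A :: "real mat"
  assumes n_ge_1: "1 \<le> n" and graph: "weighted_graph n E A" and connected: "connected_graph n E"
begin

abbreviation "L \<equiv> laplacian n A"

section \<open>The Laplacian of a connected weighted graph\<close>

lemma A_entries: "\<forall>i<n. \<forall>j<n. A $$ (i, j) = A $$ (j, i) \<and>
    ((i, j) \<in> E \<longrightarrow> A $$ (i, j) > 0) \<and> ((i, j) \<notin> E \<longrightarrow> A $$ (i, j) = 0)"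
  using graph[unfolded weighted_graph_def] by (elim conjE)

lemma A_sym: "i < n \<Longrightarrow> j < n \<Longrightarrow> A $$ (i, j) = A $$ (j, i)"
  and A_pos: "i < n \<Longrightarrow> j < n \<Longrightarrow> (i, j) \<in> E \<Longrightarrow> 0 < A $$ (i, j)"
  and A_nonneg: "i < n \<Longrightarrow> j < n \<Longrightarrow> 0 \<le> A $$ (i, j)"
proof -
  assume ij: "i < n" "j < n"
  note e = A_entries[rule_format, OF ij]
  show "A $$ (i, j) = A $$ (j, i)" "(i, j) \<in> E \<Longrightarrow> 0 < A $$ (i, j)" using e by (blast, blast)
  show "0 \<le> A $$ (i, j)" using e by (cases "(i, j) \<in> E") (auto simp: less_imp_le)
qed

lemma E_range: "(i, j) \<in> E \<Longrightarrow> i < n \<and> j < n"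
  using graph unfolding weighted_graph_def by auto

lemma L_carrier: "L \<in> carrier_mat n n"
  by (simp add: laplacian_def)

lemma L_index: "i < n \<Longrightarrow> j < n \<Longrightarrow> L $$ (i, j) = (if i = j then \<Sum>l<n. A $$ (i, l) else 0) - A $$ (i, j)"
  by (simp add: laplacian_def)

lemma L_sym: "i < n \<Longrightarrow> j < n \<Longrightarrow> L $$ (i, j) = L $$ (j, i)"
  by (simp add: L_index A_sym)

lemma L_row_sum: "i < n \<Longrightarrow> (\<Sum>j<n. L $$ (i, j)) = 0"
  by (simp add: L_index sum_subtractf sum.delta)

lemma L_column_sum: "j < n \<Longrightarrow> (\<Sum>i<n. L $$ (i, j)) = 0"
proof -
  assume j: "j < n"
  have "(\<Sum>i<n. L $$ (i, j)) = (\<Sum>i<n. L $$ (j, i))"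
    using j by (intro sum.cong refl L_sym) auto
  then show ?thesis using L_row_sum[OF j] by simp
qed

text \<open>The Dirichlet energy of the graph. In this form it is visibly nonnegative and vanishes
  only on vectors that are constant along edges.\<close>

lemma quad_form_L: "quad_form n (\<lambda>i j. L $$ (i, j)) y = (\<Sum>i<n. \<Sum>j<n. A $$ (i, j) * (y i - y j)\<^sup>2) / 2"
proof -
  define S where "S = (\<Sum>i<n. \<Sum>j<n. A $$ (i, j) * (y i)\<^sup>2)"
  define T where "T = (\<Sum>i<n. \<Sum>j<n. A $$ (i, j) * y i * y j)"
  have S': "(\<Sum>i<n. \<Sum>j<n. A $$ (i, j) * (y j)\<^sup>2) = S"
    unfolding S_def by (subst sum.swap) (intro sum.cong refl, auto simp: A_sym)
  have "(\<Sum>i<n. \<Sum>j<n. A $$ (i, j) * (y i - y j)\<^sup>2)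
      = (\<Sum>i<n. \<Sum>j<n. A $$ (i, j) * (y i)\<^sup>2 + A $$ (i, j) * (y j)\<^sup>2 - 2 * (A $$ (i, j) * y i * y j))"
    by (intro sum.cong refl) (simp add: power2_eq_square algebra_simps)
  also have "\<dots> = S + S - 2 * T"
    by (simp add: sum.distrib sum_subtractf sum_distrib_left[symmetric] S' S_def[symmetric] T_def)
  finally have 1: "(\<Sum>i<n. \<Sum>j<n. A $$ (i, j) * (y i - y j)\<^sup>2) = S + S - 2 * T" .
  have "quad_form n (\<lambda>i j. L $$ (i, j)) y
      = (\<Sum>i<n. \<Sum>j<n. (if j = i then (\<Sum>l<n. A $$ (i, l)) * (y i)\<^sup>2 else 0) - A $$ (i, j) * y i * y j)"
    unfolding quad_form_def
    by (intro sum.cong refl) (auto simp: L_index power2_eq_square algebra_simps)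
  also have "\<dots> = S - T"
    by (simp add: sum_subtractf S_def T_def sum_distrib_right)
  finally show ?thesis using 1 by simp
qed

text \<open>The minimum of the form on the complement of the constants is an eigenvalue. It is
  nonnegative as an energy and nonzero by connectedness, so it is at least the least positive
  eigenvalue.\<close>

lemma algebraic_connectivity:
  assumes x: "(\<Sum>i<n. x i) = 0"
  shows "min_pos_eigenvalue L * (\<Sum>i<n. (x i)\<^sup>2) \<le> quad_form n (\<lambda>i j. L $$ (i, j)) x"
proof (cases "(\<Sum>i<n. (x i)\<^sup>2) > 0")
  case True
  have "\<exists>y \<mu>. (\<Sum>i<n. (y i)\<^sup>2) = 1 \<and> (\<Sum>i<n. y i * 1) = 0 \<and>
    (\<forall>i<n. (\<Sum>j<n. L $$ (i, j) * y j) = \<mu> * y i) \<and>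
    (\<forall>x. (\<Sum>i<n. x i * 1) = 0 \<longrightarrow> \<mu> * (\<Sum>i<n. (x i)\<^sup>2) \<le> quad_form n (\<lambda>i j. L $$ (i, j)) x)"
    by (rule rayleigh_minimum[where z = x]) (use True x in \<open>auto simp: L_row_sum L_sym\<close>)
  then obtain y \<mu> where y: "(\<Sum>i<n. (y i)\<^sup>2) = 1" "(\<Sum>i<n. y i) = 0"
    "\<And>i. i < n \<Longrightarrow> (\<Sum>j<n. L $$ (i, j) * y j) = \<mu> * y i"
    "\<mu> * (\<Sum>i<n. (x i)\<^sup>2) \<le> quad_form n (\<lambda>i j. L $$ (i, j)) x"
    using x by auto
  have "quad_form n (\<lambda>i j. L $$ (i, j)) y = (\<Sum>i<n. y i * (\<Sum>j<n. L $$ (i, j) * y j))"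
    unfolding quad_form_def by (simp add: sum_distrib_left mult_ac)
  also have "\<dots> = (\<Sum>i<n. \<mu> * (y i)\<^sup>2)"
    by (intro sum.cong refl) (simp add: y(3) power2_eq_square)
  also have "\<dots> = \<mu>" by (simp add: sum_distrib_left[symmetric] y(1))
  finally have \<mu>: "(\<Sum>i<n. \<Sum>j<n. A $$ (i, j) * (y i - y j)\<^sup>2) = 2 * \<mu>"
    by (simp add: quad_form_L)
  have nn: "0 \<le> A $$ (i, j) * (y i - y j)\<^sup>2" if "i < n" "j < n" for i j
    using A_nonneg[OF that] by simp
  have "0 \<le> 2 * \<mu>" unfolding \<mu>[symmetric] by (intro sum_nonneg) (use nn in auto)
  moreover have "\<mu> \<noteq> 0"
  proof
    assume "\<mu> = 0"
    then have 0: "(\<Sum>i<n. \<Sum>j<n. A $$ (i, j) * (y i - y j)\<^sup>2) = 0" using \<mu> by simp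
    \<comment> \<open>Every summand of a vanishing energy is 0. Equality across edges spreads along
      paths to a constant, and the zero sum makes that constant 0.\<close>
    have edge: "y i = y j" if ij: "(i, j) \<in> E" for i j
    proof -
      have r: "i < n" "j < n" using E_range[OF ij] by auto
      have "\<forall>i\<in>{..<n}. (\<Sum>j<n. A $$ (i, j) * (y i - y j)\<^sup>2) = 0"
        using 0 by (subst (asm) sum_nonneg_eq_0_iff) (auto intro!: sum_nonneg nn)
      then have "(\<Sum>j<n. A $$ (i, j) * (y i - y j)\<^sup>2) = 0" using r by simp
      then have "\<forall>j\<in>{..<n}. A $$ (i, j) * (y i - y j)\<^sup>2 = 0"
        by (subst (asm) sum_nonneg_eq_0_iff) (use r in \<open>auto intro!: nn\<close>)
      then have "A $$ (i, j) * (y i - y j)\<^sup>2 = 0" using r by blast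
      then show ?thesis using A_pos[OF r ij] by simp
    qed
    have path: "y i = y j" if "(i, j) \<in> E\<^sup>*" for i j
      using that by (induction rule: rtrancl_induct) (auto simp: edge)
    have const: "y i = y 0" if "i < n" for i
      using path[of i 0] connected that n_ge_1 unfolding connected_graph_def by auto
    have "(\<Sum>i<n. y i) = (\<Sum>i<n. y 0)" by (intro sum.cong refl const) simp
    then have "y 0 = 0" using y(2) n_ge_1 by simp
    then have "y i = 0" if "i < n" for i using const[OF that] by simp
    then have "(\<Sum>i<n. (y i)\<^sup>2) = 0" by simp
    then show False using y(1) by simp
  qed
  ultimately have \<mu>_pos: "\<mu> > 0" by simp
  have "\<exists>k<n. y k \<noteq> 0"
  proof (rule ccontr)
    assume "\<not> ?thesis"
    then have "(\<Sum>i<n. (y i)\<^sup>2) = 0" by (intro sum.neutral) auto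
    then show False using y(1) by simp
  qed
  then have "eigenvalue L \<mu>" using eigenvalueI_sum[OF L_carrier _ _ y(3)] by blast
  \<comment> \<open>\<open>Min\<close> is a lower bound only on a finite set.\<close>
  moreover have "finite {l. eigenvalue L l \<and> l > 0}"
    using card_finite_spectrum(1)[OF L_carrier] by (rule rev_finite_subset) (auto simp: spectrum_def)
  ultimately have "min_pos_eigenvalue L \<le> \<mu>"
    unfolding min_pos_eigenvalue_def using \<mu>_pos by (intro Min_le) auto
  then have "min_pos_eigenvalue L * (\<Sum>i<n. (x i)\<^sup>2) \<le> \<mu> * (\<Sum>i<n. (x i)\<^sup>2)"
    using True by (intro mult_right_mono) auto
  then show ?thesis using y(4) by linarith
next
  case False
  then have "x i = 0" if "i < n" for i using sum_squares_eq_0_imp that by blast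
  then show ?thesis by (simp add: quad_form_def)
qed

lemma LL_carrier: "L * L \<in> carrier_mat n n"
  using L_carrier by simp

lemma LL_index: "i < n \<Longrightarrow> j < n \<Longrightarrow> (L * L) $$ (i, j) = (\<Sum>k<n. L $$ (i, k) * L $$ (k, j))"
  using L_carrier by (simp add: scalar_prod_def lessThan_atLeast0)

text \<open>The squared norm of \<open>L x\<close> is the form of \<open>L * L\<close> by symmetry.
  Its maximum is found by minimizing the negated form without constraint; it is an eigenvalue of
  \<open>L * L\<close>, hence at most the spectral radius.\<close>

lemma laplacian_norm_bound:
  "(\<Sum>i<n. (\<Sum>j<n. L $$ (i, j) * x j)\<^sup>2) \<le> spec_rad (L * L) * (\<Sum>i<n. (x i)\<^sup>2)"
proof (cases "(\<Sum>i<n. (x i)\<^sup>2) > 0")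
  case True
  let ?B = "\<lambda>i j. - ((L * L) $$ (i, j))"
  have "\<exists>y \<mu>. (\<Sum>i<n. (y i)\<^sup>2) = 1 \<and> (\<Sum>i<n. y i * 0) = 0 \<and>
    (\<forall>i<n. (\<Sum>j<n. ?B i j * y j) = \<mu> * y i) \<and>
    (\<forall>x. (\<Sum>i<n. x i * 0) = 0 \<longrightarrow> \<mu> * (\<Sum>i<n. (x i)\<^sup>2) \<le> quad_form n ?B x)"
  proof (rule rayleigh_minimum[where z = x])
    fix i j assume ij: "i < n" "j < n"
    have "(\<Sum>k<n. L $$ (i, k) * L $$ (k, j)) = (\<Sum>k<n. L $$ (j, k) * L $$ (k, i))"
    proof (intro sum.cong refl)
      fix k assume "k \<in> {..<n}"
      then have "k < n" by simp
      then show "L $$ (i, k) * L $$ (k, j) = L $$ (j, k) * L $$ (k, i)"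
        using L_sym[of i k] L_sym[of k j] ij by simp
    qed
    then show "?B i j = ?B j i" using ij by (simp only: LL_index)
  qed (use True in auto)
  then obtain y \<mu> where y: "(\<Sum>i<n. (y i)\<^sup>2) = 1"
    "\<And>i. i < n \<Longrightarrow> (\<Sum>j<n. ?B i j * y j) = \<mu> * y i" "\<mu> * (\<Sum>i<n. (x i)\<^sup>2) \<le> quad_form n ?B x"
    by auto
  have ev: "(\<Sum>j<n. (L * L) $$ (i, j) * y j) = (- \<mu>) * y i" if "i < n" for i
    using y(2)[OF that] by (simp add: sum_negf)
  have "\<exists>k<n. y k \<noteq> 0"
  proof (rule ccontr)
    assume "\<not> ?thesis"
    then have "(\<Sum>i<n. (y i)\<^sup>2) = 0" by (intro sum.neutral) auto
    then show False using y(1) by simp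
  qed
  then have \<mu>: "- \<mu> \<le> spec_rad (L * L)"
    using abs_eigenvalue_le_spec_rad[OF LL_carrier _ _ ev] by fastforce
  have "quad_form n ?B x = - (\<Sum>i<n. \<Sum>j<n. \<Sum>k<n. L $$ (i, k) * L $$ (k, j) * x i * x j)"
    unfolding quad_form_def sum_negf[symmetric]
    by (intro sum.cong refl) (simp add: LL_index sum_distrib_right sum_negf)
  also have "(\<Sum>i<n. \<Sum>j<n. \<Sum>k<n. L $$ (i, k) * L $$ (k, j) * x i * x j)
      = (\<Sum>i<n. \<Sum>k<n. \<Sum>j<n. L $$ (i, k) * L $$ (k, j) * x i * x j)"
    by (rule sum.cong[OF refl], rule sum.swap)
  also have "\<dots> = (\<Sum>k<n. \<Sum>i<n. \<Sum>j<n. L $$ (i, k) * L $$ (k, j) * x i * x j)"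
    by (rule sum.swap)
  also have "\<dots> = (\<Sum>k<n. (\<Sum>j<n. L $$ (k, j) * x j)\<^sup>2)"
    unfolding power2_eq_square sum_product
    by (intro sum.cong refl) (auto simp: L_sym)
  finally have "quad_form n ?B x = - (\<Sum>k<n. (\<Sum>j<n. L $$ (k, j) * x j)\<^sup>2)" .
  then have "(\<Sum>i<n. (\<Sum>j<n. L $$ (i, j) * x j)\<^sup>2) \<le> (- \<mu>) * (\<Sum>i<n. (x i)\<^sup>2)"
    using y(3) by simp
  also have "\<dots> \<le> spec_rad (L * L) * (\<Sum>i<n. (x i)\<^sup>2)"
    using \<mu> True by (intro mult_right_mono) auto
  finally show ?thesis .
next
  case False
  then have "x i = 0" if "i < n" for i using sum_squares_eq_0_imp that by blast
  then show ?thesis by simp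
qed

context
  fixes \<gamma> :: real
  assumes \<gamma>_pos: "0 < \<gamma>" and \<gamma>_less: "\<gamma> < d1 L"
begin

abbreviation "r \<equiv> min_pos_eigenvalue L"
abbreviation "\<rho> \<equiv> spec_rad (L * L)"

text \<open>Positivity is read off the step size: \<open>\<gamma>\<close> lies between 0 and a
  quotient that would be 0 if its denominator were, and a coordinate vector shows
  \<open>0 \<le> \<rho>\<close>. A direct argument for \<open>r\<close> would first have to exclude
  a single agent, where \<open>min_pos_eigenvalue\<close> is the \<open>Min\<close> of an empty
  set.\<close>

lemma spec_pos: "0 < \<rho>" "0 < r"
proof -
  define x where "x i = (if i = 0 then 1 else 0 :: real)" for i :: nat
  have "(\<Sum>i<n. (x i)\<^sup>2) = 1"
    using n_ge_1 by (simp add: x_def if_distrib[of "\<lambda>t. t\<^sup>2"] sum.delta cong: if_cong)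
  moreover have "0 \<le> (\<Sum>i<n. (\<Sum>j<n. L $$ (i, j) * x j)\<^sup>2)" by (intro sum_nonneg) auto
  ultimately have "0 \<le> \<rho>" using laplacian_norm_bound[of x] by simp
  moreover have "0 < r / (2 * \<rho>)" using \<gamma>_pos \<gamma>_less by (simp add: d1_def)
  ultimately show "0 < \<rho>" "0 < r" by (auto simp: zero_less_divide_iff)
qed

lemma step_size: "\<gamma>\<^sup>2 * \<rho> < \<gamma> * r / 2"
proof -
  have "\<gamma> * (2 * \<rho>) < r" using \<gamma>_less spec_pos by (simp add: d1_def pos_less_divide_eq)
  then have "\<gamma> * (\<gamma> * (2 * \<rho>)) < \<gamma> * r" using \<gamma>_pos by (intro mult_strict_left_mono)
  then show ?thesis by (simp add: power2_eq_square)
qed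

lemma eps1_pos: "0 < eps1 L \<gamma>"
  using step_size by (simp add: eps1_def)

text \<open>After expanding the square, the mixed term is bounded by the algebraic connectivity and
  the last one by the spectral radius of \<open>L * L\<close>.\<close>

lemma consensus_contraction:
  assumes y: "(\<Sum>i<n. y i) = 0"
  shows "(\<Sum>i<n. (y i - \<gamma> * (\<Sum>j<n. L $$ (i, j) * y j))\<^sup>2) \<le> (1 - 2 * \<gamma> * r + \<gamma>\<^sup>2 * \<rho>) * (\<Sum>i<n. (y i)\<^sup>2)"
proof -
  define Y where "Y = (\<Sum>i<n. (y i)\<^sup>2)"
  have "(\<Sum>i<n. (y i - \<gamma> * (\<Sum>j<n. L $$ (i, j) * y j))\<^sup>2)
      = (\<Sum>i<n. (y i)\<^sup>2 - 2 * \<gamma> * (\<Sum>j<n. L $$ (i, j) * y i * y j) + \<gamma>\<^sup>2 * (\<Sum>j<n. L $$ (i, j) * y j)\<^sup>2)"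
  proof (intro sum.cong refl)
    fix i
    have "(\<Sum>j<n. L $$ (i, j) * y i * y j) = y i * (\<Sum>j<n. L $$ (i, j) * y j)"
      by (simp add: sum_distrib_left mult_ac)
    then show "(y i - \<gamma> * (\<Sum>j<n. L $$ (i, j) * y j))\<^sup>2
      = (y i)\<^sup>2 - 2 * \<gamma> * (\<Sum>j<n. L $$ (i, j) * y i * y j) + \<gamma>\<^sup>2 * (\<Sum>j<n. L $$ (i, j) * y j)\<^sup>2"
      by (simp add: power2_diff power_mult_distrib)
  qed
  also have "\<dots> = Y - 2 * \<gamma> * quad_form n (\<lambda>i j. L $$ (i, j)) y + \<gamma>\<^sup>2 * (\<Sum>i<n. (\<Sum>j<n. L $$ (i, j) * y j)\<^sup>2)"
    by (simp add: sum.distrib sum_subtractf sum_distrib_left[symmetric] Y_def quad_form_def)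
  also have "\<dots> \<le> Y - 2 * \<gamma> * (r * Y) + \<gamma>\<^sup>2 * (\<rho> * Y)"
    unfolding Y_def using \<gamma>_pos
    by (intro add_mono diff_mono mult_left_mono algebraic_connectivity[OF y] laplacian_norm_bound) auto
  finally show ?thesis by (simp add: Y_def algebra_simps)
qed

text \<open>The Laplacian of a single vertex is zero, so \<open>\<rho>\<close> would vanish. Two
  vertices are needed for the test vector of the next bound.\<close>

lemma n_ge_2: "2 \<le> n"
proof (rule ccontr)
  assume "\<not> 2 \<le> n"
  then have n: "n = 1" using n_ge_1 by simp
  have L0: "L $$ (0, 0) = 0" using L_index[of 0 0] n by simp
  define M where "M = map_mat complex_of_real (L * L)"
  have M: "M \<in> carrier_mat 1 1" using LL_carrier n by (simp add: M_def)
  have M0: "M $$ (0, 0) = 0"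
  proof -
    have "M $$ (0, 0) = complex_of_real ((L * L) $$ (0, 0))"
      unfolding M_def using LL_carrier n by (subst index_map_mat) auto
    also have "(L * L) $$ (0, 0) = 0" using L0 LL_index[of 0 0] n by simp
    finally show ?thesis by simp
  qed
  obtain k where k: "eigenvalue M k" "norm k = \<rho>"
    using spectral_radius_mem_max(1)[OF M] by (auto simp: spectrum_def spec_rad_def M_def)
  then obtain v where v: "v \<in> carrier_vec 1" "v \<noteq> 0\<^sub>v 1" "M *\<^sub>v v = k \<cdot>\<^sub>v v"
    using M unfolding eigenvalue_def eigenvector_def by auto
  have v0: "v $ 0 \<noteq> 0"
  proof
    assume "v $ 0 = 0"
    then have "v = 0\<^sub>v 1" using v(1) by (intro eq_vecI) auto
    then show False using v(2) by simp
  qed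
  have "(M *\<^sub>v v) $ 0 = 0" using M v(1) M0 by (simp add: scalar_prod_def)
  then have "k * v $ 0 = 0" using v by simp
  then have "\<rho> = 0" using v0 k(2) by simp
  then show False using spec_pos by simp
qed

text \<open>Testing the contraction with the difference of two coordinate vectors shows that its
  factor is not negative, whence \<open>\<gamma> * r < 2 / 3\<close>. The bound makes
  \<open>3 / 2 * e1\<close> a rate below 1 and lets \<open>t > 3\<close> follow from
  \<open>t > 1 / e1\<close>.\<close>

lemma eps1_le: "eps1 L \<gamma> \<le> 1 / 3"
proof -
  define y where "y i = (if i = 0 then 1 else 0) - (if i = 1 then 1 else 0 :: real)" for i :: nat
  have s: "(\<Sum>i<n. y i) = 0"
    using n_ge_2 by (simp add: y_def sum_subtractf sum.delta)
  have "(y 0)\<^sup>2 \<le> (\<Sum>i<n. (y i)\<^sup>2)" using n_ge_2 by (intro member_le_sum) auto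
  then have pos: "0 < (\<Sum>i<n. (y i)\<^sup>2)" by (simp add: y_def)
  have "0 \<le> (\<Sum>i<n. (y i - \<gamma> * (\<Sum>j<n. L $$ (i, j) * y j))\<^sup>2)" by (intro sum_nonneg) auto
  also note consensus_contraction[OF s]
  finally have "0 \<le> 1 - 2 * \<gamma> * r + \<gamma>\<^sup>2 * \<rho>" using pos by (simp add: zero_le_mult_iff)
  then have "\<gamma> * r < 2 / 3" using step_size by (simp add: mult.assoc)
  moreover have "0 \<le> \<gamma>\<^sup>2 * \<rho>" using spec_pos by simp
  ultimately show ?thesis by (simp add: eps1_def mult.assoc)
qed

text \<open>Young's inequality with parameter \<open>\<gamma> \<rho>\<^sub>2(L)\<close>.\<close>

lemma consensus_step:
  assumes y: "(\<Sum>i<n. y i) = 0"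
  shows "(\<Sum>i<n. (y i - \<gamma> * (\<Sum>j<n. L $$ (i, j) * y j) - v i)\<^sup>2)
    \<le> (1 - 2 * eps1 L \<gamma>) * (\<Sum>i<n. (y i)\<^sup>2) + 2 * eps2 L \<gamma> * (\<Sum>i<n. (v i)\<^sup>2)"
proof -
  define c where "c = \<gamma> * r"
  have c: "c > 0" using \<gamma>_pos spec_pos by (simp add: c_def)
  have young: "(a - b)\<^sup>2 \<le> (1 + c) * a\<^sup>2 + (1 + 1 / c) * b\<^sup>2" for a b :: real
  proof -
    have "0 \<le> (c * a + b)\<^sup>2 / c" using c by simp
    also have "(c * a + b)\<^sup>2 / c = c * a\<^sup>2 + 2 * a * b + b\<^sup>2 / c"
      using c by (simp add: power2_eq_square field_simps)
    finally show ?thesis by (simp add: power2_diff algebra_simps)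
  qed
  have "(\<Sum>i<n. (y i - \<gamma> * (\<Sum>j<n. L $$ (i, j) * y j) - v i)\<^sup>2)
      \<le> (\<Sum>i<n. (1 + c) * (y i - \<gamma> * (\<Sum>j<n. L $$ (i, j) * y j))\<^sup>2 + (1 + 1 / c) * (v i)\<^sup>2)"
    by (intro sum_mono young)
  also have "\<dots> = (1 + c) * (\<Sum>i<n. (y i - \<gamma> * (\<Sum>j<n. L $$ (i, j) * y j))\<^sup>2) + (1 + 1 / c) * (\<Sum>i<n. (v i)\<^sup>2)"
    by (simp add: sum.distrib sum_distrib_left)
  also have "\<dots> \<le> (1 + c) * ((1 - 2 * c + \<gamma>\<^sup>2 * \<rho>) * (\<Sum>i<n. (y i)\<^sup>2)) + (1 + 1 / c) * (\<Sum>i<n. (v i)\<^sup>2)"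
    using consensus_contraction[OF y] c unfolding c_def by (intro add_right_mono mult_left_mono) (auto simp: mult.assoc)
  also have "\<dots> \<le> (1 - 2 * eps1 L \<gamma>) * (\<Sum>i<n. (y i)\<^sup>2) + 2 * eps2 L \<gamma> * (\<Sum>i<n. (v i)\<^sup>2)"
  proof (intro add_mono)
    \<comment> \<open>With \<open>q = \<gamma>^2 * \<rho> < c / 2\<close>, the second-order part
      \<open>c * q - 2 * c^2\<close> of the product is nonpositive; the remaining
      \<open>1 - c + q\<close> is at most \<open>1 - c + 2 * q\<close>, which is
      \<open>1 - 2 * eps1 L \<gamma>\<close>.\<close>
    have "c * (\<gamma>\<^sup>2 * \<rho>) \<le> c * (2 * c)" using step_size c by (intro mult_left_mono) (auto simp: c_def)
    then have "(1 + c) * (1 - 2 * c + \<gamma>\<^sup>2 * \<rho>) \<le> 1 - c + \<gamma>\<^sup>2 * \<rho>" by (simp add: algebra_simps)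
    also have "\<dots> \<le> 1 - 2 * eps1 L \<gamma>" using spec_pos by (simp add: eps1_def c_def)
    finally show "(1 + c) * ((1 - 2 * c + \<gamma>\<^sup>2 * \<rho>) * (\<Sum>i<n. (y i)\<^sup>2)) \<le> (1 - 2 * eps1 L \<gamma>) * (\<Sum>i<n. (y i)\<^sup>2)"
      unfolding mult.assoc[symmetric] by (intro mult_right_mono sum_nonneg) auto
    have "1 + 1 / c \<le> 2 * eps2 L \<gamma>"
    proof -
      have "eps2 L \<gamma> = (1 + 2 * c) / (2 * c)" by (simp add: eps2_def c_def mult.assoc)
      then have "2 * eps2 L \<gamma> = (1 + 2 * c) / c" using c by (simp add: field_simps)
      also have "\<dots> = 1 / c + 2" using c by (simp add: add_divide_distrib)
      finally show ?thesis by simp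
    qed
    then show "(1 + 1 / c) * (\<Sum>i<n. (v i)\<^sup>2) \<le> 2 * eps2 L \<gamma> * (\<Sum>i<n. (v i)\<^sup>2)"
      by (intro mult_right_mono sum_nonneg) auto
  qed
  finally show ?thesis .
qed

end

end

section \<open>Conditioning on the past\<close>

lemma measurable_finer:
  assumes f: "f \<in> measurable M N" and "space M' = space M" "sets M \<subseteq> sets M'"
  shows "f \<in> measurable M' N"
proof (rule measurableI)
  show "x \<in> space M' \<Longrightarrow> f x \<in> space N" for x
    using measurable_space[OF f] assms(2) by simp
  show "A \<in> sets N \<Longrightarrow> f -` A \<inter> space M' \<in> sets M'" for A
    using measurable_sets[OF f, of A] assms(2,3) by auto
qed

locale draws =
  fixes M :: "'w measure" and n p :: nat and D :: "nat \<Rightarrow> 'b measure"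
    and u :: "nat \<Rightarrow> nat \<Rightarrow> 'w \<Rightarrow> real vec" and \<xi> :: "nat \<Rightarrow> nat \<Rightarrow> 'w \<Rightarrow> 'b"
  assumes draws: "independent_draws M n p D u \<xi>"
begin

sublocale M: prob_space M using draws by (simp add: independent_draws_def)

definition events :: "(nat \<times> nat) + (nat \<times> nat) \<Rightarrow> 'w set set" where
  "events r = (case r of
     Inl (i, k) \<Rightarrow> {u i k -` B \<inter> space M | B. B \<in> sets (borel_vec p)}
   | Inr (i, k) \<Rightarrow> {\<xi> i k -` B \<inter> space M | B. B \<in> sets (D i)})"

abbreviation indices :: "((nat \<times> nat) + (nat \<times> nat)) set" where
  "indices \<equiv> ({..<n} \<times> UNIV) <+> ({..<n} \<times> UNIV)"

lemma indep_events: "M.indep_sets events indices"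
  using draws unfolding independent_draws_def events_def[abs_def] by blast

lemma u_measurable: "i < n \<Longrightarrow> u i k \<in> measurable M (borel_vec p)"
  and u_distr: "i < n \<Longrightarrow> distr M (borel_vec p) (u i k) = uniform_sphere p"
  and \<xi>_measurable: "i < n \<Longrightarrow> \<xi> i k \<in> measurable M (D i)"
  and \<xi>_distr: "i < n \<Longrightarrow> distr M (D i) (\<xi> i k) = D i"
  using draws unfolding independent_draws_def by auto

lemma events_sub: "r \<in> indices \<Longrightarrow> events r \<subseteq> sets M"
  using indep_events unfolding M.indep_sets_def by blast

lemma Int_stable_events: "Int_stable (events r)"
proof (cases r)
  case (Inl a)
  obtain i k where a: "a = (i, k)" by (cases a)
  show ?thesis unfolding Int_stable_def
  proof (intro ballI)
    fix X Y assume "X \<in> events r" "Y \<in> events r"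
    then obtain B C where B: "B \<in> sets (borel_vec p)" "X = u i k -` B \<inter> space M"
      and C: "C \<in> sets (borel_vec p)" "Y = u i k -` C \<inter> space M"
      by (auto simp: events_def Inl a)
    have e: "X \<inter> Y = u i k -` (B \<inter> C) \<inter> space M" using B C by auto
    show "X \<inter> Y \<in> events r"
      unfolding e events_def Inl a sum.case prod.case mem_Collect_eq
      by (intro exI[of _ "B \<inter> C"] conjI refl sets.Int B C)
  qed
next
  case (Inr a)
  obtain i k where a: "a = (i, k)" by (cases a)
  show ?thesis unfolding Int_stable_def
  proof (intro ballI)
    fix X Y assume "X \<in> events r" "Y \<in> events r"
    then obtain B C where B: "B \<in> sets (D i)" "X = \<xi> i k -` B \<inter> space M"
      and C: "C \<in> sets (D i)" "Y = \<xi> i k -` C \<inter> space M"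
      by (auto simp: events_def Inr a)
    have e: "X \<inter> Y = \<xi> i k -` (B \<inter> C) \<inter> space M" using B C by auto
    show "X \<inter> Y \<in> events r"
      unfolding e events_def Inr a sum.case prod.case mem_Collect_eq
      by (intro exI[of _ "B \<inter> C"] conjI refl sets.Int B C)
  qed
qed

text \<open>Only the sigma-algebra matters: measurability with respect to \<open>generated R\<close>
  says that a quantity is determined by the draws indexed by \<open>R\<close>.\<close>

definition generated :: "((nat \<times> nat) + (nat \<times> nat)) set \<Rightarrow> 'w measure" where
  "generated R = sigma (space M) (\<Union>r\<in>R. events r)"

lemma events_Pow: "(\<Union>r\<in>R. events r) \<subseteq> Pow (space M)"
proof -
  have "events r \<subseteq> Pow (space M)" for r
    by (auto simp: events_def split: sum.splits prod.splits)
  then show ?thesis by blast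
qed

lemma space_generated [simp]: "space (generated R) = space M"
  by (simp add: generated_def space_measure_of_conv)

lemma sets_generated: "sets (generated R) = sigma_sets (space M) (\<Union>r\<in>R. events r)"
  unfolding generated_def using events_Pow by (simp add: sets_measure_of)

lemma sets_generated_subset: "R \<subseteq> indices \<Longrightarrow> sets (generated R) \<subseteq> sets M"
  unfolding sets_generated using events_sub by (intro sets.sigma_sets_subset) blast

lemma measurable_generated_imp: "R \<subseteq> indices \<Longrightarrow> f \<in> measurable (generated R) N \<Longrightarrow> f \<in> measurable M N"
  by (rule measurable_finer[OF _ _ sets_generated_subset]) auto

lemma measurable_generated_mono:
  assumes "R \<subseteq> R'" and f: "f \<in> measurable (generated R) N" shows "f \<in> measurable (generated R') N"
proof -
  have "sets (generated R) \<subseteq> sets (generated R')"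
    unfolding sets_generated using assms(1) by (intro sigma_sets_mono') blast
  then show ?thesis by (intro measurable_finer[OF f]) auto
qed

lemma u_measurable_generated:
  assumes "i < n" "Inl (i, k) \<in> R" shows "u i k \<in> measurable (generated R) (borel_vec p)"
proof (rule measurableI)
  show "x \<in> space (generated R) \<Longrightarrow> u i k x \<in> space (borel_vec p)" for x
    using measurable_space[OF u_measurable[OF assms(1)], of x k] by simp
  fix B assume "B \<in> sets (borel_vec p)"
  then have "u i k -` B \<inter> space M \<in> events (Inl (i, k))" by (auto simp: events_def)
  then show "u i k -` B \<inter> space (generated R) \<in> sets (generated R)"
    using assms(2) by (auto simp: sets_generated intro!: sigma_sets.Basic)
qed

lemma \<xi>_measurable_generated:
  assumes "i < n" "Inr (i, k) \<in> R" shows "\<xi> i k \<in> measurable (generated R) (D i)"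
proof (rule measurableI)
  show "x \<in> space (generated R) \<Longrightarrow> \<xi> i k x \<in> space (D i)" for x
    using measurable_space[OF \<xi>_measurable[OF assms(1)], of x k] by simp
  fix B assume "B \<in> sets (D i)"
  then have "\<xi> i k -` B \<inter> space M \<in> events (Inr (i, k))" by (auto simp: events_def)
  then show "\<xi> i k -` B \<inter> space (generated R) \<in> sets (generated R)"
    using assms(2) by (auto simp: sets_generated intro!: sigma_sets.Basic)
qed

text \<open>Disjoint groups of independent families generate independent sigma-algebras, so the
  joint law is a product. This takes the place of conditional expectations: conditioning on the past
  becomes Fubini's theorem.\<close>

lemma distr_pair_generated:
  assumes R: "R1 \<subseteq> indices" "R2 \<subseteq> indices" "R1 \<inter> R2 = {}"
    and Y1: "Y1 \<in> measurable (generated R1) N1" and Y2: "Y2 \<in> measurable (generated R2) N2"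
  shows "distr M (N1 \<Otimes>\<^sub>M N2) (\<lambda>\<omega>. (Y1 \<omega>, Y2 \<omega>)) = distr M N1 Y1 \<Otimes>\<^sub>M distr M N2 Y2"
proof -
  note m = measurable_generated_imp[OF R(1) Y1] measurable_generated_imp[OF R(2) Y2]
  have mp: "(\<lambda>\<omega>. (Y1 \<omega>, Y2 \<omega>)) \<in> measurable M (N1 \<Otimes>\<^sub>M N2)" by (intro measurable_Pair m)
  define G where "G b = (if b then R1 else R2)" for b
  have "M.indep_sets (\<lambda>j. sigma_sets (space M) (\<Union>i\<in>G j. events i)) UNIV"
  proof (rule M.indep_sets_collect_sigma)
    show "M.indep_sets events (\<Union>j\<in>UNIV. G j)"
      by (rule M.indep_sets_mono_index[OF _ indep_events]) (use R in \<open>auto simp: G_def split: if_splits\<close>)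
    show "disjoint_family_on G UNIV"
      using R(3) by (auto simp: disjoint_family_on_def G_def)
  qed (rule Int_stable_events)
  then have ind: "M.indep_sets (\<lambda>j. sets (generated (G j))) UNIV" by (simp add: sets_generated)
  show ?thesis
  proof (rule pair_measure_eqI[symmetric])
    show "sigma_finite_measure (distr M N1 Y1)" "sigma_finite_measure (distr M N2 Y2)"
      using m by (auto intro!: prob_space_imp_sigma_finite M.prob_space_distr)
    fix B C assume "B \<in> sets (distr M N1 Y1)" "C \<in> sets (distr M N2 Y2)"
    then have B: "B \<in> sets N1" and C: "C \<in> sets N2" by auto
    define X where "X b = (if b then Y1 -` B \<inter> space M else Y2 -` C \<inter> space M)" for b
    have X: "X b \<in> sets (generated (G b))" for b
      using measurable_sets[OF Y1 B] measurable_sets[OF Y2 C] by (auto simp: X_def G_def)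
    have "M.prob (\<Inter>b\<in>UNIV. X b) = (\<Prod>b\<in>UNIV. M.prob (X b))"
      by (rule M.indep_setsD[OF ind]) (use X in auto)
    then have pr: "M.prob (X True \<inter> X False) = M.prob (X True) * M.prob (X False)"
      by (simp add: UNIV_bool Int_commute mult.commute)
    have "emeasure (distr M (N1 \<Otimes>\<^sub>M N2) (\<lambda>\<omega>. (Y1 \<omega>, Y2 \<omega>))) (B \<times> C)
        = emeasure M ((\<lambda>\<omega>. (Y1 \<omega>, Y2 \<omega>)) -` (B \<times> C) \<inter> space M)"
      using B C by (intro emeasure_distr mp) auto
    also have "(\<lambda>\<omega>. (Y1 \<omega>, Y2 \<omega>)) -` (B \<times> C) \<inter> space M = X True \<inter> X False" by (auto simp: X_def)
    also have "emeasure M (X True \<inter> X False) = emeasure M (X True) * emeasure M (X False)"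
      by (simp add: M.emeasure_eq_measure pr ennreal_mult)
    also have "\<dots> = emeasure (distr M N1 Y1) B * emeasure (distr M N2 Y2) C"
      using B C m by (simp add: emeasure_distr X_def)
    finally show "emeasure (distr M N1 Y1) B * emeasure (distr M N2 Y2) C
      = emeasure (distr M (N1 \<Otimes>\<^sub>M N2) (\<lambda>\<omega>. (Y1 \<omega>, Y2 \<omega>))) (B \<times> C)" by simp
  qed (simp cong: sets_pair_measure_cong)
qed

text \<open>Two splittings: the direction from the sample of the same draw, and this pair from
  everything indexed by \<open>R\<close>.\<close>

lemma distr_fresh_draw:
  assumes i: "i < n" and R: "R \<subseteq> indices" "Inl (i, k) \<notin> R" "Inr (i, k) \<notin> R"
    and Y: "Y \<in> measurable (generated R) N"
  shows "distr M (N \<Otimes>\<^sub>M (borel_vec p \<Otimes>\<^sub>M D i)) (\<lambda>\<omega>. (Y \<omega>, (u i k \<omega>, \<xi> i k \<omega>)))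
    = distr M N Y \<Otimes>\<^sub>M (uniform_sphere p \<Otimes>\<^sub>M D i)"
proof -
  have ix: "Inl (i, k) \<in> indices" "Inr (i, k) \<in> indices" using i by auto
  then have "distr M (borel_vec p \<Otimes>\<^sub>M D i) (\<lambda>\<omega>. (u i k \<omega>, \<xi> i k \<omega>)) = uniform_sphere p \<Otimes>\<^sub>M D i"
    using distr_pair_generated[of "{Inl (i, k)}" "{Inr (i, k)}" "u i k" "borel_vec p" "\<xi> i k" "D i"] i
    by (simp add: u_distr \<xi>_distr u_measurable_generated \<xi>_measurable_generated)
  moreover have "distr M (N \<Otimes>\<^sub>M (borel_vec p \<Otimes>\<^sub>M D i)) (\<lambda>\<omega>. (Y \<omega>, (u i k \<omega>, \<xi> i k \<omega>)))
    = distr M N Y \<Otimes>\<^sub>M distr M (borel_vec p \<Otimes>\<^sub>M D i) (\<lambda>\<omega>. (u i k \<omega>, \<xi> i k \<omega>))"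
    by (rule distr_pair_generated[of R "{Inl (i, k), Inr (i, k)}"])
      (use i R Y in \<open>auto intro!: measurable_Pair u_measurable_generated \<xi>_measurable_generated\<close>)
  ultimately show ?thesis by simp
qed

lemma prob_uniform_sphere: "1 \<le> n \<Longrightarrow> prob_space (uniform_sphere p)"
  using M.prob_space_distr[OF u_measurable[of 0 0]] u_distr[of 0 0] by simp

end

locale estimators = draws M n p D u \<xi>
  for M :: "'w measure" and n p and D :: "nat \<Rightarrow> 'b measure" and u \<xi> +
  fixes F :: "nat \<Rightarrow> real vec \<Rightarrow> 'b \<Rightarrow> real" and L\<^sub>f \<sigma>\<^sub>0 \<sigma>\<^sub>1 :: real
  assumes n_ge_1: "1 \<le> n" and p_ge_1: "1 \<le> p"
    and stochastic: "stochastic_functions n p D F"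
    and L\<^sub>f_pos: "0 < L\<^sub>f" and smooth: "\<And>i. i < n \<Longrightarrow> AE z in D i. smooth_with p L\<^sub>f (\<lambda>y. F i y z)"
    and variance: "gradient_variance_bound n p D F \<sigma>\<^sub>0 \<sigma>\<^sub>1"
begin

lemma agent: "i < n \<Longrightarrow> agent p (D i) (F i) L\<^sub>f \<sigma>\<^sub>0 \<sigma>\<^sub>1 (local_obj D F i)"
proof -
  assume i: "i < n"
  have s: "prob_space (D i)" "(\<lambda>(x, z). F i x z) \<in> borel_measurable (borel_vec p \<Otimes>\<^sub>M D i)"
    "\<And>x. x \<in> carrier_vec p \<Longrightarrow> integrable (D i) (F i x)"
    using stochastic i unfolding stochastic_functions_def by auto
  show ?thesis
  proof (intro agent.intro agent_axioms.intro sphere.intro)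
    show "prob_space (uniform_sphere p)" by (rule prob_uniform_sphere[OF n_ge_1])
    show "local_obj D F i = (\<lambda>x. \<integral>z. F i x z \<partial>D i)" by (simp add: local_obj_def fun_eq_iff)
    show "(\<integral>\<^sup>+z. ennreal ((vnorm (gradient p (\<lambda>y. F i y z) x - gradient p (local_obj D F i) x))\<^sup>2) \<partial>D i)
        \<le> ennreal (\<sigma>\<^sub>0\<^sup>2 * (vnorm (gradient p (local_obj D F i) x))\<^sup>2 + \<sigma>\<^sub>1\<^sup>2)"
      if "x \<in> carrier_vec p" for x
      using variance i that unfolding gradient_variance_bound_def by blast
  qed (fact p_ge_1 s L\<^sub>f_pos smooth[OF i])+
qed

section \<open>Conditional moments of the estimators\<close>

abbreviation "est i k \<delta> x \<omega> \<equiv> zo_gradient p (F i) \<delta> (u i k \<omega>) (\<xi> i k \<omega>) x"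
abbreviation "est_mean i \<equiv> agent.zo_mean p (D i) (F i)"

lemma measurable_zo_generated:
  assumes i: "i < n" and X: "X \<in> measurable (generated R) (borel_vec p)"
    and R: "Inl (i, k) \<in> R" "Inr (i, k) \<in> R"
  shows "(\<lambda>\<omega>. est i k \<delta> (X \<omega>) \<omega>) \<in> measurable (generated R) (borel_vec p)"
proof -
  interpret agent p "D i" "F i" L\<^sub>f \<sigma>\<^sub>0 \<sigma>\<^sub>1 "local_obj D F i" by (rule agent[OF i])
  have "(\<lambda>\<omega>. (X \<omega>, (u i k \<omega>, \<xi> i k \<omega>))) \<in> measurable (generated R) (borel_vec p \<Otimes>\<^sub>M (borel_vec p \<Otimes>\<^sub>M D i))"
    by (intro measurable_Pair X u_measurable_generated[OF i R(1)] \<xi>_measurable_generated[OF i R(2)])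
  from measurable_compose[OF this measurable_zo[of \<delta>]] show ?thesis by simp
qed

text \<open>The tower property with a weight \<open>H\<close> known from \<open>R\<close>. Besides
  the past, \<open>R\<close> may contain the current draws of other agents; the mixed terms of the
  averaged estimator use this freedom.\<close>

lemma expectation_zo:
  assumes i: "i < n" and R: "R \<subseteq> indices" "Inl (i, k) \<notin> R" "Inr (i, k) \<notin> R"
    and X: "X \<in> measurable (generated R) (borel_vec p)" and H: "H \<in> borel_measurable (generated R)"
    and c: "c < p" and int: "integrable M (\<lambda>\<omega>. H \<omega> * est i k \<delta> (X \<omega>) \<omega> $ c)"
  shows "(\<integral>\<omega>. H \<omega> * est i k \<delta> (X \<omega>) \<omega> $ c \<partial>M) = (\<integral>\<omega>. H \<omega> * est_mean i \<delta> (X \<omega>) $ c \<partial>M)"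
proof -
  interpret ag: agent p "D i" "F i" L\<^sub>f \<sigma>\<^sub>0 \<sigma>\<^sub>1 "local_obj D F i" by (rule agent[OF i])
  let ?N = "borel_vec p \<Otimes>\<^sub>M (borel :: real measure)"
  let ?UD = "uniform_sphere p \<Otimes>\<^sub>M D i"
  have Y: "(\<lambda>\<omega>. (X \<omega>, H \<omega>)) \<in> measurable (generated R) ?N" by (intro measurable_Pair X H)
  note YM = measurable_generated_imp[OF R(1) Y]
  define P where "P = distr M ?N (\<lambda>\<omega>. (X \<omega>, H \<omega>))"
  interpret P: prob_space P unfolding P_def by (rule M.prob_space_distr[OF YM])
  interpret PU: pair_sigma_finite P ?UD ..
  let ?T = "\<lambda>\<omega>. ((X \<omega>, H \<omega>), (u i k \<omega>, \<xi> i k \<omega>))"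
  have d: "distr M (?N \<Otimes>\<^sub>M (borel_vec p \<Otimes>\<^sub>M D i)) ?T = P \<Otimes>\<^sub>M ?UD"
    unfolding P_def by (rule distr_fresh_draw[OF i R Y])
  have Tm: "?T \<in> measurable M (?N \<Otimes>\<^sub>M (borel_vec p \<Otimes>\<^sub>M D i))"
    by (intro measurable_Pair YM u_measurable[OF i] \<xi>_measurable[OF i])
  define \<psi> where "\<psi> = (\<lambda>(y, s). snd y * zo_gradient p (F i) \<delta> (fst s) (snd s) (fst y) $ c)"
  have \<psi>m: "\<psi> \<in> borel_measurable (?N \<Otimes>\<^sub>M (borel_vec p \<Otimes>\<^sub>M D i))"
  proof -
    have "(\<lambda>w. (fst (fst w), snd w)) \<in> measurable (?N \<Otimes>\<^sub>M (borel_vec p \<Otimes>\<^sub>M D i))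
        (borel_vec p \<Otimes>\<^sub>M (borel_vec p \<Otimes>\<^sub>M D i))" by measurable
    from measurable_vec_index[OF measurable_compose[OF this ag.measurable_zo[of \<delta>]] c]
    show ?thesis unfolding \<psi>_def split_beta' by (intro borel_measurable_times) auto
  qed
  have ip: "integrable (P \<Otimes>\<^sub>M ?UD) \<psi>"
    unfolding d[symmetric] using int by (subst integrable_distr_eq[OF Tm \<psi>m]) (simp add: \<psi>_def)
  have "(\<integral>\<omega>. H \<omega> * est i k \<delta> (X \<omega>) \<omega> $ c \<partial>M) = (\<integral>w. \<psi> w \<partial>(P \<Otimes>\<^sub>M ?UD))"
    unfolding d[symmetric] by (subst integral_distr[OF Tm \<psi>m]) (simp add: \<psi>_def)
  also have "\<dots> = (\<integral>y. (\<integral>s. \<psi> (y, s) \<partial>?UD) \<partial>P)"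
    by (rule PU.integral_fst'[OF ip, symmetric])
  also have "\<dots> = (\<integral>y. snd y * ag.zo_mean \<delta> (fst y) $ c \<partial>P)"
    using c by (simp add: \<psi>_def ag.zo_mean_def)
  also have "\<dots> = (\<integral>\<omega>. H \<omega> * ag.zo_mean \<delta> (X \<omega>) $ c \<partial>M)"
  proof -
    have "(\<lambda>y. snd y * ag.zo_mean \<delta> (fst y) $ c) \<in> borel_measurable ?N"
      by (intro borel_measurable_times measurable_snd
        measurable_vec_index[OF measurable_compose[OF measurable_fst ag.measurable_zo_mean] c])
    then show ?thesis unfolding P_def by (subst integral_distr[OF YM]) auto
  qed
  finally show ?thesis .
qed

text \<open>Stated with nonnegative integrals, so that square integrability of the estimator can be
  deduced from it instead of being presupposed.\<close>

lemma second_moment_zo: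
  assumes i: "i < n" and R: "R \<subseteq> indices" "Inl (i, k) \<notin> R" "Inr (i, k) \<notin> R"
    and X: "X \<in> measurable (generated R) (borel_vec p)" and \<delta>: "0 < \<delta>"
  shows "(\<integral>\<^sup>+\<omega>. ennreal ((vnorm (est i k \<delta> (X \<omega>) \<omega>))\<^sup>2) \<partial>M)
    \<le> (\<integral>\<^sup>+\<omega>. ennreal (4 * p * (1 + \<sigma>\<^sub>0\<^sup>2) * (vnorm (gradient p (local_obj D F i) (X \<omega>)))\<^sup>2
        + 4 * p * \<sigma>\<^sub>1\<^sup>2 + p\<^sup>2 * L\<^sub>f\<^sup>2 * \<delta>\<^sup>2 / 2) \<partial>M)"
proof -
  interpret ag: agent p "D i" "F i" L\<^sub>f \<sigma>\<^sub>0 \<sigma>\<^sub>1 "local_obj D F i" by (rule agent[OF i])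
  let ?UD = "uniform_sphere p \<Otimes>\<^sub>M D i"
  note XM = measurable_generated_imp[OF R(1) X]
  define P where "P = distr M (borel_vec p) X"
  interpret P: prob_space P unfolding P_def by (rule M.prob_space_distr[OF XM])
  let ?T = "\<lambda>\<omega>. (X \<omega>, (u i k \<omega>, \<xi> i k \<omega>))"
  have d: "distr M (borel_vec p \<Otimes>\<^sub>M (borel_vec p \<Otimes>\<^sub>M D i)) ?T = P \<Otimes>\<^sub>M ?UD"
    unfolding P_def by (rule distr_fresh_draw[OF i R X])
  have Tm: "?T \<in> measurable M (borel_vec p \<Otimes>\<^sub>M (borel_vec p \<Otimes>\<^sub>M D i))"
    by (intro measurable_Pair XM u_measurable[OF i] \<xi>_measurable[OF i])
  define \<psi> where "\<psi> = (\<lambda>(x, s). ennreal ((vnorm (zo_gradient p (F i) \<delta> (fst s) (snd s) x))\<^sup>2))"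
  have \<psi>m: "\<psi> \<in> borel_measurable (borel_vec p \<Otimes>\<^sub>M (borel_vec p \<Otimes>\<^sub>M D i))"
    using measurable_vnorm[OF ag.measurable_zo[of \<delta>]] unfolding \<psi>_def split_beta' by measurable
  have \<psi>m': "\<psi> \<in> borel_measurable (P \<Otimes>\<^sub>M ?UD)"
    using \<psi>m unfolding d[symmetric] by simp
  define b where "b x = ennreal (4 * p * (1 + \<sigma>\<^sub>0\<^sup>2) * (vnorm (gradient p (local_obj D F i) x))\<^sup>2
        + 4 * p * \<sigma>\<^sub>1\<^sup>2 + p\<^sup>2 * L\<^sub>f\<^sup>2 * \<delta>\<^sup>2 / 2)" for x
  have bm: "b \<in> borel_measurable (borel_vec p)"
  proof -
    have [measurable]: "(\<lambda>x. vnorm (gradient p (local_obj D F i) x)) \<in> borel_measurable (borel_vec p)"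
      by (rule measurable_vnorm[OF measurable_gradient[OF ag.local_smooth less_imp_le[OF L\<^sub>f_pos] ag.f_measurable]])
    show ?thesis unfolding b_def[abs_def] by measurable
  qed
  have "(\<integral>\<^sup>+\<omega>. ennreal ((vnorm (est i k \<delta> (X \<omega>) \<omega>))\<^sup>2) \<partial>M) = (\<integral>\<^sup>+w. \<psi> w \<partial>(P \<Otimes>\<^sub>M ?UD))"
    unfolding d[symmetric] using \<psi>m by (subst nn_integral_distr[OF Tm]) (auto simp: \<psi>_def)
  also have "\<dots> = (\<integral>\<^sup>+x. (\<integral>\<^sup>+s. \<psi> (x, s) \<partial>?UD) \<partial>P)"
    by (rule ag.UD.nn_integral_fst[OF \<psi>m', symmetric])
  also have "\<dots> \<le> (\<integral>\<^sup>+x. b x \<partial>P)"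
  proof (rule nn_integral_mono)
    fix x assume "x \<in> space P"
    then have "x \<in> carrier_vec p" by (simp add: P_def)
    from ag.zo_second_moment[OF this \<delta>] show "(\<integral>\<^sup>+s. \<psi> (x, s) \<partial>?UD) \<le> b x" by (simp add: \<psi>_def b_def)
  qed
  also have "\<dots> = (\<integral>\<^sup>+\<omega>. b (X \<omega>) \<partial>M)" unfolding P_def using bm by (intro nn_integral_distr[OF XM]) auto
  finally show ?thesis by (simp add: b_def)
qed

end

section \<open>One step of the algorithm\<close>

definition sq_integrable :: "'a measure \<Rightarrow> ('a \<Rightarrow> real) \<Rightarrow> bool" where
  "sq_integrable M h \<longleftrightarrow> h \<in> borel_measurable M \<and> integrable M (\<lambda>\<omega>. (h \<omega>)\<^sup>2)"

lemma sq_integrable_mult: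
  assumes "sq_integrable M f" "sq_integrable M g" shows "integrable M (\<lambda>\<omega>. f \<omega> * g \<omega>)"
proof (rule Bochner_Integration.integrable_bound)
  show "integrable M (\<lambda>\<omega>. (f \<omega>)\<^sup>2 + (g \<omega>)\<^sup>2)" using assms by (simp add: sq_integrable_def)
  show "(\<lambda>\<omega>. f \<omega> * g \<omega>) \<in> borel_measurable M" using assms by (auto simp: sq_integrable_def)
  have "\<bar>f \<omega> * g \<omega>\<bar> \<le> (f \<omega>)\<^sup>2 + (g \<omega>)\<^sup>2" for \<omega>
  proof -
    have "2 * \<bar>f \<omega> * g \<omega>\<bar> \<le> (f \<omega>)\<^sup>2 + (g \<omega>)\<^sup>2"
      using sum_squares_bound[of "\<bar>f \<omega>\<bar>" "\<bar>g \<omega>\<bar>"] by (simp add: abs_mult)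
    then show ?thesis by linarith
  qed
  then show "AE \<omega> in M. norm (f \<omega> * g \<omega>) \<le> norm ((f \<omega>)\<^sup>2 + (g \<omega>)\<^sup>2)" by simp
qed

lemma sq_integrable_add:
  assumes "sq_integrable M f" "sq_integrable M g" shows "sq_integrable M (\<lambda>\<omega>. f \<omega> + g \<omega>)"
proof -
  have "integrable M (\<lambda>\<omega>. (f \<omega>)\<^sup>2 + (g \<omega>)\<^sup>2 + 2 * (f \<omega> * g \<omega>))"
    using assms sq_integrable_mult[OF assms] by (simp add: sq_integrable_def)
  then show ?thesis using assms by (auto simp: sq_integrable_def power2_sum mult.assoc)
qed

lemma sq_integrable_cmult:
  "sq_integrable M f \<Longrightarrow> sq_integrable M (\<lambda>\<omega>. a * f \<omega>)"
  by (auto simp: sq_integrable_def power_mult_distrib)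

lemma sq_integrable_diff:
  assumes "sq_integrable M f" "sq_integrable M g" shows "sq_integrable M (\<lambda>\<omega>. f \<omega> - g \<omega>)"
  using sq_integrable_add[OF assms(1) sq_integrable_cmult[OF assms(2), of "-1"]] by simp

lemma sq_integrable_sum:
  "finite I \<Longrightarrow> (\<And>i. i \<in> I \<Longrightarrow> sq_integrable M (f i)) \<Longrightarrow> sq_integrable M (\<lambda>\<omega>. \<Sum>i\<in>I. f i \<omega>)"
proof (induction I rule: finite_induct)
  case empty
  then show ?case by (simp add: sq_integrable_def)
next
  case (insert x F)
  then show ?case by (simp add: sq_integrable_add)
qed

lemma sq_integrable_divide:
  "sq_integrable M f \<Longrightarrow> sq_integrable M (\<lambda>\<omega>. f \<omega> / a)"
  using sq_integrable_cmult[of M f "1 / a"] by simp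

definition sq_integrable_vec :: "nat \<Rightarrow> 'a measure \<Rightarrow> ('a \<Rightarrow> real vec) \<Rightarrow> bool" where
  "sq_integrable_vec p M Y \<longleftrightarrow> Y \<in> measurable M (borel_vec p) \<and> integrable M (\<lambda>\<omega>. (vnorm (Y \<omega>))\<^sup>2)"

lemma sq_integrable_vec_index:
  assumes "sq_integrable_vec p M Y" "c < p" shows "sq_integrable M (\<lambda>\<omega>. Y \<omega> $ c)"
  unfolding sq_integrable_def
proof
  have Y: "Y \<in> measurable M (borel_vec p)" using assms(1) by (simp add: sq_integrable_vec_def)
  show m: "(\<lambda>\<omega>. Y \<omega> $ c) \<in> borel_measurable M" by (rule measurable_vec_index[OF Y assms(2)])
  show "integrable M (\<lambda>\<omega>. (Y \<omega> $ c)\<^sup>2)"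
  proof (rule Bochner_Integration.integrable_bound)
    show "integrable M (\<lambda>\<omega>. (vnorm (Y \<omega>))\<^sup>2)" using assms(1) by (simp add: sq_integrable_vec_def)
    show "(\<lambda>\<omega>. (Y \<omega> $ c)\<^sup>2) \<in> borel_measurable M" using m by simp
    have "(Y \<omega> $ c)\<^sup>2 \<le> (vnorm (Y \<omega>))\<^sup>2" if "\<omega> \<in> space M" for \<omega>
      using abs_index_le_vnorm[of "Y \<omega>" p c] measurable_space[OF Y that] assms(2) by (simp add: abs_le_square_iff[symmetric])
    then show "AE \<omega> in M. norm ((Y \<omega> $ c)\<^sup>2) \<le> norm ((vnorm (Y \<omega>))\<^sup>2)" by simp
  qed
qed

lemma sq_integrable_vecI:
  assumes c: "\<And>\<omega>. \<omega> \<in> space M \<Longrightarrow> Y \<omega> \<in> carrier_vec p"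
    and i: "\<And>c. c < p \<Longrightarrow> sq_integrable M (\<lambda>\<omega>. Y \<omega> $ c)"
  shows "sq_integrable_vec p M Y"
  unfolding sq_integrable_vec_def
proof
  show "Y \<in> measurable M (borel_vec p)"
    using c i by (intro measurable_borel_vecI) (auto simp: sq_integrable_def)
  have "integrable M (\<lambda>\<omega>. \<Sum>c<p. (Y \<omega> $ c)\<^sup>2)"
    using i by (intro Bochner_Integration.integrable_sum) (auto simp: sq_integrable_def)
  moreover have "(vnorm (Y \<omega>))\<^sup>2 = (\<Sum>c<p. (Y \<omega> $ c)\<^sup>2)" if "\<omega> \<in> space M" for \<omega>
    by (rule vnorm_power2_eq_sum[OF c[OF that]])
  ultimately show "integrable M (\<lambda>\<omega>. (vnorm (Y \<omega>))\<^sup>2)"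
    by (simp cong: Bochner_Integration.integrable_cong)
qed

text \<open>Maps of at most linear growth preserve finite second moments; gradients and estimator
  means are of this kind.\<close>

lemma (in finite_measure) sq_integrable_vec_comp:
  assumes X: "sq_integrable_vec p M X" and G: "G \<in> measurable (borel_vec p) (borel_vec p)"
    and b: "\<And>x. x \<in> carrier_vec p \<Longrightarrow> (vnorm (G x))\<^sup>2 \<le> a + b * (vnorm x)\<^sup>2"
  shows "sq_integrable_vec p M (\<lambda>\<omega>. G (X \<omega>))"
  unfolding sq_integrable_vec_def
proof
  have Xm: "X \<in> measurable M (borel_vec p)" using X by (simp add: sq_integrable_vec_def)
  show m: "(\<lambda>\<omega>. G (X \<omega>)) \<in> measurable M (borel_vec p)" by (rule measurable_compose[OF Xm G])
  show "integrable M (\<lambda>\<omega>. (vnorm (G (X \<omega>)))\<^sup>2)"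
  proof (rule Bochner_Integration.integrable_bound)
    show "integrable M (\<lambda>\<omega>. a + b * (vnorm (X \<omega>))\<^sup>2)" using X by (simp add: sq_integrable_vec_def)
    show "(\<lambda>\<omega>. (vnorm (G (X \<omega>)))\<^sup>2) \<in> borel_measurable M"
      using measurable_vnorm[OF m] by measurable
    have "(vnorm (G (X \<omega>)))\<^sup>2 \<le> a + b * (vnorm (X \<omega>))\<^sup>2" if "\<omega> \<in> space M" for \<omega>
      using b[of "X \<omega>"] measurable_space[OF Xm that] by simp
    then show "AE \<omega> in M. norm ((vnorm (G (X \<omega>)))\<^sup>2) \<le> norm (a + b * (vnorm (X \<omega>))\<^sup>2)"
      by (intro AE_I2) (metis abs_ge_self abs_of_nonneg order_trans real_norm_def zero_le_power2)
  qed
qed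

lemma smooth_gradient_growth:
  assumes sm: "smooth_with p L h" and x: "x \<in> carrier_vec p" and y: "y \<in> carrier_vec p"
  shows "(vnorm (gradient p h x))\<^sup>2 \<le> 2 * L\<^sup>2 * (vnorm (x - y))\<^sup>2 + 2 * (vnorm (gradient p h y))\<^sup>2"
proof -
  note g = smooth_has_gradient(2)[OF sm x] smooth_has_gradient(2)[OF sm y]
  have "gradient p h x = (gradient p h x - gradient p h y) + gradient p h y"
    using g by (intro eq_vecI) auto
  then have "(vnorm (gradient p h x))\<^sup>2 \<le> 2 * (vnorm (gradient p h x - gradient p h y))\<^sup>2 + 2 * (vnorm (gradient p h y))\<^sup>2"
    using vnorm_power2_add_le[of "gradient p h x - gradient p h y" p "gradient p h y"] g by simp
  also have "(vnorm (gradient p h x - gradient p h y))\<^sup>2 \<le> (L * vnorm (x - y))\<^sup>2"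
    by (intro power_mono smooth_lipschitz[OF sm x y]) auto
  finally show ?thesis by (simp add: power_mult_distrib)
qed

section \<open>Averages and disagreement\<close>

lemma avg_carrier [simp]: "avg n p x \<in> carrier_vec p"
  by (simp add: avg_def)

lemma avg_index: "c < p \<Longrightarrow> avg n p x $ c = (\<Sum>i<n. x i $ c) / real n"
  by (simp add: avg_def)

text \<open>Both parts follow from the variance identity: the sum of squared deviations is the sum
  of squares minus \<open>n * m^2\<close>.\<close>

lemma square_mean_le:
  fixes a :: "nat \<Rightarrow> real"
  assumes "1 \<le> n"
  shows "((\<Sum>i<n. a i) / real n)\<^sup>2 \<le> (\<Sum>i<n. (a i)\<^sup>2) / real n"
    and "(\<Sum>i<n. (a i - (\<Sum>i<n. a i) / real n)\<^sup>2) \<le> (\<Sum>i<n. (a i)\<^sup>2)"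
proof -
  define m where "m = (\<Sum>i<n. a i) / real n"
  have s: "(\<Sum>i<n. a i) = real n * m" using assms by (simp add: m_def)
  have "(\<Sum>i<n. (a i - m)\<^sup>2) = (\<Sum>i<n. (a i)\<^sup>2 - 2 * m * a i + m\<^sup>2)"
    by (intro sum.cong refl) (simp add: power2_diff algebra_simps)
  also have "\<dots> = (\<Sum>i<n. (a i)\<^sup>2) - real n * m\<^sup>2"
    by (simp add: sum.distrib sum_subtractf sum_distrib_left[symmetric] s power2_eq_square)
  finally have e: "(\<Sum>i<n. (a i - m)\<^sup>2) = (\<Sum>i<n. (a i)\<^sup>2) - real n * m\<^sup>2" .
  then show "(\<Sum>i<n. (a i - (\<Sum>i<n. a i) / real n)\<^sup>2) \<le> (\<Sum>i<n. (a i)\<^sup>2)"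
    by (simp add: m_def)
  have "0 \<le> (\<Sum>i<n. (a i - m)\<^sup>2)" by (intro sum_nonneg) auto
  then have "real n * m\<^sup>2 \<le> (\<Sum>i<n. (a i)\<^sup>2)" using e by simp
  then show "((\<Sum>i<n. a i) / real n)\<^sup>2 \<le> (\<Sum>i<n. (a i)\<^sup>2) / real n"
    using assms by (simp add: m_def[symmetric] pos_le_divide_eq mult.commute)
qed

lemma vnorm_avg_le:
  assumes "1 \<le> n" "\<And>i. i < n \<Longrightarrow> v i \<in> carrier_vec p"
  shows "(vnorm (avg n p v))\<^sup>2 \<le> (\<Sum>i<n. (vnorm (v i))\<^sup>2) / real n"
proof -
  have "(vnorm (avg n p v))\<^sup>2 = (\<Sum>c<p. ((\<Sum>i<n. v i $ c) / real n)\<^sup>2)"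
    by (simp add: vnorm_power2_eq_sum[of _ p] avg_index)
  also have "\<dots> \<le> (\<Sum>c<p. (\<Sum>i<n. (v i $ c)\<^sup>2) / real n)"
    by (intro sum_mono square_mean_le(1) assms(1))
  also have "\<dots> = (\<Sum>i<n. \<Sum>c<p. (v i $ c)\<^sup>2) / real n"
    by (subst sum.swap) (simp add: sum_divide_distrib)
  also have "\<dots> = (\<Sum>i<n. (vnorm (v i))\<^sup>2) / real n"
    using assms(2) by (simp add: vnorm_power2_eq_sum[of _ p])
  finally show ?thesis .
qed

text \<open>Swapping the sums decouples the coordinates. The Laplacian mixes agents but not
  coordinates, so the scalar spectral bounds apply to each coordinate.\<close>

lemma disagreement_eq:
  assumes "\<And>i. i < n \<Longrightarrow> x i \<in> carrier_vec p"
  shows "disagreement n p x = (\<Sum>c<p. \<Sum>i<n. (x i $ c - (\<Sum>j<n. x j $ c) / real n)\<^sup>2) / real n"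
proof -
  have "(\<Sum>i<n. (vnorm (x i - avg n p x))\<^sup>2) = (\<Sum>i<n. \<Sum>c<p. (x i $ c - (\<Sum>j<n. x j $ c) / real n)\<^sup>2)"
  proof (intro sum.cong refl)
    fix i assume "i \<in> {..<n}"
    then have "(vnorm (x i - avg n p x))\<^sup>2 = (\<Sum>c<p. ((x i - avg n p x) $ c)\<^sup>2)"
      using assms by (intro vnorm_power2_eq_sum) auto
    also have "\<dots> = (\<Sum>c<p. (x i $ c - (\<Sum>j<n. x j $ c) / real n)\<^sup>2)"
      by (intro sum.cong refl) (simp add: avg_def)
    finally show "(vnorm (x i - avg n p x))\<^sup>2 = (\<Sum>c<p. (x i $ c - (\<Sum>j<n. x j $ c) / real n)\<^sup>2)" .
  qed
  then show ?thesis unfolding disagreement_def by (simp add: sum.swap[of _ "{..<n}"])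
qed

lemma disagreement_nonneg: "0 \<le> disagreement n p x"
  by (simp add: disagreement_def sum_nonneg)

context estimators
begin

abbreviation "loc i \<equiv> local_obj D F i"
abbreviation "f \<equiv> global_obj n D F"

lemma loc_smooth: "i < n \<Longrightarrow> smooth_with p L\<^sub>f (loc i)"
  using agent.local_smooth[OF agent] .

lemma loc_measurable: "i < n \<Longrightarrow> loc i \<in> borel_measurable (borel_vec p)"
  using agent.f_measurable[OF agent] .

lemma loc_gradient_carrier: "i < n \<Longrightarrow> x \<in> carrier_vec p \<Longrightarrow> gradient p (loc i) x \<in> carrier_vec p"
  using smooth_has_gradient(2)[OF loc_smooth] .

lemma f_smooth: "smooth_with p L\<^sub>f f"
  and f_gradient: "x \<in> carrier_vec p \<Longrightarrow> gradient p f x = avg n p (\<lambda>i. gradient p (loc i) x)"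
proof -
  let ?g = "\<lambda>x. avg n p (\<lambda>i. gradient p (loc i) x)"
  have q: "\<bar>f (x + d) - f x - ?g x \<bullet> d\<bar> \<le> L\<^sub>f / 2 * (vnorm d)\<^sup>2"
    if x: "x \<in> carrier_vec p" and d: "d \<in> carrier_vec p" for x d
  proof -
    have "?g x \<bullet> d = (\<Sum>c<p. (\<Sum>i<n. gradient p (loc i) x $ c) / real n * d $ c)"
      using d by (simp add: scalar_prod_sum[of d p] avg_index)
    also have "\<dots> = (\<Sum>c<p. \<Sum>i<n. gradient p (loc i) x $ c * d $ c) / real n"
      by (simp add: sum_divide_distrib sum_distrib_right)
    also have "\<dots> = (\<Sum>i<n. gradient p (loc i) x \<bullet> d) / real n"
      using d by (subst sum.swap) (simp add: scalar_prod_sum[of d p])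
    finally have "f (x + d) - f x - ?g x \<bullet> d
        = (\<Sum>i<n. loc i (x + d) - loc i x - gradient p (loc i) x \<bullet> d) / real n"
      by (simp add: global_obj_def sum_subtractf diff_divide_distrib)
    then have "\<bar>f (x + d) - f x - ?g x \<bullet> d\<bar>
        = \<bar>\<Sum>i<n. loc i (x + d) - loc i x - gradient p (loc i) x \<bullet> d\<bar> / real n"
      by (simp add: abs_divide)
    also have "\<dots> \<le> (\<Sum>i<n. L\<^sub>f / 2 * (vnorm d)\<^sup>2) / real n"
    proof (rule divide_right_mono)
      have "\<bar>\<Sum>i<n. loc i (x + d) - loc i x - gradient p (loc i) x \<bullet> d\<bar>
          \<le> (\<Sum>i<n. \<bar>loc i (x + d) - loc i x - gradient p (loc i) x \<bullet> d\<bar>)" by (rule sum_abs)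
      also have "\<dots> \<le> (\<Sum>i<n. L\<^sub>f / 2 * (vnorm d)\<^sup>2)"
      proof (rule sum_mono)
        fix i assume "i \<in> {..<n}"
        then show "\<bar>loc i (x + d) - loc i x - gradient p (loc i) x \<bullet> d\<bar> \<le> L\<^sub>f / 2 * (vnorm d)\<^sup>2"
          using smooth_quadratic_bound[OF loc_smooth _ x d] L\<^sub>f_pos by simp
      qed
      finally show "\<bar>\<Sum>i<n. loc i (x + d) - loc i x - gradient p (loc i) x \<bullet> d\<bar> \<le> (\<Sum>i<n. L\<^sub>f / 2 * (vnorm d)\<^sup>2)" .
    qed simp
    also have "\<dots> = L\<^sub>f / 2 * (vnorm d)\<^sup>2" using n_ge_1 by simp
    finally show ?thesis .
  qed
  have l: "vnorm (?g x - ?g y) \<le> L\<^sub>f * vnorm (x - y)"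
    if x: "x \<in> carrier_vec p" and y: "y \<in> carrier_vec p" for x y
  proof -
    have "?g x - ?g y = avg n p (\<lambda>i. gradient p (loc i) x - gradient p (loc i) y)"
    proof (intro eq_vecI)
      fix c assume "c < dim_vec (avg n p (\<lambda>i. gradient p (loc i) x - gradient p (loc i) y))"
      then have c: "c < p" by (simp add: avg_def)
      have "(\<Sum>i<n. (gradient p (loc i) x - gradient p (loc i) y) $ c)
          = (\<Sum>i<n. gradient p (loc i) x $ c - gradient p (loc i) y $ c)"
      proof (intro sum.cong refl)
        fix i assume "i \<in> {..<n}"
        then have "dim_vec (gradient p (loc i) y) = p" using loc_gradient_carrier[OF _ y] by simp
        then show "(gradient p (loc i) x - gradient p (loc i) y) $ c
          = gradient p (loc i) x $ c - gradient p (loc i) y $ c" using c by simp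
      qed
      then show "(?g x - ?g y) $ c = avg n p (\<lambda>i. gradient p (loc i) x - gradient p (loc i) y) $ c"
        using c by (simp add: avg_def sum_subtractf diff_divide_distrib)
    qed (simp add: avg_def)
    then have "(vnorm (?g x - ?g y))\<^sup>2 \<le> (\<Sum>i<n. (vnorm (gradient p (loc i) x - gradient p (loc i) y))\<^sup>2) / real n"
      using vnorm_avg_le[OF n_ge_1, of "\<lambda>i. gradient p (loc i) x - gradient p (loc i) y" p]
        loc_gradient_carrier x y by auto
    also have "\<dots> \<le> (\<Sum>i<n. (L\<^sub>f * vnorm (x - y))\<^sup>2) / real n"
      by (intro divide_right_mono sum_mono power_mono smooth_lipschitz[OF loc_smooth x y]) auto
    also have "\<dots> = (L\<^sub>f * vnorm (x - y))\<^sup>2" using n_ge_1 by simp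
    finally show ?thesis using L\<^sub>f_pos by (simp add: power2_le_iff_abs_le)
  qed
  show "smooth_with p L\<^sub>f f" "x \<in> carrier_vec p \<Longrightarrow> gradient p f x = ?g x"
    using smooth_withI[of p ?g f "L\<^sub>f / 2" L\<^sub>f, OF _ q l] by auto
qed

lemma f_measurable: "f \<in> borel_measurable (borel_vec p)"
  unfolding global_obj_def[abs_def]
  by (intro borel_measurable_divide borel_measurable_sum loc_measurable) auto

lemma f_gradient_carrier: "x \<in> carrier_vec p \<Longrightarrow> gradient p f x \<in> carrier_vec p"
  by (simp add: f_gradient)

lemma est_carrier:
  assumes "i < n" "x \<in> carrier_vec p" "\<omega> \<in> space M" shows "est i k \<delta> x \<omega> \<in> carrier_vec p"
  using measurable_space[OF u_measurable[OF assms(1)] assms(3), of k] by (simp add: zo_gradient_def)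

lemma est_mean_carrier: "i < n \<Longrightarrow> est_mean i \<delta> x \<in> carrier_vec p"
  using agent.zo_mean_carrier[OF agent] .

lemma est_mean_growth:
  assumes i: "i < n" and x: "x \<in> carrier_vec p" and \<delta>: "0 < \<delta>"
  shows "(vnorm (est_mean i \<delta> x))\<^sup>2 \<le> 2 * (\<delta> * L\<^sub>f)\<^sup>2 + 2 * (vnorm (gradient p (loc i) x))\<^sup>2"
proof -
  note c = est_mean_carrier[OF i, of \<delta> x] loc_gradient_carrier[OF i x]
  have "est_mean i \<delta> x = (est_mean i \<delta> x - gradient p (loc i) x) + gradient p (loc i) x"
    using c by (intro eq_vecI) auto
  then have "(vnorm (est_mean i \<delta> x))\<^sup>2 \<le> 2 * (vnorm (est_mean i \<delta> x - gradient p (loc i) x))\<^sup>2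
      + 2 * (vnorm (gradient p (loc i) x))\<^sup>2"
    using vnorm_power2_add_le[of "est_mean i \<delta> x - gradient p (loc i) x" p "gradient p (loc i) x"] c by simp
  also have "(vnorm (est_mean i \<delta> x - gradient p (loc i) x))\<^sup>2 \<le> (\<delta> * L\<^sub>f)\<^sup>2"
    by (intro power_mono agent.zo_bias[OF agent[OF i] x \<delta>]) auto
  finally show ?thesis by simp
qed

end

text \<open>The step sizes are constrained here only by \<open>0 \<le> \<eta> k\<close> and
  \<open>L\<^sub>f * \<eta> k \<le> 1\<close>; the latter lets the descent absorb the mean part of
  the squared step. Their decay in \<open>k\<close> enters with the scalar recursions.\<close>

locale algorithm = estimators M n p D u \<xi> F L\<^sub>f \<sigma>\<^sub>0 \<sigma>\<^sub>1 + net: network n E A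
  for M :: "'w measure" and n p and D :: "nat \<Rightarrow> 'b measure" and u \<xi> F L\<^sub>f \<sigma>\<^sub>0 \<sigma>\<^sub>1 E A +
  fixes \<gamma> \<nu> :: real and \<eta> :: "nat \<Rightarrow> real" and \<delta> :: "nat \<Rightarrow> nat \<Rightarrow> real" and x0 :: "nat \<Rightarrow> real vec"
  assumes \<gamma>_pos: "0 < \<gamma>" and \<gamma>_less: "\<gamma> < d1 (laplacian n A)"
    and \<eta>_nonneg: "\<And>k. 0 \<le> \<eta> k" and \<eta>_le: "\<And>k. L\<^sub>f * \<eta> k \<le> 1"
    and \<delta>_pos: "\<And>i k. i < n \<Longrightarrow> 0 < \<delta> i k"
    and x0_carrier: "\<And>i. i < n \<Longrightarrow> x0 i \<in> carrier_vec p"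
    and minimizer_exists: "minimizers p (global_obj n D F) \<noteq> {}"
    and \<nu>_pos: "0 < \<nu>" and PL: "polyak_lojasiewicz p \<nu> (global_obj n D F)"
    and loc_bdd: "\<And>i. i < n \<Longrightarrow> bdd_below (local_obj D F i ` carrier_vec p)"
begin

abbreviation "L \<equiv> laplacian n A"

definition X :: "nat \<Rightarrow> 'w \<Rightarrow> nat \<Rightarrow> real vec" where
  "X k \<omega> = zo_primal n p L F \<gamma> \<eta> \<delta> x0 (\<lambda>i k. u i k \<omega>) (\<lambda>i k. \<xi> i k \<omega>) k"

abbreviation "g k \<omega> i \<equiv> est i k (\<delta> i k) (X k \<omega> i) \<omega>"
abbreviation "m k \<omega> i \<equiv> est_mean i (\<delta> i k) (X k \<omega> i)"
abbreviation "xbar k \<omega> \<equiv> avg n p (X k \<omega>)"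
abbreviation "f_min \<equiv> min_value p f"
abbreviation "mean_min \<equiv> (\<Sum>i<n. min_value p (loc i)) / real n"

lemma X_0: "X 0 \<omega> = x0"
  by (simp add: X_def)

lemma X_Suc: "X (Suc k) \<omega> i = Matrix.vec p (\<lambda>c. X k \<omega> i $ c - \<gamma> * (\<Sum>j<n. L $$ (i, j) * X k \<omega> j $ c)
    - \<eta> k * g k \<omega> i $ c)"
  by (simp add: X_def Let_def)

lemma X_carrier: "i < n \<Longrightarrow> X k \<omega> i \<in> carrier_vec p"
  by (cases k) (simp_all add: X_0 X_Suc x0_carrier)

text \<open>Rounds strictly before \<open>k\<close>: they determine the iterate \<open>X k\<close>,
  while the draws of round \<open>k\<close> are still fresh.\<close>

definition past :: "nat \<Rightarrow> ((nat \<times> nat) + (nat \<times> nat)) set" where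
  "past k = ({..<n} \<times> {..<k}) <+> ({..<n} \<times> {..<k})"

lemma past_subset: "past k \<subseteq> indices"
  by (auto simp: past_def)

lemma past_iff: "Inl (i, l) \<in> past k \<longleftrightarrow> i < n \<and> l < k" "Inr (i, l) \<in> past k \<longleftrightarrow> i < n \<and> l < k"
  by (auto simp: past_def)

lemma X_measurable_past: "i < n \<Longrightarrow> (\<lambda>\<omega>. X k \<omega> i) \<in> measurable (generated (past k)) (borel_vec p)"
proof (induction k arbitrary: i)
  case 0
  then show ?case by (simp add: X_0 x0_carrier)
next
  case (Suc k)
  have sub: "past k \<subseteq> past (Suc k)" by (auto simp: past_def)
  have X: "(\<lambda>\<omega>. X k \<omega> j) \<in> measurable (generated (past (Suc k))) (borel_vec p)" if "j < n" for j
    by (rule measurable_generated_mono[OF sub Suc.IH[OF that]])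
  have g: "(\<lambda>\<omega>. g k \<omega> i) \<in> measurable (generated (past (Suc k))) (borel_vec p)"
    using Suc.prems by (intro measurable_zo_generated X) (auto simp: past_iff)
  show ?case
  proof (rule measurable_borel_vecI)
    fix c assume c: "c < p"
    have Xc: "(\<lambda>\<omega>. X k \<omega> j $ c) \<in> borel_measurable (generated (past (Suc k)))" if "j < n" for j
      by (rule measurable_vec_index[OF X[OF that] c])
    have s: "(\<lambda>\<omega>. \<Sum>j<n. L $$ (i, j) * X k \<omega> j $ c) \<in> borel_measurable (generated (past (Suc k)))"
    proof (rule borel_measurable_sum)
      fix j assume "j \<in> {..<n}"
      then show "(\<lambda>\<omega>. L $$ (i, j) * X k \<omega> j $ c) \<in> borel_measurable (generated (past (Suc k)))"
        using Xc[of j] by simp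
    qed
    have "(\<lambda>\<omega>. X k \<omega> i $ c - \<gamma> * (\<Sum>j<n. L $$ (i, j) * X k \<omega> j $ c) - \<eta> k * g k \<omega> i $ c)
        \<in> borel_measurable (generated (past (Suc k)))"
      by (rule borel_measurable_diff[OF borel_measurable_diff[OF Xc[OF Suc.prems]
          borel_measurable_times[OF borel_measurable_const s]]
          borel_measurable_times[OF borel_measurable_const measurable_vec_index[OF g c]]])
    moreover have "X (Suc k) \<omega> i $ c
        = X k \<omega> i $ c - \<gamma> * (\<Sum>j<n. L $$ (i, j) * X k \<omega> j $ c) - \<eta> k * g k \<omega> i $ c" for \<omega>
      using c by (simp add: X_Suc)
    ultimately show "(\<lambda>\<omega>. X (Suc k) \<omega> i $ c) \<in> borel_measurable (generated (past (Suc k)))"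
      by (simp only:)
  qed (simp add: X_Suc)
qed

lemma g_carrier: "i < n \<Longrightarrow> \<omega> \<in> space M \<Longrightarrow> g k \<omega> i \<in> carrier_vec p"
  by (intro est_carrier X_carrier)

lemma loc_gradient_measurable: "i < n \<Longrightarrow> gradient p (loc i) \<in> measurable (borel_vec p) (borel_vec p)"
  by (rule measurable_gradient[OF loc_smooth less_imp_le[OF L\<^sub>f_pos] loc_measurable])

lemma loc_gradient_sq_integrable:
  assumes i: "i < n" and Y: "sq_integrable_vec p M Y"
  shows "sq_integrable_vec p M (\<lambda>\<omega>. gradient p (loc i) (Y \<omega>))"
proof (rule M.sq_integrable_vec_comp[OF Y loc_gradient_measurable[OF i]])
  fix x :: "real vec" assume x: "x \<in> carrier_vec p"
  have "x - 0\<^sub>v p = x" using x by simp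
  then show "(vnorm (gradient p (loc i) x))\<^sup>2
      \<le> 2 * (vnorm (gradient p (loc i) (0\<^sub>v p)))\<^sup>2 + 2 * L\<^sub>f\<^sup>2 * (vnorm x)\<^sup>2"
    using smooth_gradient_growth[OF loc_smooth[OF i] x zero_carrier_vec] by simp
qed

text \<open>Linear growth of the gradient makes the bound on the nonnegative integral finite; only
  then can both sides be read as expectations.\<close>

lemma g_second_moment:
  assumes i: "i < n" and X: "sq_integrable_vec p M (\<lambda>\<omega>. X k \<omega> i)"
  shows "sq_integrable_vec p M (\<lambda>\<omega>. g k \<omega> i)"
    and "(\<integral>\<omega>. (vnorm (g k \<omega> i))\<^sup>2 \<partial>M) \<le> 4 * p * (1 + \<sigma>\<^sub>0\<^sup>2) * (\<integral>\<omega>. (vnorm (gradient p (loc i) (X k \<omega> i)))\<^sup>2 \<partial>M)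
      + 4 * p * \<sigma>\<^sub>1\<^sup>2 + p\<^sup>2 * L\<^sub>f\<^sup>2 * (\<delta> i k)\<^sup>2 / 2"
proof -
  let ?G = "\<lambda>\<omega>. (vnorm (gradient p (loc i) (X k \<omega> i)))\<^sup>2"
  define b where "b \<omega> = 4 * p * (1 + \<sigma>\<^sub>0\<^sup>2) * ?G \<omega> + (4 * p * \<sigma>\<^sub>1\<^sup>2 + p\<^sup>2 * L\<^sub>f\<^sup>2 * (\<delta> i k)\<^sup>2 / 2)" for \<omega>
  have G: "integrable M ?G"
    using loc_gradient_sq_integrable[OF i X] by (simp add: sq_integrable_vec_def)
  then have b: "integrable M b" unfolding b_def by (intro Bochner_Integration.integrable_add integrable_mult_right) auto
  have b0: "0 \<le> b \<omega>" for \<omega> by (simp add: b_def)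
  have np: "Inl (i, k) \<notin> past k" "Inr (i, k) \<notin> past k" by (auto simp: past_iff)
  have "(\<lambda>\<omega>. g k \<omega> i) \<in> measurable (generated (past (Suc k))) (borel_vec p)"
  proof (intro measurable_zo_generated[OF i])
    show "(\<lambda>\<omega>. X k \<omega> i) \<in> measurable (generated (past (Suc k))) (borel_vec p)"
      by (rule measurable_generated_mono[OF _ X_measurable_past[OF i, of k]]) (auto simp: past_def)
  qed (auto simp: past_iff i)
  then have gm: "(\<lambda>\<omega>. g k \<omega> i) \<in> measurable M (borel_vec p)"
    by (rule measurable_generated_imp[OF past_subset])
  have le: "(\<integral>\<^sup>+\<omega>. ennreal ((vnorm (g k \<omega> i))\<^sup>2) \<partial>M) \<le> (\<integral>\<^sup>+\<omega>. ennreal (b \<omega>) \<partial>M)"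
    using second_moment_zo[OF i past_subset np X_measurable_past[OF i] \<delta>_pos[OF i]]
    by (simp add: b_def add.assoc)
  also have eq: "\<dots> = ennreal (\<integral>\<omega>. b \<omega> \<partial>M)"
    using b b0 by (intro nn_integral_eq_integral) auto
  finally have le': "(\<integral>\<^sup>+\<omega>. ennreal ((vnorm (g k \<omega> i))\<^sup>2) \<partial>M) \<le> ennreal (\<integral>\<omega>. b \<omega> \<partial>M)" .
  have vm: "(\<lambda>\<omega>. (vnorm (g k \<omega> i))\<^sup>2) \<in> borel_measurable M"
    using measurable_vnorm[OF gm] by measurable
  have int: "integrable M (\<lambda>\<omega>. (vnorm (g k \<omega> i))\<^sup>2)"
  proof (rule integrableI_bounded[OF vm])
    show "(\<integral>\<^sup>+\<omega>. ennreal (norm ((vnorm (g k \<omega> i))\<^sup>2)) \<partial>M) < \<infinity>"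
      using le_less_trans[OF le' ennreal_less_top] by simp
  qed
  show "sq_integrable_vec p M (\<lambda>\<omega>. g k \<omega> i)" using gm int by (simp add: sq_integrable_vec_def)
  have "ennreal (\<integral>\<omega>. (vnorm (g k \<omega> i))\<^sup>2 \<partial>M) \<le> ennreal (\<integral>\<omega>. b \<omega> \<partial>M)"
    using le' int by (subst (asm) nn_integral_eq_integral) auto
  then have "(\<integral>\<omega>. (vnorm (g k \<omega> i))\<^sup>2 \<partial>M) \<le> (\<integral>\<omega>. b \<omega> \<partial>M)"
    using b0 by (subst (asm) ennreal_le_iff) (auto intro: integral_nonneg_AE)
  also have "\<dots> = 4 * p * (1 + \<sigma>\<^sub>0\<^sup>2) * (\<integral>\<omega>. ?G \<omega> \<partial>M) + (4 * p * \<sigma>\<^sub>1\<^sup>2 + p\<^sup>2 * L\<^sub>f\<^sup>2 * (\<delta> i k)\<^sup>2 / 2)"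
    unfolding b_def using G M.prob_space by simp
  finally show "(\<integral>\<omega>. (vnorm (g k \<omega> i))\<^sup>2 \<partial>M) \<le> 4 * p * (1 + \<sigma>\<^sub>0\<^sup>2) * (\<integral>\<omega>. ?G \<omega> \<partial>M)
      + 4 * p * \<sigma>\<^sub>1\<^sup>2 + p\<^sup>2 * L\<^sub>f\<^sup>2 * (\<delta> i k)\<^sup>2 / 2" by simp
qed

text \<open>One step preserves finite second moments because the estimator inherits them from the
  iterate. All later expectations rest on this.\<close>

lemma X_sq_integrable: "i < n \<Longrightarrow> sq_integrable_vec p M (\<lambda>\<omega>. X k \<omega> i)"
proof (induction k arbitrary: i)
  case 0
  then show ?case by (simp add: X_0 sq_integrable_vec_def x0_carrier)
next
  case (Suc k)
  show ?case
  proof (rule sq_integrable_vecI)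
    fix c assume c: "c < p"
    have X: "sq_integrable M (\<lambda>\<omega>. X k \<omega> j $ c)" if "j < n" for j
      by (rule sq_integrable_vec_index[OF Suc.IH[OF that] c])
    have g: "sq_integrable M (\<lambda>\<omega>. g k \<omega> i $ c)"
      by (rule sq_integrable_vec_index[OF g_second_moment(1)[OF Suc.prems Suc.IH[OF Suc.prems]] c])
    have "sq_integrable M (\<lambda>\<omega>. X k \<omega> i $ c - \<gamma> * (\<Sum>j<n. L $$ (i, j) * X k \<omega> j $ c) - \<eta> k * g k \<omega> i $ c)"
      by (intro sq_integrable_diff sq_integrable_cmult sq_integrable_sum X g Suc.prems) auto
    then show "sq_integrable M (\<lambda>\<omega>. X (Suc k) \<omega> i $ c)" using c by (simp add: X_Suc)
  qed (simp add: X_Suc)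
qed

lemmas g_sq_integrable = g_second_moment(1)[OF _ X_sq_integrable]

lemma m_carrier: "i < n \<Longrightarrow> m k \<omega> i \<in> carrier_vec p"
  by (rule est_mean_carrier)

lemma m_sq_integrable:
  assumes i: "i < n" shows "sq_integrable_vec p M (\<lambda>\<omega>. m k \<omega> i)"
proof (rule M.sq_integrable_vec_comp[OF X_sq_integrable[OF i]])
  show "est_mean i (\<delta> i k) \<in> measurable (borel_vec p) (borel_vec p)"
    by (rule agent.measurable_zo_mean[OF agent[OF i]])
  fix x :: "real vec" assume x: "x \<in> carrier_vec p"
  have "x - 0\<^sub>v p = x" using x by simp
  then have "(vnorm (gradient p (loc i) x))\<^sup>2
      \<le> 2 * L\<^sub>f\<^sup>2 * (vnorm x)\<^sup>2 + 2 * (vnorm (gradient p (loc i) (0\<^sub>v p)))\<^sup>2"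
    using smooth_gradient_growth[OF loc_smooth[OF i] x zero_carrier_vec] by simp
  then show "(vnorm (est_mean i (\<delta> i k) x))\<^sup>2
      \<le> (2 * (\<delta> i k * L\<^sub>f)\<^sup>2 + 4 * (vnorm (gradient p (loc i) (0\<^sub>v p)))\<^sup>2) + 4 * L\<^sub>f\<^sup>2 * (vnorm x)\<^sup>2"
    using est_mean_growth[OF i x \<delta>_pos[OF i], of k] by linarith
qed

lemma avg_sq_integrable:
  assumes "\<And>i. i < n \<Longrightarrow> sq_integrable_vec p M (\<lambda>\<omega>. Y \<omega> i)"
  shows "sq_integrable_vec p M (\<lambda>\<omega>. avg n p (Y \<omega>))"
proof (rule sq_integrable_vecI)
  fix c assume c: "c < p"
  have "sq_integrable M (\<lambda>\<omega>. (\<Sum>i<n. Y \<omega> i $ c) / real n)"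
    by (intro sq_integrable_divide sq_integrable_sum sq_integrable_vec_index[OF assms c]) auto
  then show "sq_integrable M (\<lambda>\<omega>. avg n p (Y \<omega>) $ c)" using c by (simp add: avg_index)
qed simp

lemma xbar_measurable_past: "(\<lambda>\<omega>. xbar k \<omega>) \<in> measurable (generated (past k)) (borel_vec p)"
proof (rule measurable_borel_vecI)
  fix c assume c: "c < p"
  have "(\<lambda>\<omega>. (\<Sum>i<n. X k \<omega> i $ c) / real n) \<in> borel_measurable (generated (past k))"
    using c by (intro borel_measurable_divide borel_measurable_sum measurable_vec_index[OF X_measurable_past]) auto
  then show "(\<lambda>\<omega>. xbar k \<omega> $ c) \<in> borel_measurable (generated (past k))" using c by (simp add: avg_index)
qed simp

text \<open>The columns of the Laplacian sum to zero, so the mixing term drops out of the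
  average.\<close>

lemma xbar_Suc:
  assumes \<omega>: "\<omega> \<in> space M"
  shows "xbar (Suc k) \<omega> = xbar k \<omega> + (- \<eta> k) \<cdot>\<^sub>v avg n p (g k \<omega>)"
proof (rule eq_vecI)
  fix c assume "c < dim_vec (xbar k \<omega> + (- \<eta> k) \<cdot>\<^sub>v avg n p (g k \<omega>))"
  then have c: "c < p" by (simp add: avg_def)
  have "(\<Sum>i<n. \<Sum>j<n. L $$ (i, j) * X k \<omega> j $ c) = (\<Sum>j<n. (\<Sum>i<n. L $$ (i, j)) * X k \<omega> j $ c)"
    by (subst sum.swap) (simp add: sum_distrib_right)
  also have "\<dots> = 0" by (simp add: net.L_column_sum)
  finally have 0: "(\<Sum>i<n. \<Sum>j<n. L $$ (i, j) * X k \<omega> j $ c) = 0" .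
  have "(\<Sum>i<n. X (Suc k) \<omega> i $ c) = (\<Sum>i<n. X k \<omega> i $ c) - \<gamma> * (\<Sum>i<n. \<Sum>j<n. L $$ (i, j) * X k \<omega> j $ c)
      - \<eta> k * (\<Sum>i<n. g k \<omega> i $ c)"
    using c by (simp add: X_Suc sum_subtractf sum_distrib_left)
  then show "xbar (Suc k) \<omega> $ c = (xbar k \<omega> + (- \<eta> k) \<cdot>\<^sub>v avg n p (g k \<omega>)) $ c"
    using c 0 by (simp add: avg_def diff_divide_distrib)
qed (simp add: avg_def)

lemma eps2_nonneg: "0 \<le> eps2 L \<gamma>"
  using net.spec_pos[OF \<gamma>_pos \<gamma>_less] \<gamma>_pos by (simp add: eps2_def)

lemma disagreement_step:
  assumes \<omega>: "\<omega> \<in> space M"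
  shows "disagreement n p (X (Suc k) \<omega>) \<le> (1 - 2 * eps1 L \<gamma>) * disagreement n p (X k \<omega>)
    + 2 * eps2 L \<gamma> * (\<eta> k)\<^sup>2 * ((\<Sum>i<n. (vnorm (g k \<omega> i))\<^sup>2) / real n)"
proof -
  let ?y = "\<lambda>k c i. X k \<omega> i $ c - (\<Sum>j<n. X k \<omega> j $ c) / real n"
  let ?v = "\<lambda>c i. \<eta> k * (g k \<omega> i $ c - (\<Sum>j<n. g k \<omega> j $ c) / real n)"
  have step: "(\<Sum>i<n. (?y (Suc k) c i)\<^sup>2) \<le> (1 - 2 * eps1 L \<gamma>) * (\<Sum>i<n. (?y k c i)\<^sup>2)
      + 2 * eps2 L \<gamma> * ((\<eta> k)\<^sup>2 * (\<Sum>i<n. (g k \<omega> i $ c)\<^sup>2))" if c: "c < p" for c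
  proof -
    \<comment> \<open>The deviations obey the recursion of the iterates, since the Laplacian
      annihilates constants. The noise appears centred, and \<open>square_mean_le\<close> then
      discards the centring.\<close>
    have eq: "?y (Suc k) c i = ?y k c i - \<gamma> * (\<Sum>j<n. L $$ (i, j) * ?y k c j) - ?v c i" if i: "i < n" for i
    proof -
      have "(\<Sum>j<n. L $$ (i, j) * ?y k c j) = (\<Sum>j<n. L $$ (i, j) * X k \<omega> j $ c)
          - (\<Sum>j<n. L $$ (i, j)) * ((\<Sum>j<n. X k \<omega> j $ c) / real n)"
        unfolding sum_distrib_right right_diff_distrib sum_subtractf ..
      also have "(\<Sum>j<n. L $$ (i, j)) = 0" by (rule net.L_row_sum[OF i])
      finally have 1: "(\<Sum>j<n. L $$ (i, j) * ?y k c j) = (\<Sum>j<n. L $$ (i, j) * X k \<omega> j $ c)" by simp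
      have 2: "(\<Sum>j<n. X (Suc k) \<omega> j $ c) / real n = (\<Sum>j<n. X k \<omega> j $ c) / real n - \<eta> k * ((\<Sum>j<n. g k \<omega> j $ c) / real n)"
        using arg_cong[OF xbar_Suc[OF \<omega>, of k], of "\<lambda>v. v $ c"] c by (simp add: avg_def)
      show ?thesis unfolding 1 2 using c by (simp add: X_Suc algebra_simps)
    qed
    have zero: "(\<Sum>i<n. ?y k c i) = 0" using n_ge_1 by (simp add: sum_subtractf)
    have "(\<Sum>i<n. (?y (Suc k) c i)\<^sup>2) = (\<Sum>i<n. (?y k c i - \<gamma> * (\<Sum>j<n. L $$ (i, j) * ?y k c j) - ?v c i)\<^sup>2)"
      by (rule sum.cong[OF refl]) (simp add: eq)
    also have "\<dots> \<le> (1 - 2 * eps1 L \<gamma>) * (\<Sum>i<n. (?y k c i)\<^sup>2) + 2 * eps2 L \<gamma> * (\<Sum>i<n. (?v c i)\<^sup>2)"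
      by (rule net.consensus_step[OF \<gamma>_pos \<gamma>_less zero])
    also have "(\<Sum>i<n. (?v c i)\<^sup>2) = (\<eta> k)\<^sup>2 * (\<Sum>i<n. (g k \<omega> i $ c - (\<Sum>j<n. g k \<omega> j $ c) / real n)\<^sup>2)"
      by (simp add: power_mult_distrib sum_distrib_left)
    also have "2 * eps2 L \<gamma> * \<dots> \<le> 2 * eps2 L \<gamma> * ((\<eta> k)\<^sup>2 * (\<Sum>i<n. (g k \<omega> i $ c)\<^sup>2))"
      using eps2_nonneg by (intro mult_left_mono square_mean_le(2) n_ge_1) auto
    finally show ?thesis by simp
  qed
  have "disagreement n p (X (Suc k) \<omega>) = (\<Sum>c<p. \<Sum>i<n. (?y (Suc k) c i)\<^sup>2) / real n"
    by (rule disagreement_eq[OF X_carrier])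
  also have "\<dots> \<le> (\<Sum>c<p. (1 - 2 * eps1 L \<gamma>) * (\<Sum>i<n. (?y k c i)\<^sup>2)
      + 2 * eps2 L \<gamma> * ((\<eta> k)\<^sup>2 * (\<Sum>i<n. (g k \<omega> i $ c)\<^sup>2))) / real n"
    by (intro divide_right_mono sum_mono step) auto
  also have "\<dots> = (1 - 2 * eps1 L \<gamma>) * ((\<Sum>c<p. \<Sum>i<n. (?y k c i)\<^sup>2) / real n)
      + 2 * eps2 L \<gamma> * (\<eta> k)\<^sup>2 * ((\<Sum>c<p. \<Sum>i<n. (g k \<omega> i $ c)\<^sup>2) / real n)"
    by (simp add: sum.distrib sum_distrib_left[symmetric] add_divide_distrib mult.assoc)
  also have "(\<Sum>c<p. \<Sum>i<n. (?y k c i)\<^sup>2) / real n = disagreement n p (X k \<omega>)"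
    by (rule disagreement_eq[OF X_carrier, symmetric])
  also have "(\<Sum>c<p. \<Sum>i<n. (g k \<omega> i $ c)\<^sup>2) = (\<Sum>i<n. (vnorm (g k \<omega> i))\<^sup>2)"
    using g_carrier[OF _ \<omega>] by (subst sum.swap) (simp add: vnorm_power2_eq_sum[of _ p])
  finally show ?thesis .
qed

lemma disagreement_integrable: "integrable M (\<lambda>\<omega>. disagreement n p (X k \<omega>))"
proof -
  have X: "sq_integrable M (\<lambda>\<omega>. X k \<omega> i $ c)" if "i < n" "c < p" for i c
    by (rule sq_integrable_vec_index[OF X_sq_integrable[OF that(1)] that(2)])
  have "sq_integrable M (\<lambda>\<omega>. X k \<omega> i $ c - (\<Sum>j<n. X k \<omega> j $ c) / real n)" if "i < n" "c < p" for i c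
    using that by (intro sq_integrable_diff sq_integrable_divide sq_integrable_sum X) auto
  note sq = this
  have eq: "disagreement n p (X k \<omega>) = (\<Sum>c<p. \<Sum>i<n. (X k \<omega> i $ c - (\<Sum>j<n. X k \<omega> j $ c) / real n)\<^sup>2) / real n" for \<omega>
    by (rule disagreement_eq[OF X_carrier])
  show ?thesis
    unfolding eq using sq
    by (intro integrable_divide Bochner_Integration.integrable_sum) (auto simp only: sq_integrable_def lessThan_iff)
qed

text \<open>A minimizer bounds the values below, which is what makes the infimum in
  \<open>min_value\<close> meaningful.\<close>

lemma min_value_le: "x \<in> carrier_vec p \<Longrightarrow> f_min \<le> f x"
proof -
  assume x: "x \<in> carrier_vec p"
  obtain y where y: "y \<in> carrier_vec p" "\<And>z. z \<in> carrier_vec p \<Longrightarrow> f y \<le> f z"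
    using minimizer_exists by (auto simp: minimizers_def)
  have "bdd_below (f ` carrier_vec p)" by (rule bdd_belowI2[OF y(2)])
  then show ?thesis unfolding min_value_def by (rule cINF_lower[OF _ x])
qed

lemma loc_min_le: "i < n \<Longrightarrow> x \<in> carrier_vec p \<Longrightarrow> min_value p (loc i) \<le> loc i x"
  unfolding min_value_def by (rule cINF_lower[OF loc_bdd])

text \<open>The difference \<open>f_min - mean_min\<close> measures the heterogeneity of the agents;
  its sign is needed for the noise constants to be nonnegative.\<close>

lemma mean_min_le: "mean_min \<le> f_min"
  unfolding min_value_def[of p f]
proof (rule cINF_greatest)
  show "carrier_vec p \<noteq> ({} :: real vec set)" using zero_carrier_vec by blast
  fix x :: "real vec" assume x: "x \<in> carrier_vec p"
  show "mean_min \<le> f x" unfolding global_obj_def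
    by (intro divide_right_mono sum_mono loc_min_le x) auto
qed

text \<open>Smoothness gives quadratic growth around the origin, so the gap is dominated by the
  squared norm of the average iterate.\<close>

lemma f_gap_integrable: "integrable M (\<lambda>\<omega>. f (xbar k \<omega>) - f_min)"
proof (rule Bochner_Integration.integrable_bound)
  define g0 where "g0 = gradient p f (0\<^sub>v p)"
  have g0: "g0 \<in> carrier_vec p" unfolding g0_def by (rule f_gradient_carrier) simp
  have xb: "sq_integrable_vec p M (xbar k)" by (rule avg_sq_integrable[OF X_sq_integrable])
  let ?b = "\<lambda>\<omega>. (f (0\<^sub>v p) - f_min + (vnorm g0)\<^sup>2) + (1 + L\<^sub>f / 2) * (vnorm (xbar k \<omega>))\<^sup>2"
  show "integrable M ?b" using xb by (simp add: sq_integrable_vec_def)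
  show "(\<lambda>\<omega>. f (xbar k \<omega>) - f_min) \<in> borel_measurable M"
    by (rule borel_measurable_diff[OF measurable_compose[OF _ f_measurable] borel_measurable_const])
      (use xb in \<open>simp add: sq_integrable_vec_def\<close>)
  have "norm (f (xbar k \<omega>) - f_min) \<le> norm (?b \<omega>)" for \<omega>
  proof -
    define x where "x = xbar k \<omega>"
    have x: "x \<in> carrier_vec p" "0\<^sub>v p + x = x" by (auto simp: x_def)
    have "f x \<le> f (0\<^sub>v p) + g0 \<bullet> x + L\<^sub>f / 2 * (vnorm x)\<^sup>2"
      using abs_le_D1[OF smooth_quadratic_bound[OF f_smooth less_imp_le[OF L\<^sub>f_pos] zero_carrier_vec x(1)]]
      unfolding x(2) g0_def by linarith
    also have "g0 \<bullet> x \<le> vnorm g0 * vnorm x" using abs_scalar_prod_le[OF g0 x(1)] by simp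
    also have "vnorm g0 * vnorm x \<le> (vnorm g0)\<^sup>2 + (vnorm x)\<^sup>2"
    proof -
      have "0 \<le> vnorm g0 * vnorm x" by simp
      then show ?thesis using sum_squares_bound[of "vnorm g0" "vnorm x"] by linarith
    qed
    finally have "f x - f_min \<le> ?b \<omega>" by (simp add: x_def algebra_simps)
    moreover have "0 \<le> f x - f_min" using min_value_le[OF x(1)] by simp
    ultimately show ?thesis by (simp add: x_def)
  qed
  then show "AE \<omega> in M. norm (f (xbar k \<omega>) - f_min) \<le> norm (?b \<omega>)" by simp
qed

abbreviation "DD k \<equiv> \<integral>\<omega>. disagreement n p (X k \<omega>) \<partial>M"
abbreviation "WW k \<equiv> \<integral>\<omega>. f (xbar k \<omega>) - f_min \<partial>M"
abbreviation "GG k \<equiv> \<integral>\<omega>. (\<Sum>i<n. (vnorm (g k \<omega> i))\<^sup>2) / real n \<partial>M"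

lemma GG_integrable: "integrable M (\<lambda>\<omega>. (\<Sum>i<n. (vnorm (g k \<omega> i))\<^sup>2) / real n)"
  using g_sq_integrable by (intro integrable_divide Bochner_Integration.integrable_sum) (auto simp: sq_integrable_vec_def)

lemma DD_recursion: "DD (Suc k) \<le> (1 - 2 * eps1 L \<gamma>) * DD k + 2 * eps2 L \<gamma> * (\<eta> k)\<^sup>2 * GG k"
proof -
  note D = disagreement_integrable[of k] and G = GG_integrable[of k]
  have i: "integrable M (\<lambda>\<omega>. (1 - 2 * eps1 L \<gamma>) * disagreement n p (X k \<omega>)
    + 2 * eps2 L \<gamma> * (\<eta> k)\<^sup>2 * ((\<Sum>i<n. (vnorm (g k \<omega> i))\<^sup>2) / real n))"
    by (rule Bochner_Integration.integrable_add[OF integrable_mult_right[OF D] integrable_mult_right[OF G]])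
  have "DD (Suc k) \<le> (\<integral>\<omega>. (1 - 2 * eps1 L \<gamma>) * disagreement n p (X k \<omega>)
    + 2 * eps2 L \<gamma> * (\<eta> k)\<^sup>2 * ((\<Sum>i<n. (vnorm (g k \<omega> i))\<^sup>2) / real n) \<partial>M)"
    by (rule integral_mono[OF disagreement_integrable i disagreement_step])
  also have "\<dots> = (1 - 2 * eps1 L \<gamma>) * DD k + 2 * eps2 L \<gamma> * (\<eta> k)\<^sup>2 * GG k"
    unfolding Bochner_Integration.integral_add[OF integrable_mult_right[OF D] integrable_mult_right[OF G]]
      integral_mult_right_zero ..
  finally show ?thesis .
qed

lemma WW_nonneg: "0 \<le> WW k" and DD_nonneg: "0 \<le> DD k"
  using min_value_le by (auto intro!: integral_nonneg_AE simp: disagreement_nonneg)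

text \<open>At the common average point each local gradient is controlled by the gap to its own
  infimum, and these gaps average to the global gap above \<open>mean_min\<close>. Moving each agent
  to the average costs the disagreement.\<close>

lemma mean_local_gradient_bound:
  assumes x: "\<And>i. i < n \<Longrightarrow> x i \<in> carrier_vec p"
  shows "(\<Sum>i<n. (vnorm (gradient p (loc i) (x i)))\<^sup>2) / real n
    \<le> 2 * L\<^sub>f\<^sup>2 * disagreement n p x + 4 * L\<^sub>f * (f (avg n p x) - mean_min)"
proof -
  have "(\<Sum>i<n. (vnorm (gradient p (loc i) (x i)))\<^sup>2) / real n
      \<le> (\<Sum>i<n. 2 * L\<^sub>f\<^sup>2 * (vnorm (x i - avg n p x))\<^sup>2 + 4 * L\<^sub>f * (loc i (avg n p x) - min_value p (loc i))) / real n"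
  proof (intro divide_right_mono sum_mono)
    fix i assume "i \<in> {..<n}"
    then have i: "i < n" by simp
    have "(vnorm (gradient p (loc i) (avg n p x)))\<^sup>2 \<le> 2 * L\<^sub>f * (loc i (avg n p x) - min_value p (loc i))"
      by (rule smooth_self_bound[OF loc_smooth[OF i] L\<^sub>f_pos avg_carrier loc_min_le[OF i]])
    then show "(vnorm (gradient p (loc i) (x i)))\<^sup>2 \<le> 2 * L\<^sub>f\<^sup>2 * (vnorm (x i - avg n p x))\<^sup>2
        + 4 * L\<^sub>f * (loc i (avg n p x) - min_value p (loc i))"
      using smooth_gradient_growth[OF loc_smooth[OF i] x[OF i] avg_carrier[of n p x]] by linarith
  qed simp
  also have "\<dots> = 2 * L\<^sub>f\<^sup>2 * disagreement n p x + 4 * L\<^sub>f * (f (avg n p x) - mean_min)"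
    by (simp add: disagreement_def global_obj_def sum.distrib sum_distrib_left[symmetric] sum_subtractf
        add_divide_distrib diff_divide_distrib[symmetric])
  finally show ?thesis .
qed

lemma GG_bound:
  assumes dk: "\<And>i. i < n \<Longrightarrow> (\<delta> i k)\<^sup>2 \<le> dk"
  shows "GG k \<le> 4 * p * (1 + \<sigma>\<^sub>0\<^sup>2) * (2 * L\<^sub>f\<^sup>2 * DD k + 4 * L\<^sub>f * (WW k + (f_min - mean_min)))
    + 4 * p * \<sigma>\<^sub>1\<^sup>2 + p\<^sup>2 * L\<^sub>f\<^sup>2 * dk / 2"
proof -
  let ?G = "\<lambda>i \<omega>. (vnorm (gradient p (loc i) (X k \<omega> i)))\<^sup>2"
  have Gi: "integrable M (?G i)" if "i < n" for i
    using loc_gradient_sq_integrable[OF that X_sq_integrable[OF that]] by (simp add: sq_integrable_vec_def)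
  define K where "K = 4 * p * \<sigma>\<^sub>1\<^sup>2 + p\<^sup>2 * L\<^sub>f\<^sup>2 * dk / 2"
  have "GG k = (\<Sum>i<n. \<integral>\<omega>. (vnorm (g k \<omega> i))\<^sup>2 \<partial>M) / real n"
    using g_sq_integrable by (simp add: Bochner_Integration.integral_sum sq_integrable_vec_def)
  also have "\<dots> \<le> (\<Sum>i<n. 4 * p * (1 + \<sigma>\<^sub>0\<^sup>2) * (\<integral>\<omega>. ?G i \<omega> \<partial>M) + K) / real n"
  proof (intro divide_right_mono sum_mono)
    fix i assume "i \<in> {..<n}"
    then have i: "i < n" by simp
    have "p\<^sup>2 * L\<^sub>f\<^sup>2 * (\<delta> i k)\<^sup>2 \<le> p\<^sup>2 * L\<^sub>f\<^sup>2 * dk" by (intro mult_left_mono dk i) auto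
    then show "(\<integral>\<omega>. (vnorm (g k \<omega> i))\<^sup>2 \<partial>M) \<le> 4 * p * (1 + \<sigma>\<^sub>0\<^sup>2) * (\<integral>\<omega>. ?G i \<omega> \<partial>M) + K"
      using g_second_moment(2)[OF i X_sq_integrable[OF i], of k] unfolding K_def by linarith
  qed simp
  also have "\<dots> = 4 * p * (1 + \<sigma>\<^sub>0\<^sup>2) * (\<integral>\<omega>. (\<Sum>i<n. ?G i \<omega>) / real n \<partial>M) + K"
    using Gi n_ge_1 by (simp add: Bochner_Integration.integral_sum sum.distrib sum_distrib_left[symmetric] add_divide_distrib)
  also have "\<dots> \<le> 4 * p * (1 + \<sigma>\<^sub>0\<^sup>2) * (\<integral>\<omega>. 2 * L\<^sub>f\<^sup>2 * disagreement n p (X k \<omega>)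
      + 4 * L\<^sub>f * ((f (xbar k \<omega>) - f_min) + (f_min - mean_min)) \<partial>M) + K"
  proof (intro add_right_mono mult_left_mono integral_mono)
    show "integrable M (\<lambda>\<omega>. (\<Sum>i<n. ?G i \<omega>) / real n)"
      using Gi by (intro integrable_divide Bochner_Integration.integrable_sum) auto
    show "integrable M (\<lambda>\<omega>. 2 * L\<^sub>f\<^sup>2 * disagreement n p (X k \<omega>)
      + 4 * L\<^sub>f * ((f (xbar k \<omega>) - f_min) + (f_min - mean_min)))"
      using disagreement_integrable[of k] f_gap_integrable[of k]
      by (intro Bochner_Integration.integrable_add integrable_mult_right) auto
    show "(\<Sum>i<n. ?G i \<omega>) / real n \<le> 2 * L\<^sub>f\<^sup>2 * disagreement n p (X k \<omega>)
      + 4 * L\<^sub>f * ((f (xbar k \<omega>) - f_min) + (f_min - mean_min))" for \<omega>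
      using mean_local_gradient_bound[of "X k \<omega>", OF X_carrier] by simp
  qed simp
  also have "(\<integral>\<omega>. 2 * L\<^sub>f\<^sup>2 * disagreement n p (X k \<omega>)
      + 4 * L\<^sub>f * ((f (xbar k \<omega>) - f_min) + (f_min - mean_min)) \<partial>M)
      = 2 * L\<^sub>f\<^sup>2 * DD k + 4 * L\<^sub>f * (WW k + (f_min - mean_min))"
  proof -
    have "(\<integral>\<omega>. 2 * L\<^sub>f\<^sup>2 * disagreement n p (X k \<omega>)
        + 4 * L\<^sub>f * ((f (xbar k \<omega>) - f_min) + (f_min - mean_min)) \<partial>M)
      = (\<integral>\<omega>. 2 * L\<^sub>f\<^sup>2 * disagreement n p (X k \<omega>) \<partial>M)
        + (\<integral>\<omega>. 4 * L\<^sub>f * ((f (xbar k \<omega>) - f_min) + (f_min - mean_min)) \<partial>M)"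
      using disagreement_integrable[of k] f_gap_integrable[of k]
      by (intro Bochner_Integration.integral_add integrable_mult_right Bochner_Integration.integrable_add) auto
    also have "(\<integral>\<omega>. (f (xbar k \<omega>) - f_min) + (f_min - mean_min) \<partial>M) = WW k + (f_min - mean_min)"
      using f_gap_integrable[of k] M.prob_space by (subst Bochner_Integration.integral_add) auto
    then have "(\<integral>\<omega>. 4 * L\<^sub>f * ((f (xbar k \<omega>) - f_min) + (f_min - mean_min)) \<partial>M) = 4 * L\<^sub>f * (WW k + (f_min - mean_min))"
      by simp
    finally show ?thesis by simp
  qed
  finally show ?thesis by (simp add: K_def)
qed

end

context algorithm
begin

section \<open>Expected descent of the objective at the average iterate\<close>

abbreviation "gbar k \<omega> \<equiv> avg n p (g k \<omega>)"
abbreviation "mbar k \<omega> \<equiv> avg n p (m k \<omega>)"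
abbreviation "gradf k \<omega> \<equiv> gradient p f (xbar k \<omega>)"

lemma gradient_f_measurable: "gradient p f \<in> measurable (borel_vec p) (borel_vec p)"
  by (rule measurable_gradient[OF f_smooth less_imp_le[OF L\<^sub>f_pos] f_measurable])

lemma gradient_f_sq_integrable: "sq_integrable_vec p M (\<lambda>\<omega>. gradf k \<omega>)"
proof (rule M.sq_integrable_vec_comp[OF avg_sq_integrable[OF X_sq_integrable] gradient_f_measurable])
  fix x :: "real vec" assume x: "x \<in> carrier_vec p"
  have "x - 0\<^sub>v p = x" using x by simp
  then show "(vnorm (gradient p f x))\<^sup>2 \<le> 2 * (vnorm (gradient p f (0\<^sub>v p)))\<^sup>2 + 2 * L\<^sub>f\<^sup>2 * (vnorm x)\<^sup>2"
    using smooth_gradient_growth[OF f_smooth x zero_carrier_vec] by simp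
qed

lemma gradient_f_measurable_past:
  "(\<lambda>\<omega>. gradf k \<omega>) \<in> measurable (generated (past k)) (borel_vec p)"
  by (rule measurable_compose[OF xbar_measurable_past gradient_f_measurable])

lemma not_past: "Inl (i, k) \<notin> past k" "Inr (i, k) \<notin> past k"
  by (auto simp: past_iff)

lemma g_index_sq_integrable: "i < n \<Longrightarrow> c < p \<Longrightarrow> sq_integrable M (\<lambda>\<omega>. g k \<omega> i $ c)"
  by (rule sq_integrable_vec_index[OF g_sq_integrable])

lemma m_index_sq_integrable: "i < n \<Longrightarrow> c < p \<Longrightarrow> sq_integrable M (\<lambda>\<omega>. m k \<omega> i $ c)"
  by (rule sq_integrable_vec_index[OF m_sq_integrable])

text \<open>\<open>gradf\<close> depends on the past only, so each of its entries can serve as the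
  known weight in \<open>expectation_zo\<close>.\<close>

lemma expectation_gradient_gbar:
  "(\<integral>\<omega>. gradf k \<omega> \<bullet> gbar k \<omega> \<partial>M) = (\<integral>\<omega>. gradf k \<omega> \<bullet> mbar k \<omega> \<partial>M)"
  "integrable M (\<lambda>\<omega>. gradf k \<omega> \<bullet> gbar k \<omega>)" "integrable M (\<lambda>\<omega>. gradf k \<omega> \<bullet> mbar k \<omega>)"
proof -
  have expand: "v \<bullet> avg n p y = (\<Sum>c<p. \<Sum>i<n. v $ c * y i $ c) / real n" for v :: "real vec" and y
  proof -
    have "v \<bullet> avg n p y = (\<Sum>c<p. v $ c * ((\<Sum>i<n. y i $ c) / real n))"
      by (simp add: scalar_prod_sum[of _ p] avg_index)
    then show ?thesis by (simp add: sum_divide_distrib sum_distrib_left)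
  qed
  have h: "sq_integrable M (\<lambda>\<omega>. gradf k \<omega> $ c)" if "c < p" for c
    by (rule sq_integrable_vec_index[OF gradient_f_sq_integrable that])
  have ig: "integrable M (\<lambda>\<omega>. gradf k \<omega> $ c * g k \<omega> i $ c)" if "c < p" "i < n" for c i
    by (rule sq_integrable_mult[OF h[OF that(1)] g_index_sq_integrable[OF that(2,1)]])
  have im: "integrable M (\<lambda>\<omega>. gradf k \<omega> $ c * m k \<omega> i $ c)" if "c < p" "i < n" for c i
    by (rule sq_integrable_mult[OF h[OF that(1)] m_index_sq_integrable[OF that(2,1)]])
  have e: "(\<integral>\<omega>. gradf k \<omega> $ c * g k \<omega> i $ c \<partial>M) = (\<integral>\<omega>. gradf k \<omega> $ c * m k \<omega> i $ c \<partial>M)"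
    if "c < p" "i < n" for c i
    by (rule expectation_zo[OF that(2) past_subset not_past X_measurable_past[OF that(2)]
          measurable_vec_index[OF gradient_f_measurable_past that(1)] that(1) ig[OF that]])
  show "integrable M (\<lambda>\<omega>. gradf k \<omega> \<bullet> gbar k \<omega>)" unfolding expand
    by (rule integrable_divide, rule Bochner_Integration.integrable_sum,
        rule Bochner_Integration.integrable_sum, rule ig) auto
  show "integrable M (\<lambda>\<omega>. gradf k \<omega> \<bullet> mbar k \<omega>)" unfolding expand
    by (rule integrable_divide, rule Bochner_Integration.integrable_sum,
        rule Bochner_Integration.integrable_sum, rule im) auto
  have 1: "(\<integral>\<omega>. (\<Sum>c<p. \<Sum>i<n. gradf k \<omega> $ c * g k \<omega> i $ c) \<partial>M) = (\<Sum>c<p. \<Sum>i<n. \<integral>\<omega>. gradf k \<omega> $ c * g k \<omega> i $ c \<partial>M)"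
    by (subst Bochner_Integration.integral_sum; (rule Bochner_Integration.integrable_sum ig sum.cong[OF refl] Bochner_Integration.integral_sum)+) auto
  have 2: "(\<integral>\<omega>. (\<Sum>c<p. \<Sum>i<n. gradf k \<omega> $ c * m k \<omega> i $ c) \<partial>M) = (\<Sum>c<p. \<Sum>i<n. \<integral>\<omega>. gradf k \<omega> $ c * m k \<omega> i $ c \<partial>M)"
    by (subst Bochner_Integration.integral_sum; (rule Bochner_Integration.integrable_sum im sum.cong[OF refl] Bochner_Integration.integral_sum)+) auto
  have 3: "(\<Sum>c<p. \<Sum>i<n. \<integral>\<omega>. gradf k \<omega> $ c * g k \<omega> i $ c \<partial>M) = (\<Sum>c<p. \<Sum>i<n. \<integral>\<omega>. gradf k \<omega> $ c * m k \<omega> i $ c \<partial>M)"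
    by (intro sum.cong refl e) auto
  show "(\<integral>\<omega>. gradf k \<omega> \<bullet> gbar k \<omega> \<partial>M) = (\<integral>\<omega>. gradf k \<omega> \<bullet> mbar k \<omega> \<partial>M)"
    unfolding expand integral_divide_zero 1 2 3 ..
qed

text \<open>Condition twice. The current draw of agent \<open>j\<close> first joins the past, so
  that \<open>g k \<omega> j\<close> is a known weight while agent \<open>i\<close> is averaged out;
  then agent \<open>j\<close> is averaged out given the past.\<close>

lemma expectation_cross:
  assumes i: "i < n" and j: "j < n" and ij: "i \<noteq> j" and c: "c < p"
  shows "(\<integral>\<omega>. g k \<omega> j $ c * g k \<omega> i $ c \<partial>M) = (\<integral>\<omega>. m k \<omega> j $ c * m k \<omega> i $ c \<partial>M)"
proof -
  define R where "R = past k \<union> {Inl (j, k), Inr (j, k)}"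
  have R: "R \<subseteq> indices" "Inl (i, k) \<notin> R" "Inr (i, k) \<notin> R" "past k \<subseteq> R"
    using past_subset[of k] j ij by (auto simp: R_def past_iff)
  have XR: "(\<lambda>\<omega>. X k \<omega> l) \<in> measurable (generated R) (borel_vec p)" if "l < n" for l
    by (rule measurable_generated_mono[OF R(4) X_measurable_past[OF that]])
  have gj: "(\<lambda>\<omega>. g k \<omega> j $ c) \<in> borel_measurable (generated R)"
    by (rule measurable_vec_index[OF measurable_zo_generated[OF j XR[OF j]] c]) (auto simp: R_def)
  have mi: "(\<lambda>\<omega>. m k \<omega> i $ c) \<in> borel_measurable (generated (past k))"
    by (rule measurable_vec_index[OF measurable_compose[OF X_measurable_past[OF i]
          agent.measurable_zo_mean[OF agent[OF i]]] c])
  have "(\<integral>\<omega>. g k \<omega> j $ c * g k \<omega> i $ c \<partial>M) = (\<integral>\<omega>. g k \<omega> j $ c * m k \<omega> i $ c \<partial>M)"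
    by (rule expectation_zo[OF i R(1-3) XR[OF i] gj c
          sq_integrable_mult[OF g_index_sq_integrable[OF j c] g_index_sq_integrable[OF i c]]])
  also have "\<dots> = (\<integral>\<omega>. m k \<omega> i $ c * g k \<omega> j $ c \<partial>M)" by (simp only: mult.commute)
  also have "\<dots> = (\<integral>\<omega>. m k \<omega> i $ c * m k \<omega> j $ c \<partial>M)"
    by (rule expectation_zo[OF j past_subset not_past X_measurable_past[OF j] mi c
          sq_integrable_mult[OF m_index_sq_integrable[OF i c] g_index_sq_integrable[OF j c]]])
  also have "\<dots> = (\<integral>\<omega>. m k \<omega> j $ c * m k \<omega> i $ c \<partial>M)" by (simp only: mult.commute)
  finally show ?thesis .
qed

lemma gbar_sq_integrable: "sq_integrable_vec p M (gbar k)"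
  by (rule avg_sq_integrable[OF g_sq_integrable])

lemma mbar_sq_integrable: "sq_integrable_vec p M (mbar k)"
  by (rule avg_sq_integrable[OF m_sq_integrable])

text \<open>Given the past, the estimators of different agents are uncorrelated.\<close>

lemma gbar_second_moment:
  "(\<integral>\<omega>. (vnorm (gbar k \<omega>))\<^sup>2 \<partial>M) \<le> (\<integral>\<omega>. (vnorm (mbar k \<omega>))\<^sup>2 \<partial>M) + GG k / real n"
proof -
  have expand: "(vnorm (avg n p y))\<^sup>2 = (\<Sum>c<p. \<Sum>i<n. \<Sum>j<n. y i $ c * y j $ c) / (real n)\<^sup>2" for y
  proof -
    have "(vnorm (avg n p y))\<^sup>2 = (\<Sum>c<p. ((\<Sum>i<n. y i $ c) / real n)\<^sup>2)"
      by (simp add: vnorm_power2_eq_sum[of _ p] avg_index)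
    then show ?thesis by (simp add: power2_eq_square sum_product sum_divide_distrib)
  qed
  have int: "(\<integral>\<omega>. (vnorm (avg n p (Y \<omega>)))\<^sup>2 \<partial>M)
      = (\<Sum>c<p. \<Sum>i<n. \<Sum>j<n. \<integral>\<omega>. Y \<omega> i $ c * Y \<omega> j $ c \<partial>M) / (real n)\<^sup>2"
    if Y: "\<And>i c. i < n \<Longrightarrow> c < p \<Longrightarrow> sq_integrable M (\<lambda>\<omega>. Y \<omega> i $ c)" for Y :: "_ \<Rightarrow> nat \<Rightarrow> real vec"
  proof -
    have i: "integrable M (\<lambda>\<omega>. Y \<omega> i $ c * Y \<omega> j $ c)" if "i < n" "j < n" "c < p" for i j c
      by (rule sq_integrable_mult[OF Y[OF that(1,3)] Y[OF that(2,3)]])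
    have "(\<integral>\<omega>. (\<Sum>c<p. \<Sum>i<n. \<Sum>j<n. Y \<omega> i $ c * Y \<omega> j $ c) \<partial>M)
        = (\<Sum>c<p. \<integral>\<omega>. (\<Sum>i<n. \<Sum>j<n. Y \<omega> i $ c * Y \<omega> j $ c) \<partial>M)"
      by (rule Bochner_Integration.integral_sum, rule Bochner_Integration.integrable_sum,
          rule Bochner_Integration.integrable_sum, rule i) auto
    also have "\<dots> = (\<Sum>c<p. \<Sum>i<n. \<integral>\<omega>. (\<Sum>j<n. Y \<omega> i $ c * Y \<omega> j $ c) \<partial>M)"
      by (rule sum.cong[OF refl], rule Bochner_Integration.integral_sum,
          rule Bochner_Integration.integrable_sum, rule i) auto
    also have "\<dots> = (\<Sum>c<p. \<Sum>i<n. \<Sum>j<n. \<integral>\<omega>. Y \<omega> i $ c * Y \<omega> j $ c \<partial>M)"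
      by (rule sum.cong[OF refl], rule sum.cong[OF refl], rule Bochner_Integration.integral_sum, rule i) auto
    finally show ?thesis unfolding expand integral_divide_zero by simp
  qed
  have le: "(\<integral>\<omega>. g k \<omega> i $ c * g k \<omega> j $ c \<partial>M)
      \<le> (\<integral>\<omega>. m k \<omega> i $ c * m k \<omega> j $ c \<partial>M) + (if i = j then \<integral>\<omega>. (g k \<omega> i $ c)\<^sup>2 \<partial>M else 0)"
    if "c < p" "i < n" "j < n" for c i j
  proof (cases "i = j")
    case True
    \<comment> \<open>Adding the nonnegative diagonal products completes the double sum of means to
      the square of \<open>mbar\<close>; the price is one full second moment per agent, divided by
      \<open>n^2\<close>.\<close>
    have "0 \<le> (\<integral>\<omega>. m k \<omega> i $ c * m k \<omega> j $ c \<partial>M)" using True by (intro integral_nonneg_AE) auto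
    then show ?thesis using True by (simp add: power2_eq_square)
  next
    case False
    then show ?thesis using expectation_cross[OF that(3,2) _ that(1), of k] by simp
  qed
  have "(\<Sum>c<p. \<Sum>i<n. \<Sum>j<n. \<integral>\<omega>. g k \<omega> i $ c * g k \<omega> j $ c \<partial>M)
      \<le> (\<Sum>c<p. \<Sum>i<n. \<Sum>j<n. (\<integral>\<omega>. m k \<omega> i $ c * m k \<omega> j $ c \<partial>M)
          + (if i = j then \<integral>\<omega>. (g k \<omega> i $ c)\<^sup>2 \<partial>M else 0))"
    by (rule sum_mono, rule sum_mono, rule sum_mono, rule le) auto
  also have "\<dots> = (\<Sum>c<p. \<Sum>i<n. \<Sum>j<n. \<integral>\<omega>. m k \<omega> i $ c * m k \<omega> j $ c \<partial>M)
      + (\<Sum>c<p. \<Sum>i<n. \<integral>\<omega>. (g k \<omega> i $ c)\<^sup>2 \<partial>M)"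
    by (simp add: sum.distrib sum.delta)
  finally have 1: "(\<integral>\<omega>. (vnorm (gbar k \<omega>))\<^sup>2 \<partial>M)
      \<le> (\<integral>\<omega>. (vnorm (mbar k \<omega>))\<^sup>2 \<partial>M) + (\<Sum>c<p. \<Sum>i<n. \<integral>\<omega>. (g k \<omega> i $ c)\<^sup>2 \<partial>M) / (real n)\<^sup>2"
  proof -
    assume le: "(\<Sum>c<p. \<Sum>i<n. \<Sum>j<n. \<integral>\<omega>. g k \<omega> i $ c * g k \<omega> j $ c \<partial>M)
      \<le> (\<Sum>c<p. \<Sum>i<n. \<Sum>j<n. \<integral>\<omega>. m k \<omega> i $ c * m k \<omega> j $ c \<partial>M)
      + (\<Sum>c<p. \<Sum>i<n. \<integral>\<omega>. (g k \<omega> i $ c)\<^sup>2 \<partial>M)"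
    have g: "(\<integral>\<omega>. (vnorm (gbar k \<omega>))\<^sup>2 \<partial>M)
        = (\<Sum>c<p. \<Sum>i<n. \<Sum>j<n. \<integral>\<omega>. g k \<omega> i $ c * g k \<omega> j $ c \<partial>M) / (real n)\<^sup>2"
      by (rule int) (rule g_index_sq_integrable)
    have m: "(\<integral>\<omega>. (vnorm (mbar k \<omega>))\<^sup>2 \<partial>M)
        = (\<Sum>c<p. \<Sum>i<n. \<Sum>j<n. \<integral>\<omega>. m k \<omega> i $ c * m k \<omega> j $ c \<partial>M) / (real n)\<^sup>2"
      by (rule int) (rule m_index_sq_integrable)
    show ?thesis unfolding g m add_divide_distrib[symmetric]
      by (rule divide_right_mono[OF le]) simp
  qed
  have "(\<Sum>c<p. \<Sum>i<n. \<integral>\<omega>. (g k \<omega> i $ c)\<^sup>2 \<partial>M) = (\<Sum>i<n. \<Sum>c<p. \<integral>\<omega>. (g k \<omega> i $ c)\<^sup>2 \<partial>M)"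
    by (rule sum.swap)
  also have "\<dots> = (\<Sum>i<n. \<integral>\<omega>. (vnorm (g k \<omega> i))\<^sup>2 \<partial>M)"
  proof (rule sum.cong[OF refl])
    fix i assume "i \<in> {..<n}"
    then have i: "i < n" by simp
    have "(\<integral>\<omega>. (vnorm (g k \<omega> i))\<^sup>2 \<partial>M) = (\<integral>\<omega>. (\<Sum>c<p. (g k \<omega> i $ c)\<^sup>2) \<partial>M)"
      by (rule Bochner_Integration.integral_cong[OF refl], rule vnorm_power2_eq_sum[OF g_carrier[OF i]])
    also have "\<dots> = (\<Sum>c<p. \<integral>\<omega>. (g k \<omega> i $ c)\<^sup>2 \<partial>M)"
    proof (rule Bochner_Integration.integral_sum)
      fix c assume "c \<in> {..<p}"
      then have "sq_integrable M (\<lambda>\<omega>. g k \<omega> i $ c)" using g_index_sq_integrable[OF i] by blast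
      then show "integrable M (\<lambda>\<omega>. (g k \<omega> i $ c)\<^sup>2)" unfolding sq_integrable_def by blast
    qed
    finally show "(\<Sum>c<p. \<integral>\<omega>. (g k \<omega> i $ c)\<^sup>2 \<partial>M) = (\<integral>\<omega>. (vnorm (g k \<omega> i))\<^sup>2 \<partial>M)" by simp
  qed
  also have "\<dots> = real n * GG k"
  proof -
    have "(\<integral>\<omega>. (\<Sum>i<n. (vnorm (g k \<omega> i))\<^sup>2) \<partial>M) = (\<Sum>i<n. \<integral>\<omega>. (vnorm (g k \<omega> i))\<^sup>2 \<partial>M)"
    proof (rule Bochner_Integration.integral_sum)
      fix i assume "i \<in> {..<n}"
      then have "sq_integrable_vec p M (\<lambda>\<omega>. g k \<omega> i)" using g_sq_integrable by blast
      then show "integrable M (\<lambda>\<omega>. (vnorm (g k \<omega> i))\<^sup>2)" unfolding sq_integrable_vec_def by blast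
    qed
    then show ?thesis unfolding integral_divide_zero using n_ge_1 by simp
  qed
  finally have "(\<Sum>c<p. \<Sum>i<n. \<integral>\<omega>. (g k \<omega> i $ c)\<^sup>2 \<partial>M) / (real n)\<^sup>2 = GG k / real n"
    using n_ge_1 by (simp add: power2_eq_square)
  then show ?thesis using 1 by simp
qed

lemma vnorm_diff_power2:
  assumes "a \<in> carrier_vec p" "b \<in> carrier_vec p"
  shows "(vnorm (a - b))\<^sup>2 = (vnorm a)\<^sup>2 - 2 * (a \<bullet> b) + (vnorm b)\<^sup>2"
proof -
  have "(vnorm (a - b))\<^sup>2 = (\<Sum>c<p. (a $ c - b $ c)\<^sup>2)"
    using assms by (subst vnorm_power2_eq_sum[of _ p]) (auto intro!: sum.cong)
  also have "\<dots> = (\<Sum>c<p. (a $ c)\<^sup>2 - 2 * (a $ c * b $ c) + (b $ c)\<^sup>2)"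
    by (intro sum.cong refl) (simp add: power2_diff algebra_simps)
  also have "\<dots> = (\<Sum>c<p. (a $ c)\<^sup>2) - 2 * (\<Sum>c<p. a $ c * b $ c) + (\<Sum>c<p. (b $ c)\<^sup>2)"
    by (simp add: sum.distrib sum_subtractf sum_distrib_left)
  finally show ?thesis using assms by (simp add: vnorm_power2_eq_sum[of _ p] scalar_prod_sum[of b p])
qed

text \<open>Polarization: the scalar product is half of \<open>\<parallel>gradf\<parallel>^2 +
  \<parallel>mbar\<parallel>^2 - \<parallel>gradf - mbar\<parallel>^2\<close>. The first term feeds
  the Polyak-Lojasiewicz inequality, the second is kept to absorb the quadratic term of the descent,
  and the third is bounded by disagreement plus squared bias.\<close>

lemma gradient_mbar_lower:
  assumes dk: "\<And>i. i < n \<Longrightarrow> (\<delta> i k)\<^sup>2 \<le> dk"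
  shows "\<nu> * (f (xbar k \<omega>) - f_min) + (vnorm (mbar k \<omega>))\<^sup>2 / 2
      - L\<^sub>f\<^sup>2 * disagreement n p (X k \<omega>) - L\<^sub>f\<^sup>2 * dk \<le> gradf k \<omega> \<bullet> mbar k \<omega>"
proof -
  let ?x = "xbar k \<omega>"
  let ?e = "\<lambda>i. gradient p (loc i) ?x - m k \<omega> i"
  have gc: "gradient p (loc i) ?x \<in> carrier_vec p" if "i < n" for i
    by (rule loc_gradient_carrier[OF that avg_carrier])
  have e_le: "(vnorm (?e i))\<^sup>2 \<le> 2 * L\<^sub>f\<^sup>2 * (vnorm (X k \<omega> i - ?x))\<^sup>2 + 2 * (L\<^sub>f\<^sup>2 * dk)" if i: "i < n" for i
  proof -
    let ?h = "gradient p (loc i) (X k \<omega> i)"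
    have h: "?h \<in> carrier_vec p" by (rule loc_gradient_carrier[OF i X_carrier[OF i]])
    note c = gc[OF i] h m_carrier[OF i, of k \<omega>]
    have "?e i = (gradient p (loc i) ?x - ?h) + (?h - m k \<omega> i)" using c by (intro eq_vecI) auto
    then have "(vnorm (?e i))\<^sup>2 \<le> 2 * (vnorm (gradient p (loc i) ?x - ?h))\<^sup>2 + 2 * (vnorm (?h - m k \<omega> i))\<^sup>2"
      using vnorm_power2_add_le[of "gradient p (loc i) ?x - ?h" p "?h - m k \<omega> i"] c by simp
    moreover have "(vnorm (gradient p (loc i) ?x - ?h))\<^sup>2 \<le> (L\<^sub>f * vnorm (?x - X k \<omega> i))\<^sup>2"
      by (intro power_mono smooth_lipschitz[OF loc_smooth[OF i]] X_carrier i avg_carrier) auto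
    moreover have "vnorm (?x - X k \<omega> i) = vnorm (X k \<omega> i - ?x)"
      by (rule vnorm_minus_commute[OF avg_carrier X_carrier[OF i]])
    moreover have "vnorm (m k \<omega> i - ?h) \<le> \<delta> i k * L\<^sub>f"
      by (rule agent.zo_bias[OF agent[OF i] X_carrier[OF i] \<delta>_pos[OF i]])
    then have "(vnorm (?h - m k \<omega> i))\<^sup>2 \<le> (\<delta> i k * L\<^sub>f)\<^sup>2"
      unfolding vnorm_minus_commute[OF h m_carrier[OF i]] by (intro power_mono) auto
    moreover have "(\<delta> i k * L\<^sub>f)\<^sup>2 \<le> L\<^sub>f\<^sup>2 * dk"
      using mult_left_mono[OF dk[OF i], of "L\<^sub>f\<^sup>2"] by (simp add: power_mult_distrib mult.commute)
    ultimately show ?thesis by (simp add: power_mult_distrib)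
  qed
  have eq: "gradf k \<omega> - mbar k \<omega> = avg n p ?e"
  proof (rule eq_vecI)
    fix c assume "c < dim_vec (avg n p ?e)"
    then have c: "c < p" by (simp add: avg_def)
    have "(\<Sum>i<n. ?e i $ c) = (\<Sum>i<n. gradient p (loc i) ?x $ c - m k \<omega> i $ c)"
    proof (rule sum.cong[OF refl])
      fix i assume "i \<in> {..<n}"
      then have "dim_vec (m k \<omega> i) = p" using m_carrier[of i k \<omega>] by simp
      then show "?e i $ c = gradient p (loc i) ?x $ c - m k \<omega> i $ c" using c by simp
    qed
    then show "(gradf k \<omega> - mbar k \<omega>) $ c = avg n p ?e $ c"
      using c by (simp add: f_gradient avg_def sum_subtractf diff_divide_distrib)
  qed (simp add: avg_def f_gradient)
  have "(vnorm (gradf k \<omega> - mbar k \<omega>))\<^sup>2 \<le> (\<Sum>i<n. (vnorm (?e i))\<^sup>2) / real n"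
    unfolding eq by (rule vnorm_avg_le[OF n_ge_1]) (use gc m_carrier in auto)
  also have "\<dots> \<le> (\<Sum>i<n. 2 * L\<^sub>f\<^sup>2 * (vnorm (X k \<omega> i - ?x))\<^sup>2 + 2 * (L\<^sub>f\<^sup>2 * dk)) / real n"
    by (intro divide_right_mono sum_mono e_le) auto
  also have "\<dots> = 2 * L\<^sub>f\<^sup>2 * disagreement n p (X k \<omega>) + 2 * (L\<^sub>f\<^sup>2 * dk)"
    using n_ge_1 by (simp add: disagreement_def sum.distrib sum_distrib_left[symmetric] add_divide_distrib)
  finally have 1: "(vnorm (gradf k \<omega> - mbar k \<omega>))\<^sup>2 \<le> 2 * L\<^sub>f\<^sup>2 * disagreement n p (X k \<omega>) + 2 * (L\<^sub>f\<^sup>2 * dk)" .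
  have 2: "(vnorm (gradf k \<omega> - mbar k \<omega>))\<^sup>2 = (vnorm (gradf k \<omega>))\<^sup>2 - 2 * (gradf k \<omega> \<bullet> mbar k \<omega>) + (vnorm (mbar k \<omega>))\<^sup>2"
    by (rule vnorm_diff_power2[OF f_gradient_carrier[OF avg_carrier] avg_carrier])
  have "\<nu> * (f ?x - f_min) \<le> (vnorm (gradf k \<omega>))\<^sup>2 / 2"
    using PL avg_carrier unfolding polyak_lojasiewicz_def by fastforce
  then show ?thesis using 1 2 by linarith
qed

lemma descent_step:
  assumes \<omega>: "\<omega> \<in> space M"
  shows "f (xbar (Suc k) \<omega>) - f_min \<le> (f (xbar k \<omega>) - f_min) - \<eta> k * (gradf k \<omega> \<bullet> gbar k \<omega>)
    + L\<^sub>f / 2 * (\<eta> k)\<^sup>2 * (vnorm (gbar k \<omega>))\<^sup>2"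
proof -
  have "f (xbar k \<omega> + (- \<eta> k) \<cdot>\<^sub>v gbar k \<omega>) - f (xbar k \<omega>) - gradf k \<omega> \<bullet> ((- \<eta> k) \<cdot>\<^sub>v gbar k \<omega>)
      \<le> L\<^sub>f / 2 * (vnorm ((- \<eta> k) \<cdot>\<^sub>v gbar k \<omega>))\<^sup>2"
    by (rule abs_le_D1[OF smooth_quadratic_bound[OF f_smooth less_imp_le[OF L\<^sub>f_pos]]]) simp_all
  moreover have "gradf k \<omega> \<bullet> ((- \<eta> k) \<cdot>\<^sub>v gbar k \<omega>) = - \<eta> k * (gradf k \<omega> \<bullet> gbar k \<omega>)"
    by (rule scalar_prod_smult_distrib[OF f_gradient_carrier[OF avg_carrier] avg_carrier])
  moreover have "L\<^sub>f / 2 * (vnorm ((- \<eta> k) \<cdot>\<^sub>v gbar k \<omega>))\<^sup>2 = L\<^sub>f / 2 * (\<eta> k)\<^sup>2 * (vnorm (gbar k \<omega>))\<^sup>2"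
    by (simp add: vnorm_smult power_mult_distrib)
  ultimately show ?thesis unfolding xbar_Suc[OF \<omega>] by linarith
qed

lemma WW_recursion:
  assumes dk: "\<And>i. i < n \<Longrightarrow> (\<delta> i k)\<^sup>2 \<le> dk"
  shows "WW (Suc k) \<le> WW k - \<nu> * \<eta> k * WW k + \<eta> k * L\<^sub>f\<^sup>2 * DD k + \<eta> k * L\<^sub>f\<^sup>2 * dk
    + L\<^sub>f / 2 * (\<eta> k)\<^sup>2 * (GG k / real n)"
proof -
  define S where "S = (\<integral>\<omega>. (vnorm (mbar k \<omega>))\<^sup>2 \<partial>M)"
  define P where "P = (\<integral>\<omega>. gradf k \<omega> \<bullet> mbar k \<omega> \<partial>M)"
  have S0: "0 \<le> S" by (simp add: S_def)
  note W = f_gap_integrable[of k] and E = expectation_gradient_gbar[of k] and Dg = disagreement_integrable[of k]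
  have gi: "integrable M (\<lambda>\<omega>. (vnorm (gbar k \<omega>))\<^sup>2)" and mi: "integrable M (\<lambda>\<omega>. (vnorm (mbar k \<omega>))\<^sup>2)"
    using gbar_sq_integrable mbar_sq_integrable by (simp_all add: sq_integrable_vec_def)
  note i1 = Bochner_Integration.integrable_diff[OF W integrable_mult_right[OF E(2), of "\<eta> k"]]
  note i2 = integrable_mult_right[OF gi, of "L\<^sub>f / 2 * (\<eta> k)\<^sup>2"]
  have "WW (Suc k) \<le> (\<integral>\<omega>. ((f (xbar k \<omega>) - f_min) - \<eta> k * (gradf k \<omega> \<bullet> gbar k \<omega>))
      + L\<^sub>f / 2 * (\<eta> k)\<^sup>2 * (vnorm (gbar k \<omega>))\<^sup>2 \<partial>M)"
    by (rule integral_mono[OF f_gap_integrable Bochner_Integration.integrable_add[OF i1 i2] descent_step])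
  also have "\<dots> = WW k - \<eta> k * P + L\<^sub>f / 2 * (\<eta> k)\<^sup>2 * (\<integral>\<omega>. (vnorm (gbar k \<omega>))\<^sup>2 \<partial>M)"
    unfolding Bochner_Integration.integral_add[OF i1 i2]
      Bochner_Integration.integral_diff[OF W integrable_mult_right[OF E(2), of "\<eta> k"]]
      integral_mult_right_zero E(1) P_def ..
  also have "\<dots> \<le> WW k - \<eta> k * P + L\<^sub>f / 2 * (\<eta> k)\<^sup>2 * (S + GG k / real n)"
    unfolding S_def using L\<^sub>f_pos by (intro add_left_mono mult_left_mono gbar_second_moment) auto
  finally have 1: "WW (Suc k) \<le> WW k - \<eta> k * P + L\<^sub>f / 2 * (\<eta> k)\<^sup>2 * S + L\<^sub>f / 2 * (\<eta> k)\<^sup>2 * (GG k / real n)"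
    by (simp add: algebra_simps)
  note j1 = integrable_mult_right[OF W, of \<nu>]
  note j2 = integrable_divide[OF mi, of 2]
  note j3 = integrable_mult_right[OF Dg, of "L\<^sub>f\<^sup>2"]
  have cst: "integrable M (\<lambda>\<omega>. L\<^sub>f\<^sup>2 * dk)" by simp
  note j12 = Bochner_Integration.integrable_add[OF j1 j2]
  note j123 = Bochner_Integration.integrable_diff[OF j12 j3]
  have "\<nu> * WW k + S / 2 - L\<^sub>f\<^sup>2 * DD k - L\<^sub>f\<^sup>2 * dk
      = (\<integral>\<omega>. \<nu> * (f (xbar k \<omega>) - f_min) + (vnorm (mbar k \<omega>))\<^sup>2 / 2
          - L\<^sub>f\<^sup>2 * disagreement n p (X k \<omega>) - L\<^sub>f\<^sup>2 * dk \<partial>M)"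
    unfolding Bochner_Integration.integral_diff[OF j123 cst] Bochner_Integration.integral_diff[OF j12 j3]
      Bochner_Integration.integral_add[OF j1 j2] integral_mult_right_zero integral_divide_zero S_def
    by (simp add: M.prob_space)
  also have "\<dots> \<le> P" unfolding P_def
    by (rule integral_mono[OF Bochner_Integration.integrable_diff[OF j123 cst] E(3) gradient_mbar_lower[OF dk]])
  finally have "\<eta> k * (\<nu> * WW k + S / 2 - L\<^sub>f\<^sup>2 * DD k - L\<^sub>f\<^sup>2 * dk) \<le> \<eta> k * P"
    by (rule mult_left_mono[OF _ \<eta>_nonneg])
  \<comment> \<open>The mean part of the squared step is absorbed here. What survives is the term
    \<open>GG k\<close> divided by \<open>n\<close>, and hence the speedup with the number of
    agents.\<close>
  moreover have "L\<^sub>f / 2 * (\<eta> k)\<^sup>2 * S \<le> \<eta> k * (S / 2)"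
  proof -
    have "(L\<^sub>f * \<eta> k) * (\<eta> k * (S / 2)) \<le> 1 * (\<eta> k * (S / 2))"
      by (intro mult_right_mono \<eta>_le mult_nonneg_nonneg \<eta>_nonneg) (use S0 in auto)
    then show ?thesis by (simp add: power2_eq_square)
  qed
  moreover have "\<eta> k * (\<nu> * WW k + S / 2 - L\<^sub>f\<^sup>2 * DD k - L\<^sub>f\<^sup>2 * dk)
      = \<nu> * \<eta> k * WW k + \<eta> k * (S / 2) - \<eta> k * L\<^sub>f\<^sup>2 * DD k - \<eta> k * L\<^sub>f\<^sup>2 * dk"
    by (simp add: algebra_simps)
  ultimately show ?thesis using 1 by linarith
qed

end

section \<open>The scalar recursions\<close>

text \<open>Half of the rate \<open>e\<close> pays for the noise, the other half for the decrease of
  \<open>1 / s^2\<close>. The shift to \<open>t'\<close> ensures \<open>s \<ge> 4 / e\<close>, which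
  is enough for \<open>(1 - e / 2) * (s + 1)^2 \<le> s^2\<close>.\<close>

lemma inverse_square_decay:
  fixes D :: "nat \<Rightarrow> real"
  assumes rec: "\<And>k. D (Suc k) \<le> (1 - e) * D k + c / (real k + t)\<^sup>2"
    and e: "0 < e" "e \<le> 1" and t: "0 < t" and c: "0 \<le> c"
  defines "t' \<equiv> t + 4 / e"
  assumes K: "D 0 * t'\<^sup>2 \<le> K" "2 * c * (t' / t)\<^sup>2 / e \<le> K"
  shows "D k \<le> K / (real k + t')\<^sup>2"
proof (induction k)
  case 0
  have "0 < t'" using t e by (simp add: t'_def add_pos_pos)
  then show ?case using K(1) by (simp add: pos_le_divide_eq)
next
  case (Suc k)
  define s where "s = real k + t'"
  have t': "t \<le> t'" "4 / e \<le> t'" using t e by (auto simp: t'_def)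
  have s: "4 / e \<le> s" "0 < s" using t' t e by (auto simp: s_def)
  have "0 \<le> 2 * c * (t' / t)\<^sup>2 / e" using c e by simp
  then have K0: "0 \<le> K" using K(2) by linarith
  \<comment> \<open>The noise is given at the unshifted offset; \<open>t' / t\<close> bounds the
    ratio of the two denominators for all \<open>k\<close>.\<close>
  have shift: "c / (real k + t)\<^sup>2 \<le> c * (t' / t)\<^sup>2 / s\<^sup>2"
  proof -
    have "s * t \<le> t' * (real k + t)" using mult_right_mono[OF t'(1), of "real k"] by (simp add: s_def algebra_simps)
    then have "s / (real k + t) \<le> t' / t" using t by (simp add: divide_simps mult.commute)
    then have "(s / (real k + t))\<^sup>2 \<le> (t' / t)\<^sup>2" using s t by (intro power_mono) auto
    then have "c * (s / (real k + t))\<^sup>2 / s\<^sup>2 \<le> c * (t' / t)\<^sup>2 / s\<^sup>2"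
      using c by (intro divide_right_mono mult_left_mono) auto
    then show ?thesis using s by (simp add: power_divide)
  qed
  have "2 * (c * (t' / t)\<^sup>2) / e \<le> K" using K(2) by (simp add: mult.assoc)
  then have c': "c * (t' / t)\<^sup>2 \<le> K * (e / 2)" using e by (simp add: pos_divide_le_eq algebra_simps)
  have "D (Suc k) \<le> (1 - e) * (K / s\<^sup>2) + c * (t' / t)\<^sup>2 / s\<^sup>2"
    using rec[of k] shift mult_left_mono[OF Suc.IH, of "1 - e"] e by (simp add: s_def)
  also have "\<dots> \<le> (1 - e) * (K / s\<^sup>2) + K * (e / 2) / s\<^sup>2"
    using c' by (intro add_left_mono divide_right_mono) auto
  also have "\<dots> = K * ((1 - e / 2) / s\<^sup>2)" by (simp add: algebra_simps add_divide_distrib diff_divide_distrib)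
  also have "\<dots> \<le> K * (1 / (s + 1)\<^sup>2)"
  proof (rule mult_left_mono[OF _ K0])
    have "4 \<le> e * s" using s(1) e by (simp add: pos_divide_le_eq mult.commute)
    then have "2 * s \<le> (e / 2) * s * s" using s(2) mult_right_mono[of 4 "e * s" s] by simp
    moreover have "4 * s \<le> e * s * s" using calculation by simp
    moreover have "(1 - e / 2) * (s + 1)\<^sup>2 = s\<^sup>2 + 2 * s + 1 - (e / 2) * s * s - e * s - e / 2"
      by (simp add: power2_eq_square algebra_simps)
    ultimately have "(1 - e / 2) * (s + 1)\<^sup>2 \<le> s\<^sup>2" using \<open>4 \<le> e * s\<close> e by linarith
    then show "(1 - e / 2) / s\<^sup>2 \<le> 1 / (s + 1)\<^sup>2" using s(2) by (simp add: divide_simps)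
  qed
  finally show ?case by (simp add: s_def add.commute add.left_commute)
qed

text \<open>With rate 3 both profiles close: \<open>a / s\<close> leaves
  \<open>a * (s - 2) / s^2\<close>, and \<open>d / s^2\<close> leaves
  \<open>d * (s - 2) / s^3\<close>. The noise constant \<open>a\<close> reappears unchanged in the
  leading term and the initial value is confined to the faster one; this keeps the network out of
  the leading constant.\<close>

lemma inverse_decay:
  fixes W :: "nat \<Rightarrow> real"
  assumes rec: "\<And>k. W (Suc k) \<le> (1 - 3 / (real k + t)) * W k + a / (real k + t)\<^sup>2 + b / (real k + t) ^ 3"
    and t: "3 \<le> t" and a: "0 \<le> a" and b: "0 \<le> b" and W0: "0 \<le> W 0"
  shows "W k \<le> a / (real k + t) + (W 0 * t\<^sup>2 + b) / (real k + t)\<^sup>2"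
proof (induction k)
  case 0
  have "W 0 = W 0 * t\<^sup>2 / t\<^sup>2" using t by simp
  also have "\<dots> \<le> (W 0 * t\<^sup>2 + b) / t\<^sup>2" using b by (intro divide_right_mono) auto
  finally show ?case using a t by (simp add: add_increasing)
next
  case (Suc k)
  define s where "s = real k + t"
  \<comment> \<open>Large enough for the base case and for dominating the cubic noise
    \<open>b\<close>.\<close>
  define d where "d = W 0 * t\<^sup>2 + b"
  have s: "3 \<le> s" using t by (simp add: s_def)
  have d: "0 \<le> d" "b \<le> d" using b W0 by (auto simp: d_def)
  have "W (Suc k) \<le> (1 - 3 / s) * (a / s + d / s\<^sup>2) + a / s\<^sup>2 + b / s ^ 3"
    using rec[of k] mult_left_mono[OF Suc.IH, of "1 - 3 / s"] s by (simp add: s_def[symmetric] d_def[symmetric])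
  also have "\<dots> \<le> (1 - 3 / s) * (a / s + d / s\<^sup>2) + a / s\<^sup>2 + d / s ^ 3"
    using d s by (intro add_left_mono divide_right_mono) auto
  also have "\<dots> = a * ((s - 2) / s\<^sup>2) + d * ((s - 2) / s ^ 3)"
    using s by (simp add: field_simps power2_eq_square power3_eq_cube)
  also have "\<dots> \<le> a * (1 / (s + 1)) + d * (1 / (s + 1)\<^sup>2)"
  proof (intro add_mono mult_left_mono a d(1))
    show "(s - 2) / s\<^sup>2 \<le> 1 / (s + 1)"
      using s by (simp add: divide_simps power2_eq_square algebra_simps)
    have "(s - 2) * (s + 1)\<^sup>2 = s ^ 3 - 3 * s - 2"
      by (simp add: power2_eq_square power3_eq_cube algebra_simps)
    then have "(s - 2) * (s + 1)\<^sup>2 \<le> s ^ 3" using s by linarith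
    then show "(s - 2) / s ^ 3 \<le> 1 / (s + 1)\<^sup>2" using s by (simp add: divide_simps)
  qed
  finally show ?case by (simp add: s_def d_def add.commute add.left_commute)
qed

text \<open>The noise telescopes through \<open>1 / s^2 \<le> 1 / (s - 1) - 1 / s\<close>.\<close>

lemma summed_squares_bound:
  fixes U :: "nat \<Rightarrow> real"
  assumes rec: "\<And>k. U (Suc k) \<le> U k + c / (real k + t)\<^sup>2" and t: "1 < t" and c: "0 \<le> c"
  shows "U k \<le> U 0 + c / (t - 1)"
proof -
  have "U k \<le> U 0 + c * (1 / (t - 1) - 1 / (real k + t - 1))"
  proof (induction k)
    case (Suc k)
    define s where "s = real k + t"
    have s: "1 < s" using t by (simp add: s_def)
    have "1 / s\<^sup>2 \<le> 1 / (s - 1) - 1 / s"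
      using s by (simp add: divide_simps power2_eq_square algebra_simps)
    then have "c * (1 / s\<^sup>2) \<le> c * (1 / (s - 1) - 1 / s)" by (rule mult_left_mono[OF _ c])
    then have "U (Suc k) \<le> U 0 + c * (1 / (t - 1) - 1 / (s - 1)) + c * (1 / (s - 1) - 1 / s)"
      using rec[of k] Suc.IH by (simp add: s_def)
    also have "\<dots> = U 0 + c * (1 / (t - 1) - 1 / s)" by (simp add: algebra_simps)
    finally show ?case by (simp add: s_def)
  qed (use t in simp)
  also have "\<dots> \<le> U 0 + c * (1 / (t - 1))" using t c by (intro add_left_mono mult_left_mono) auto
  finally show ?thesis by simp
qed

text \<open>The part of the estimator's second moment, per unit of \<open>p\<close>, that shrinks
  neither with the disagreement nor with the gap. Its terms stem from heterogeneity, sampling and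
  smoothing, the last one using \<open>p * \<eta> * L \<le> 1 / 4\<close>.\<close>

definition noise_level :: "real \<Rightarrow> real \<Rightarrow> real \<Rightarrow> real \<Rightarrow> real \<Rightarrow> real" where
  "noise_level L \<sigma>\<^sub>0 \<sigma>\<^sub>1 \<kappa>\<^sub>\<delta> \<Delta> = 16 * (1 + \<sigma>\<^sub>0\<^sup>2) * L * \<Delta> + 4 * \<sigma>\<^sub>1\<^sup>2 + L * \<kappa>\<^sub>\<delta>\<^sup>2 / 8"

text \<open>The coefficient of \<open>\<eta>^2 * p / n\<close> in the recursion of the gap: squared
  bias plus averaged estimator noise. None of its arguments stems from the graph.\<close>

definition descent_noise :: "real \<Rightarrow> real \<Rightarrow> real \<Rightarrow> real \<Rightarrow> real \<Rightarrow> real" where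
  "descent_noise L \<sigma>\<^sub>0 \<sigma>\<^sub>1 \<kappa>\<^sub>\<delta> \<Delta> = L\<^sup>2 * \<kappa>\<^sub>\<delta>\<^sup>2 + L * noise_level L \<sigma>\<^sub>0 \<sigma>\<^sub>1 \<kappa>\<^sub>\<delta> \<Delta> / 2"

text \<open>Eliminates \<open>G\<close>. \<open>h1\<close> and \<open>h2\<close> are the two halves
  of the condition through \<open>d2_tilde\<close>, and \<open>h3\<close> is the one through
  \<open>eps10\<close>. They are spent so that the rates \<open>3 / 4 * \<nu> * \<eta>\<close> and
  \<open>3 / 2 * e1\<close> remain, which still suffices for the sum of \<open>D\<close> and
  \<open>W\<close> to grow by noise only.\<close>

lemma one_step:
  fixes n p L \<sigma>\<^sub>0 \<sigma>\<^sub>1 \<nu> \<kappa>\<^sub>\<delta> \<Delta> e1 e2 \<eta> G W D W' D' :: real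
  defines "a \<equiv> 1 + \<sigma>\<^sub>0\<^sup>2" and "S \<equiv> noise_level L \<sigma>\<^sub>0 \<sigma>\<^sub>1 \<kappa>\<^sub>\<delta> \<Delta>" and "S' \<equiv> descent_noise L \<sigma>\<^sub>0 \<sigma>\<^sub>1 \<kappa>\<^sub>\<delta> \<Delta>"
    and "dk \<equiv> \<kappa>\<^sub>\<delta>\<^sup>2 * (p * \<eta>) / (n + p)"
  assumes n: "1 \<le> n" and p: "1 \<le> p" and L: "0 < L" and e2: "0 \<le> e2" and \<eta>: "0 < \<eta>"
    and \<Delta>: "0 \<le> \<Delta>" and W: "0 \<le> W" and D: "0 \<le> D"
    and h1: "\<eta> * L\<^sup>2 \<le> e1 / 4" and h2: "4 * p * a * (2 * e2 + L) * \<eta> \<le> 1"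
    and h3: "8 * p * a * (2 * e2 + L / n) * L * \<eta> \<le> \<nu> / 4" and \<nu>: "0 < \<nu>"
    and G: "G \<le> 4 * p * a * (2 * L\<^sup>2 * D + 4 * L * (W + \<Delta>)) + 4 * p * \<sigma>\<^sub>1\<^sup>2 + p\<^sup>2 * L\<^sup>2 * dk / 2"
    and D': "D' \<le> (1 - 2 * e1) * D + 2 * e2 * \<eta>\<^sup>2 * G"
    and W': "W' \<le> W - \<nu> * \<eta> * W + \<eta> * L\<^sup>2 * D + \<eta> * L\<^sup>2 * dk + L / 2 * \<eta>\<^sup>2 * (G / n)"
  shows "W' \<le> (1 - 3 / 4 * \<nu> * \<eta>) * W + 2 * \<eta> * L\<^sup>2 * D + \<eta>\<^sup>2 * (p / n) * S'"
    and "D' \<le> (1 - 3 / 2 * e1) * D + \<eta>\<^sup>2 * p * (32 * e2 * a * L * W + 2 * e2 * S)"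
    and "D' + W' \<le> D + W + \<eta>\<^sup>2 * p * (S' + 2 * e2 * S)"
proof -
  have "0 \<le> \<eta> * L\<^sup>2" using \<eta> by simp
  then have e1: "0 \<le> e1" using h1 by linarith
  have a: "1 \<le> a" by (simp add: a_def)
  have S: "0 \<le> S" using L \<Delta> a by (simp add: S_def noise_level_def)
  have pos: "0 < p" "0 < n" "0 < a" using p n a by auto
  have "4 * p * a * (2 * e2 + L) * \<eta> = 8 * p * a * e2 * \<eta> + 4 * p * a * L * \<eta>" by (simp add: algebra_simps)
  moreover have nn: "0 \<le> 8 * p * a * e2 * \<eta>" "0 \<le> 4 * p * a * L * \<eta>" using pos e2 L \<eta> by auto
  ultimately have k1: "8 * p * a * e2 * \<eta> \<le> 1" and k2: "4 * p * a * L * \<eta> \<le> 1"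
    using h2 by linarith+
  have "4 * p * 1 * L * \<eta> \<le> 4 * p * a * L * \<eta>"
    using a pos L \<eta> by (intro mult_right_mono mult_left_mono) auto
  then have k3: "p * \<eta> * L \<le> 1 / 4" using k2 by (simp add: mult_ac)
  have "8 * p * a * (2 * e2 + L / n) * L * \<eta> = 16 * p * a * e2 * L * \<eta> + 8 * p * a * (L / n) * L * \<eta>"
    by (simp add: algebra_simps)
  moreover have "0 \<le> 16 * p * a * e2 * L * \<eta>" "0 \<le> 8 * p * a * (L / n) * L * \<eta>" using pos e2 L \<eta> by auto
  ultimately have k4: "16 * p * a * e2 * L * \<eta> \<le> \<nu> / 4" and k5: "8 * p * a * (L / n) * L * \<eta> \<le> \<nu> / 4"
    using h3 by linarith+
  \<comment> \<open>Two uses of the same fraction: below 1 where the factor \<open>p^2\<close> must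
    shrink to order \<open>p\<close>, and below \<open>p / n\<close> where the bias must match the
    averaged noise.\<close>
  have pn: "p / (n + p) \<le> 1" "p / (n + p) \<le> p / n" using pos by (auto simp: divide_simps)
  have d1: "p\<^sup>2 * L\<^sup>2 * dk / 2 \<le> p * (L * \<kappa>\<^sub>\<delta>\<^sup>2 / 8)"
  proof -
    have "p\<^sup>2 * L\<^sup>2 * dk / 2 = (p * L * \<kappa>\<^sub>\<delta>\<^sup>2 / 2) * ((p * \<eta> * L) * (p / (n + p)))"
      by (simp add: dk_def power2_eq_square mult_ac)
    also have "\<dots> \<le> (p * L * \<kappa>\<^sub>\<delta>\<^sup>2 / 2) * ((1 / 4) * 1)"
      using pos L \<eta> k3 pn(1) by (intro mult_left_mono mult_mono) auto
    finally show ?thesis by simp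
  qed
  have d2: "\<eta> * L\<^sup>2 * dk \<le> \<eta>\<^sup>2 * (p / n) * (L\<^sup>2 * \<kappa>\<^sub>\<delta>\<^sup>2)"
  proof -
    have "\<eta> * L\<^sup>2 * dk = (\<eta>\<^sup>2 * (L\<^sup>2 * \<kappa>\<^sub>\<delta>\<^sup>2)) * (p / (n + p))" by (simp add: dk_def power2_eq_square mult_ac)
    also have "\<dots> \<le> (\<eta>\<^sup>2 * (L\<^sup>2 * \<kappa>\<^sub>\<delta>\<^sup>2)) * (p / n)" by (intro mult_left_mono pn(2)) auto
    finally show ?thesis by (simp add: mult_ac)
  qed
  have "G \<le> 4 * p * a * (2 * L\<^sup>2 * D + 4 * L * (W + \<Delta>)) + 4 * p * \<sigma>\<^sub>1\<^sup>2 + p * (L * \<kappa>\<^sub>\<delta>\<^sup>2 / 8)"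
    using G d1 by linarith
  also have "\<dots> = p * (8 * a * L\<^sup>2 * D + 16 * a * L * W + S)"
    by (simp add: S_def noise_level_def a_def algebra_simps)
  finally have G': "G \<le> p * (8 * a * L\<^sup>2 * D + 16 * a * L * W + S)" .
  \<comment> \<open>The first two summands are bounded by \<open>k2\<close> and \<open>k5\<close>;
    the second spends a quarter of the decrease \<open>\<nu> * \<eta> * W\<close>.\<close>
  have "L / 2 * \<eta>\<^sup>2 * (G / n) \<le> L / 2 * \<eta>\<^sup>2 * (p * (8 * a * L\<^sup>2 * D + 16 * a * L * W + S) / n)"
    using G' pos L by (intro mult_left_mono divide_right_mono) auto
  also have "\<dots> = (4 * p * a * L * \<eta>) * (\<eta> * L\<^sup>2 * (D / n)) + (8 * p * a * (L / n) * L * \<eta>) * (\<eta> * W)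
      + \<eta>\<^sup>2 * (p / n) * (L * S / 2)"
    by (simp add: power2_eq_square algebra_simps add_divide_distrib)
  also have "\<dots> \<le> 1 * (\<eta> * L\<^sup>2 * D) + (\<nu> / 4) * (\<eta> * W) + \<eta>\<^sup>2 * (p / n) * (L * S / 2)"
  proof (intro add_mono order_refl mult_mono k2 k5)
    show "D / n \<le> D" using n D by (simp add: divide_le_eq mult_left_le mult_le_cancel_left1)
  qed (use pos L \<eta> D W \<nu> in auto)
  finally have g1: "L / 2 * \<eta>\<^sup>2 * (G / n) \<le> \<eta> * L\<^sup>2 * D + (\<nu> / 4) * (\<eta> * W) + \<eta>\<^sup>2 * (p / n) * (L * S / 2)" by simp
  have "W' \<le> W - \<nu> * \<eta> * W + \<eta> * L\<^sup>2 * D + \<eta>\<^sup>2 * (p / n) * (L\<^sup>2 * \<kappa>\<^sub>\<delta>\<^sup>2)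
      + (\<eta> * L\<^sup>2 * D + (\<nu> / 4) * (\<eta> * W) + \<eta>\<^sup>2 * (p / n) * (L * S / 2))"
    using W' d2 g1 by linarith
  also have "\<dots> = (1 - 3 / 4 * \<nu> * \<eta>) * W + 2 * \<eta> * L\<^sup>2 * D + \<eta>\<^sup>2 * (p / n) * S'"
    by (simp add: S'_def descent_noise_def S_def algebra_simps)
  finally show w: "W' \<le> (1 - 3 / 4 * \<nu> * \<eta>) * W + 2 * \<eta> * L\<^sup>2 * D + \<eta>\<^sup>2 * (p / n) * S'" .
  \<comment> \<open>\<open>k1\<close> and \<open>h1\<close> charge the disagreement part of
    \<open>G\<close> to the contraction, at a cost of \<open>e1 / 2\<close>.\<close>
  have "2 * e2 * \<eta>\<^sup>2 * G \<le> 2 * e2 * \<eta>\<^sup>2 * (p * (8 * a * L\<^sup>2 * D + 16 * a * L * W + S))"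
    using G' e2 by (intro mult_left_mono) auto
  also have "\<dots> = (8 * p * a * e2 * \<eta>) * (2 * (\<eta> * L\<^sup>2) * D) + \<eta>\<^sup>2 * p * (32 * e2 * a * L * W + 2 * e2 * S)"
    by (simp add: power2_eq_square algebra_simps)
  also have "\<dots> \<le> 1 * (2 * (e1 / 4) * D) + \<eta>\<^sup>2 * p * (32 * e2 * a * L * W + 2 * e2 * S)"
    using h1 \<eta> D e1 by (intro add_right_mono mult_mono k1) auto
  finally show dd: "D' \<le> (1 - 3 / 2 * e1) * D + \<eta>\<^sup>2 * p * (32 * e2 * a * L * W + 2 * e2 * S)"
    using D' by (simp add: algebra_simps)
  \<comment> \<open>In the sum, the influence of the gap on the disagreement costs
    \<open>\<nu> / 2 * \<eta> * W\<close> and the reverse influence \<open>e1 / 2 * D\<close>; the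
    rates leave \<open>\<nu> / 4 * \<eta> * W\<close> and \<open>e1 * D\<close> to spare.\<close>
  have "\<eta>\<^sup>2 * p * (32 * e2 * a * L * W) = 2 * (16 * p * a * e2 * L * \<eta>) * (\<eta> * W)"
    by (simp add: power2_eq_square mult_ac)
  also have "\<dots> \<le> 2 * (\<nu> / 4) * (\<eta> * W)"
    using k4 \<eta> W by (intro mult_right_mono mult_left_mono) auto
  finally have u1: "\<eta>\<^sup>2 * p * (32 * e2 * a * L * W) \<le> 2 * (\<nu> / 4) * (\<eta> * W)" .
  have u2: "2 * (\<eta> * L\<^sup>2) * D \<le> 2 * (e1 / 4) * D" using h1 D by (intro mult_right_mono mult_left_mono) auto
  have S'0: "0 \<le> S'" using S L by (simp add: S'_def descent_noise_def S_def)
  have u3: "\<eta>\<^sup>2 * (p / n) * S' \<le> \<eta>\<^sup>2 * p * S'"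
  proof (intro mult_right_mono mult_left_mono S'0)
    show "p / n \<le> p" using n p by (simp add: divide_le_eq mult_le_cancel_left1)
  qed auto
  have "D' + W' \<le> ((1 - 3 / 2 * e1) * D + \<eta>\<^sup>2 * p * (32 * e2 * a * L * W) + \<eta>\<^sup>2 * p * (2 * e2 * S))
      + ((1 - 3 / 4 * \<nu> * \<eta>) * W + 2 * (\<eta> * L\<^sup>2) * D + \<eta>\<^sup>2 * p * S')"
    using w dd u3 by (simp add: algebra_simps)
  also have "\<dots> \<le> ((1 - 3 / 2 * e1) * D + 2 * (\<nu> / 4) * (\<eta> * W) + \<eta>\<^sup>2 * p * (2 * e2 * S))
      + ((1 - 3 / 4 * \<nu> * \<eta>) * W + 2 * (e1 / 4) * D + \<eta>\<^sup>2 * p * S')"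
    using u1 u2 by linarith
  also have "\<dots> = D + W + \<eta>\<^sup>2 * p * (S' + 2 * e2 * S) - (e1 * D + \<nu> / 4 * (\<eta> * W))"
    by (simp add: algebra_simps)
  also have "\<dots> \<le> D + W + \<eta>\<^sup>2 * p * (S' + 2 * e2 * S)"
  proof -
    have "0 \<le> e1 * D" "0 \<le> \<nu> / 4 * (\<eta> * W)" using e1 D W \<eta> \<nu> by simp_all
    then show ?thesis by linarith
  qed
  finally show "D' + W' \<le> D + W + \<eta>\<^sup>2 * p * (S' + 2 * e2 * S)" .
qed

text \<open>The step size condition bounds the dimension by \<open>t\<close>, so that the constants below may not
  mention \<open>p\<close>.\<close>

definition dim_bound :: "real \<Rightarrow> real \<Rightarrow> real \<Rightarrow> real \<Rightarrow> real \<Rightarrow> real" where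
  "dim_bound L \<sigma>\<^sub>0 \<kappa> e2 t = t / (4 * \<kappa> * (1 + \<sigma>\<^sub>0\<^sup>2) * (2 * e2 + L))"

text \<open>Initial sum plus telescoped noise, with the dimension replaced by its bound.\<close>

definition lyapunov_bound ::
  "real \<Rightarrow> real \<Rightarrow> real \<Rightarrow> real \<Rightarrow> real \<Rightarrow> real \<Rightarrow> real \<Rightarrow> real \<Rightarrow> real \<Rightarrow> real \<Rightarrow> real" where
  "lyapunov_bound L \<sigma>\<^sub>0 \<sigma>\<^sub>1 \<kappa>\<^sub>\<delta> \<Delta> \<kappa> D0 W0 e2 t = D0 + W0 + \<kappa>\<^sup>2 * dim_bound L \<sigma>\<^sub>0 \<kappa> e2 t *
     (descent_noise L \<sigma>\<^sub>0 \<sigma>\<^sub>1 \<kappa>\<^sub>\<delta> \<Delta> + 2 * e2 * noise_level L \<sigma>\<^sub>0 \<sigma>\<^sub>1 \<kappa>\<^sub>\<delta> \<Delta>) / (t - 1)"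

text \<open>The numerator over \<open>(k + t)^2\<close> of the forcing term in the disagreement
  recursion, once the gap is replaced by its uniform bound.\<close>

definition consensus_noise ::
  "real \<Rightarrow> real \<Rightarrow> real \<Rightarrow> real \<Rightarrow> real \<Rightarrow> real \<Rightarrow> real \<Rightarrow> real \<Rightarrow> real \<Rightarrow> real \<Rightarrow> real" where
  "consensus_noise L \<sigma>\<^sub>0 \<sigma>\<^sub>1 \<kappa>\<^sub>\<delta> \<Delta> \<kappa> D0 W0 e2 t = \<kappa>\<^sup>2 * dim_bound L \<sigma>\<^sub>0 \<kappa> e2 t *
     (32 * e2 * (1 + \<sigma>\<^sub>0\<^sup>2) * L * lyapunov_bound L \<sigma>\<^sub>0 \<sigma>\<^sub>1 \<kappa>\<^sub>\<delta> \<Delta> \<kappa> D0 W0 e2 t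
      + 2 * e2 * noise_level L \<sigma>\<^sub>0 \<sigma>\<^sub>1 \<kappa>\<^sub>\<delta> \<Delta>)"

text \<open>The constant that \<open>inverse_square_decay\<close> asks for: the sum of its two
  nonnegative lower bounds satisfies both.\<close>

definition consensus_const ::
  "real \<Rightarrow> real \<Rightarrow> real \<Rightarrow> real \<Rightarrow> real \<Rightarrow> real \<Rightarrow> real \<Rightarrow> real \<Rightarrow> real \<Rightarrow> real \<Rightarrow> real \<Rightarrow> real" where
  "consensus_const L \<sigma>\<^sub>0 \<sigma>\<^sub>1 \<kappa>\<^sub>\<delta> \<Delta> \<kappa> D0 W0 e1 e2 t = (let e = 3 / 2 * e1; t' = t + 4 / e in
     D0 * t'\<^sup>2 + 2 * consensus_noise L \<sigma>\<^sub>0 \<sigma>\<^sub>1 \<kappa>\<^sub>\<delta> \<Delta> \<kappa> D0 W0 e2 t * (t' / t)\<^sup>2 / e)"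

text \<open>\<open>t1\<close> to \<open>t4\<close> are the lower bound \<open>d2_check\<close> on
  the offset, cleared of denominators, with one inequality for each quantity inside its maximum and
  minimum.\<close>

lemma convergence_rates:
  fixes n p L \<sigma>\<^sub>0 \<sigma>\<^sub>1 \<nu> \<kappa>\<^sub>\<delta> \<Delta> \<kappa> e1 e2 t :: real and G W D :: "nat \<Rightarrow> real"
  defines "a \<equiv> 1 + \<sigma>\<^sub>0\<^sup>2" and "\<eta> \<equiv> \<lambda>k. \<kappa> / (real k + t)"
    and "C\<^sub>3 \<equiv> consensus_const L \<sigma>\<^sub>0 \<sigma>\<^sub>1 \<kappa>\<^sub>\<delta> \<Delta> \<kappa> (D 0) (W 0) e1 e2 t"
  assumes n: "1 \<le> n" and p: "1 \<le> p" and L: "0 < L" and \<nu>: "0 < \<nu>" and \<Delta>: "0 \<le> \<Delta>"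
    and e1: "0 < e1" "e1 \<le> 1 / 3" and e2: "0 \<le> e2" and \<kappa>: "8 / \<nu> < \<kappa>"
    and t1: "1 / e1 < t" and t2: "\<kappa> * (4 * L\<^sup>2) \<le> e1 * t"
    and t3: "\<kappa> * (4 * p * a * (2 * e2 + L)) \<le> t"
    and t4: "4 * \<kappa> * (8 * p * a * (2 * e2 + L / n) * L) \<le> \<nu> * t"
    and W: "\<And>k. 0 \<le> W k" and D: "\<And>k. 0 \<le> D k"
    and G: "\<And>k. G k \<le> 4 * p * a * (2 * L\<^sup>2 * D k + 4 * L * (W k + \<Delta>)) + 4 * p * \<sigma>\<^sub>1\<^sup>2
      + p\<^sup>2 * L\<^sup>2 * (\<kappa>\<^sub>\<delta>\<^sup>2 * (p * \<eta> k) / (n + p)) / 2"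
    and D': "\<And>k. D (Suc k) \<le> (1 - 2 * e1) * D k + 2 * e2 * (\<eta> k)\<^sup>2 * G k"
    and W': "\<And>k. W (Suc k) \<le> W k - \<nu> * \<eta> k * W k + \<eta> k * L\<^sup>2 * D k
      + \<eta> k * L\<^sup>2 * (\<kappa>\<^sub>\<delta>\<^sup>2 * (p * \<eta> k) / (n + p)) + L / 2 * (\<eta> k)\<^sup>2 * (G k / n)"
    and T: "1 \<le> T"
  shows "D T \<le> C\<^sub>3 * p / (real T)\<^sup>2"
    and "W T \<le> \<kappa>\<^sup>2 * descent_noise L \<sigma>\<^sub>0 \<sigma>\<^sub>1 \<kappa>\<^sub>\<delta> \<Delta> * p / (n * real T)
      + (W 0 * t\<^sup>2 + 2 * \<kappa> * L\<^sup>2 * C\<^sub>3) * p / (real T)\<^sup>2"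
proof -
  define S where "S = noise_level L \<sigma>\<^sub>0 \<sigma>\<^sub>1 \<kappa>\<^sub>\<delta> \<Delta>"
  define S' where "S' = descent_noise L \<sigma>\<^sub>0 \<sigma>\<^sub>1 \<kappa>\<^sub>\<delta> \<Delta>"
  define P where "P = dim_bound L \<sigma>\<^sub>0 \<kappa> e2 t"
  define B where "B = lyapunov_bound L \<sigma>\<^sub>0 \<sigma>\<^sub>1 \<kappa>\<^sub>\<delta> \<Delta> \<kappa> (D 0) (W 0) e2 t"
  define c where "c = consensus_noise L \<sigma>\<^sub>0 \<sigma>\<^sub>1 \<kappa>\<^sub>\<delta> \<Delta> \<kappa> (D 0) (W 0) e2 t"
  define e where "e = 3 / 2 * e1"
  define t' where "t' = t + 4 / e"
  \<comment> \<open>This makes the factor \<open>1 - 3 / (k + t)\<close> in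
    \<open>inverse_decay\<close> nonnegative from the start.\<close>
  have "3 \<le> 1 / e1" using e1 by (simp add: pos_le_divide_eq)
  then have t: "3 < t" using t1 by linarith
  have "0 < 8 / \<nu>" using \<nu> by simp
  then have \<kappa>0: "0 < \<kappa>" using \<kappa> by linarith
  have a: "1 \<le> a" by (simp add: a_def)
  have S: "0 \<le> S" using L \<Delta> by (simp add: S_def noise_level_def)
  have S'0: "0 \<le> S'" using S L by (simp add: S'_def descent_noise_def S_def)
  have den: "0 < 4 * \<kappa> * a * (2 * e2 + L)" using \<kappa>0 a e2 L by (intro mult_pos_pos) auto
  have P: "p \<le> P"
    using t3 den by (simp add: P_def dim_bound_def a_def[symmetric] pos_le_divide_eq mult_ac)
  have P0: "0 \<le> P" using P p by simp
  have B0: "0 \<le> B"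
    using D[of 0] W[of 0] P0 S S'0 e2 t
    by (auto simp: B_def lyapunov_bound_def P_def[symmetric] S_def[symmetric] S'_def[symmetric]
        intro!: add_nonneg_nonneg divide_nonneg_nonneg mult_nonneg_nonneg)
  have c0: "0 \<le> c"
    using P0 S e2 L a B0
    by (auto simp: c_def consensus_noise_def P_def[symmetric] S_def[symmetric] B_def[symmetric] a_def
        intro!: add_nonneg_nonneg mult_nonneg_nonneg)
  have \<eta>0: "0 < \<eta> k" for k using \<kappa>0 t by (simp add: \<eta>_def add_nonneg_pos)
  \<comment> \<open>\<open>\<eta>\<close> is largest at \<open>k = 0\<close>, so the conditions on
    \<open>t\<close> carry over to every step.\<close>
  have \<eta>le: "\<eta> k * b \<le> q" if "\<kappa> * b \<le> q * t" "0 \<le> q" for k b q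
  proof -
    have "\<kappa> * b \<le> q * (real k + t)"
      using that by (simp add: algebra_simps) (smt (verit) mult_nonneg_nonneg of_nat_0_le_iff)
    moreover have "0 < real k + t" using t by (simp add: add_nonneg_pos)
    ultimately have "(\<kappa> * b) / (real k + t) \<le> q" by (simp add: pos_divide_le_eq)
    then show ?thesis by (simp add: \<eta>_def)
  qed
  have h1: "\<eta> k * L\<^sup>2 \<le> e1 / 4" for k using \<eta>le[of "L\<^sup>2" "e1 / 4" k] t2 e1 by simp
  have h2: "4 * p * a * (2 * e2 + L) * \<eta> k \<le> 1" for k
    using \<eta>le[of "4 * p * a * (2 * e2 + L)" 1 k] t3 by (simp add: mult_ac)
  have h3: "8 * p * a * (2 * e2 + L / n) * L * \<eta> k \<le> \<nu> / 4" for k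
    using \<eta>le[of "8 * p * a * (2 * e2 + L / n) * L" "\<nu> / 4" k] t4 \<nu> by (simp add: mult_ac)
  note step = one_step[OF n p L e2 \<eta>0 \<Delta> W D h1 h2[unfolded a_def] h3[unfolded a_def] \<nu> G[unfolded a_def] D' W',
      folded S_def S'_def]
  have \<eta>sq: "(\<eta> k)\<^sup>2 = \<kappa>\<^sup>2 / (real k + t)\<^sup>2" for k by (simp add: \<eta>_def power_divide)
  have U: "D k + W k \<le> B" for k
  proof -
    have "D k + W k \<le> D 0 + W 0 + \<kappa>\<^sup>2 * P * (S' + 2 * e2 * S) / (t - 1)"
    proof (rule summed_squares_bound[of "\<lambda>k. D k + W k"])
      fix k
      \<comment> \<open>The sharp \<open>p\<close> is given up for its network-dependent bound. This
        is harmless because the result enters only terms of order \<open>1 / T^2\<close>.\<close>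
      have "(\<eta> k)\<^sup>2 * p * (S' + 2 * e2 * S) \<le> (\<eta> k)\<^sup>2 * P * (S' + 2 * e2 * S)"
        using P S S'0 e2 by (intro mult_right_mono mult_left_mono) auto
      also have "\<dots> = \<kappa>\<^sup>2 * P * (S' + 2 * e2 * S) / (real k + t)\<^sup>2" by (simp add: \<eta>sq)
      finally show "D (Suc k) + W (Suc k) \<le> D k + W k + \<kappa>\<^sup>2 * P * (S' + 2 * e2 * S) / (real k + t)\<^sup>2"
        using step(3)[of k] by linarith
    qed (use t P0 S S'0 e2 in auto)
    then show ?thesis by (simp add: B_def lyapunov_bound_def P_def S_def S'_def)
  qed
  have e: "0 < e" "e \<le> 1" using e1 by (auto simp: e_def)
  have t': "t \<le> t'" using e by (simp add: t'_def)
  have C3: "C\<^sub>3 = D 0 * t'\<^sup>2 + 2 * c * (t' / t)\<^sup>2 / e"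
    by (simp add: C\<^sub>3_def consensus_const_def Let_def c_def t'_def e_def)
  have C30: "0 \<le> C\<^sub>3" using D[of 0] c0 e by (auto simp: C3)
  have Dk: "D k \<le> C\<^sub>3 / (real k + t')\<^sup>2" for k
    unfolding t'_def
  proof (rule inverse_square_decay[where c = c])
    fix k
    have "(\<eta> k)\<^sup>2 * p * (32 * e2 * a * L * W k + 2 * e2 * S) \<le> (\<eta> k)\<^sup>2 * P * (32 * e2 * a * L * B + 2 * e2 * S)"
    proof (intro mult_mono add_mono order_refl P)
      show "W k \<le> B" using U[of k] D[of k] by linarith
    qed (use P0 p e2 a L S W in auto)
    also have "\<dots> = c / (real k + t)\<^sup>2"
      by (simp add: \<eta>sq c_def consensus_noise_def P_def B_def S_def a_def)
    finally show "D (Suc k) \<le> (1 - e) * D k + c / (real k + t)\<^sup>2"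
      using step(2)[of k] by (simp add: e_def a_def)
  qed (use e t c0 D[of 0] in \<open>auto simp: C3 t'_def\<close>)
  have T0: "0 < real T" using T by simp
  have tp: "0 < t'" using t t' by simp
  have "D T \<le> C\<^sub>3 / (real T)\<^sup>2"
  proof (rule order_trans[OF Dk])
    show "C\<^sub>3 / (real T + t')\<^sup>2 \<le> C\<^sub>3 / (real T)\<^sup>2"
      using C30 T0 tp by (intro divide_left_mono power_mono mult_pos_pos) auto
  qed
  \<comment> \<open>The decay constant is already free of \<open>p\<close>; the factor is supplied
    by \<open>1 \<le> p\<close>.\<close>
  also have "\<dots> \<le> C\<^sub>3 * p / (real T)\<^sup>2"
    using C30 p by (intro divide_right_mono) (auto simp: mult_le_cancel_left1)
  finally show "D T \<le> C\<^sub>3 * p / (real T)\<^sup>2" .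
  \<comment> \<open>Here \<open>p / n\<close> stays explicit, and the disagreement, of order
    \<open>\<eta>^2\<close>, contributes the cubic term with constant
    \<open>2 * \<kappa> * L\<^sup>2 * C\<^sub>3\<close>.\<close>
  have W_rate: "W k \<le> \<kappa>\<^sup>2 * (p / n) * S' / (real k + t) + (W 0 * t\<^sup>2 + 2 * \<kappa> * L\<^sup>2 * C\<^sub>3) / (real k + t)\<^sup>2" for k
  proof (rule inverse_decay)
    fix k
    define s where "s = real k + t"
    have s: "0 < s" using t by (simp add: s_def add_nonneg_pos)
    \<comment> \<open>The remaining rate is at least \<open>3 / 4 * 8 = 6\<close>, well above the 3
      that \<open>inverse_decay\<close> uses.\<close>
    have "8 < \<nu> * \<kappa>" using \<kappa> \<nu> by (simp add: pos_divide_less_eq mult.commute)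
    then have "3 \<le> 3 / 4 * (\<nu> * \<kappa>)" by linarith
    then have "3 / s \<le> 3 / 4 * (\<nu> * \<kappa>) / s" using s by (intro divide_right_mono) auto
    then have "3 / s \<le> 3 / 4 * \<nu> * \<eta> k" by (simp add: \<eta>_def s_def)
    then have w1: "(1 - 3 / 4 * \<nu> * \<eta> k) * W k \<le> (1 - 3 / s) * W k" using W by (intro mult_right_mono) auto
    have "D k \<le> C\<^sub>3 / s\<^sup>2"
    proof (rule order_trans[OF Dk])
      show "C\<^sub>3 / (real k + t')\<^sup>2 \<le> C\<^sub>3 / s\<^sup>2"
        using C30 s t' tp by (intro divide_left_mono power_mono mult_pos_pos) (auto simp: s_def)
    qed
    then have "2 * \<eta> k * L\<^sup>2 * D k \<le> 2 * \<eta> k * L\<^sup>2 * (C\<^sub>3 / s\<^sup>2)"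
      using \<eta>0[of k] by (intro mult_left_mono) auto
    also have "\<dots> = 2 * \<kappa> * L\<^sup>2 * C\<^sub>3 / s ^ 3" by (simp add: \<eta>_def s_def power2_eq_square power3_eq_cube)
    finally have w2: "2 * \<eta> k * L\<^sup>2 * D k \<le> 2 * \<kappa> * L\<^sup>2 * C\<^sub>3 / s ^ 3" .
    have w3: "(\<eta> k)\<^sup>2 * (p / n) * S' = \<kappa>\<^sup>2 * (p / n) * S' / s\<^sup>2" by (simp add: \<eta>sq s_def)
    show "W (Suc k) \<le> (1 - 3 / (real k + t)) * W k + \<kappa>\<^sup>2 * (p / n) * S' / (real k + t)\<^sup>2
        + 2 * \<kappa> * L\<^sup>2 * C\<^sub>3 / (real k + t) ^ 3"
      using step(1)[of k] w1 w2 w3 unfolding s_def by linarith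
  qed (use t S'0 n p \<kappa>0 C30 W in auto)
  have b0: "0 \<le> W 0 * t\<^sup>2 + 2 * \<kappa> * L\<^sup>2 * C\<^sub>3" using W[of 0] C30 \<kappa>0 by simp
  have "W T \<le> \<kappa>\<^sup>2 * (p / n) * S' / real T + (W 0 * t\<^sup>2 + 2 * \<kappa> * L\<^sup>2 * C\<^sub>3) / (real T)\<^sup>2"
  proof (rule order_trans[OF W_rate], rule add_mono)
    show "\<kappa>\<^sup>2 * (p / n) * S' / (real T + t) \<le> \<kappa>\<^sup>2 * (p / n) * S' / real T"
      using S'0 n p T0 t by (intro divide_left_mono mult_pos_pos) auto
    show "(W 0 * t\<^sup>2 + 2 * \<kappa> * L\<^sup>2 * C\<^sub>3) / (real T + t)\<^sup>2 \<le> (W 0 * t\<^sup>2 + 2 * \<kappa> * L\<^sup>2 * C\<^sub>3) / (real T)\<^sup>2"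
      using b0 T0 t by (intro divide_left_mono power_mono mult_pos_pos) auto
  qed
  also have "\<dots> \<le> \<kappa>\<^sup>2 * S' * p / (n * real T) + (W 0 * t\<^sup>2 + 2 * \<kappa> * L\<^sup>2 * C\<^sub>3) * p / (real T)\<^sup>2"
  proof (rule add_mono)
    show "(W 0 * t\<^sup>2 + 2 * \<kappa> * L\<^sup>2 * C\<^sub>3) / (real T)\<^sup>2 \<le> (W 0 * t\<^sup>2 + 2 * \<kappa> * L\<^sup>2 * C\<^sub>3) * p / (real T)\<^sup>2"
      using b0 p by (intro divide_right_mono) (auto simp: mult_le_cancel_left1)
  qed (simp add: mult_ac)
  finally show "W T \<le> \<kappa>\<^sup>2 * descent_noise L \<sigma>\<^sub>0 \<sigma>\<^sub>1 \<kappa>\<^sub>\<delta> \<Delta> * p / (n * real T)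
      + (W 0 * t\<^sup>2 + 2 * \<kappa> * L\<^sup>2 * C\<^sub>3) * p / (real T)\<^sup>2" by (simp add: S'_def)
qed

section \<open>The convergence theorem\<close>

lemma (in algorithm) rates:
  fixes \<kappa>\<^sub>\<eta> \<kappa>\<^sub>\<delta> t :: real
  defines "C \<equiv> consensus_const L\<^sub>f \<sigma>\<^sub>0 \<sigma>\<^sub>1 \<kappa>\<^sub>\<delta> (f_min - mean_min) \<kappa>\<^sub>\<eta> (disagreement n p x0) (f (avg n p x0) - f_min)
    (eps1 L \<gamma>) (eps2 L \<gamma>) t"
  assumes \<eta>: "\<And>k. \<eta> k = \<kappa>\<^sub>\<eta> / (real k + t)" and \<kappa>: "8 / \<nu> < \<kappa>\<^sub>\<eta>"
    and t: "d2_check n p L L\<^sub>f \<sigma>\<^sub>0 \<nu> \<kappa>\<^sub>\<eta> \<gamma> < t"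
    and \<delta>: "\<And>i k. i < n \<Longrightarrow> \<delta> i k \<le> \<kappa>\<^sub>\<delta> * sqrt (real p * \<eta> k) / sqrt (real (n + p))"
    and T: "1 \<le> T"
  shows "DD T \<le> C * p / real T ^ 2"
    and "WW T \<le> \<kappa>\<^sub>\<eta>\<^sup>2 * descent_noise L\<^sub>f \<sigma>\<^sub>0 \<sigma>\<^sub>1 \<kappa>\<^sub>\<delta> (f_min - mean_min) * p / (real n * real T)
      + ((f (avg n p x0) - f_min) * t\<^sup>2 + 2 * \<kappa>\<^sub>\<eta> * L\<^sub>f\<^sup>2 * C) * p / real T ^ 2"
proof -
  define e1 where "e1 = eps1 L \<gamma>"
  define e2 where "e2 = eps2 L \<gamma>"
  define a where "a = 1 + \<sigma>\<^sub>0\<^sup>2"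
  have e1: "0 < e1" "e1 \<le> 1 / 3"
    unfolding e1_def by (rule net.eps1_pos[OF \<gamma>_pos \<gamma>_less], rule net.eps1_le[OF \<gamma>_pos \<gamma>_less])
  have e2: "0 \<le> e2" unfolding e2_def by (rule eps2_nonneg)
  have a: "1 \<le> a" by (simp add: a_def)
  have "0 < 8 / \<nu>" using \<nu>_pos by simp
  then have \<kappa>0: "0 < \<kappa>\<^sub>\<eta>" using \<kappa> by linarith
  have pos: "0 < L\<^sub>f" "1 \<le> real n" "1 \<le> real p" using L\<^sub>f_pos n_ge_1 p_ge_1 by auto
  define q where "q = 4 * p * a * (2 * e2 + L\<^sub>f)"
  have q: "0 < q" using pos a e2 by (auto simp: q_def intro!: mult_pos_pos add_nonneg_pos)
  have t1: "1 / e1 < t" and t23: "\<kappa>\<^sub>\<eta> / d2_tilde p L L\<^sub>f \<sigma>\<^sub>0 \<gamma> < t"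
    and t4: "4 * \<kappa>\<^sub>\<eta> * eps10 n p L L\<^sub>f \<sigma>\<^sub>0 \<gamma> / \<nu> < t"
    using t by (simp_all add: d2_check_def e1_def)
  have "0 < 1 / e1" using e1 by simp
  then have t0: "0 < t" using t1 by linarith
  have tilde: "d2_tilde p L L\<^sub>f \<sigma>\<^sub>0 \<gamma> = min (e1 / (4 * L\<^sub>f\<^sup>2)) (1 / q)"
    by (simp add: d2_tilde_def e1_def e2_def a_def q_def)
  have tilde0: "0 < d2_tilde p L L\<^sub>f \<sigma>\<^sub>0 \<gamma>" unfolding tilde using e1 pos q by simp
  have kt: "\<kappa>\<^sub>\<eta> \<le> t * d2_tilde p L L\<^sub>f \<sigma>\<^sub>0 \<gamma>" using t23 tilde0 by (simp add: pos_divide_less_eq)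
  \<comment> \<open>The minimum in \<open>d2_tilde\<close> yields one inequality for each of its
    arguments: \<open>t2\<close> from the first, \<open>t3\<close> from the second.\<close>
  have "t * d2_tilde p L L\<^sub>f \<sigma>\<^sub>0 \<gamma> \<le> t * (e1 / (4 * L\<^sub>f\<^sup>2))" unfolding tilde using t0 by (intro mult_left_mono) auto
  then have "\<kappa>\<^sub>\<eta> \<le> e1 * t / (4 * L\<^sub>f\<^sup>2)" using kt by (simp add: mult.commute)
  then have t2: "\<kappa>\<^sub>\<eta> * (4 * L\<^sub>f\<^sup>2) \<le> e1 * t" using pos by (simp add: pos_le_divide_eq)
  have "t * d2_tilde p L L\<^sub>f \<sigma>\<^sub>0 \<gamma> \<le> t * (1 / q)" using t0 by (intro mult_left_mono) (auto simp: tilde)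
  then have "\<kappa>\<^sub>\<eta> \<le> t / q" using kt by simp
  then have t3: "\<kappa>\<^sub>\<eta> * (4 * real p * (1 + \<sigma>\<^sub>0\<^sup>2) * (2 * e2 + L\<^sub>f)) \<le> t"
    using q by (simp add: pos_le_divide_eq q_def a_def)
  have t4': "4 * \<kappa>\<^sub>\<eta> * (8 * real p * (1 + \<sigma>\<^sub>0\<^sup>2) * (2 * e2 + L\<^sub>f / real n) * L\<^sub>f) \<le> \<nu> * t"
    using t4 \<nu>_pos by (simp add: pos_divide_less_eq eps10_def e2_def mult_ac)
  have \<eta>0: "0 < \<eta> k" for k using \<kappa>0 t0 by (simp add: \<eta> add_nonneg_pos)
  have dk: "(\<delta> i k)\<^sup>2 \<le> \<kappa>\<^sub>\<delta>\<^sup>2 * (real p * \<eta> k) / (real n + real p)" if i: "i < n" for i k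
  proof -
    have "(\<delta> i k)\<^sup>2 \<le> (\<kappa>\<^sub>\<delta> * sqrt (real p * \<eta> k) / sqrt (real (n + p)))\<^sup>2"
      using \<delta>[OF i, of k] less_imp_le[OF \<delta>_pos[OF i, of k]] by (rule power_mono)
    also have "\<dots> = \<kappa>\<^sub>\<delta>\<^sup>2 * (real p * \<eta> k) / (real n + real p)"
      using less_imp_le[OF \<eta>0[of k]] by (simp add: power_divide power_mult_distrib)
    finally show ?thesis .
  qed
  have D0: "DD 0 = disagreement n p x0" and W0: "WW 0 = f (avg n p x0) - f_min"
    using M.prob_space by (simp_all add: X_0)
  have \<Delta>: "0 \<le> f_min - mean_min" using mean_min_le by simp
  have G: "GG k \<le> 4 * real p * (1 + \<sigma>\<^sub>0\<^sup>2) * (2 * L\<^sub>f\<^sup>2 * DD k + 4 * L\<^sub>f * (WW k + (f_min - mean_min)))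
      + 4 * real p * \<sigma>\<^sub>1\<^sup>2 + (real p)\<^sup>2 * L\<^sub>f\<^sup>2 * (\<kappa>\<^sub>\<delta>\<^sup>2 * (real p * (\<kappa>\<^sub>\<eta> / (real k + t))) / (real n + real p)) / 2" for k
    using GG_bound[OF dk, of k] by (simp add: \<eta>)
  have D': "DD (Suc k) \<le> (1 - 2 * e1) * DD k + 2 * e2 * (\<kappa>\<^sub>\<eta> / (real k + t))\<^sup>2 * GG k" for k
    using DD_recursion[of k] unfolding \<eta> e1_def e2_def .
  have W': "WW (Suc k) \<le> WW k - \<nu> * (\<kappa>\<^sub>\<eta> / (real k + t)) * WW k + \<kappa>\<^sub>\<eta> / (real k + t) * L\<^sub>f\<^sup>2 * DD k
      + \<kappa>\<^sub>\<eta> / (real k + t) * L\<^sub>f\<^sup>2 * (\<kappa>\<^sub>\<delta>\<^sup>2 * (real p * (\<kappa>\<^sub>\<eta> / (real k + t))) / (real n + real p))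
      + L\<^sub>f / 2 * (\<kappa>\<^sub>\<eta> / (real k + t))\<^sup>2 * (GG k / real n)" for k
    using WW_recursion[OF dk, of k] unfolding \<eta> .
  note r = convergence_rates[where D = "\<lambda>k. DD k" and W = "\<lambda>k. WW k" and G = "\<lambda>k. GG k",
      OF pos(2,3,1) \<nu>_pos \<Delta> e1 e2 \<kappa> t1 t2 t3 t4' WW_nonneg DD_nonneg G D' W' T,
      unfolded D0 W0 e1_def e2_def, folded C_def]
  show "DD T \<le> C * p / real T ^ 2" by (rule r(1))
  show "WW T \<le> \<kappa>\<^sub>\<eta>\<^sup>2 * descent_noise L\<^sub>f \<sigma>\<^sub>0 \<sigma>\<^sub>1 \<kappa>\<^sub>\<delta> (f_min - mean_min) * p / (real n * real T)
      + ((f (avg n p x0) - f_min) * t\<^sup>2 + 2 * \<kappa>\<^sub>\<eta> * L\<^sub>f\<^sup>2 * C) * p / real T ^ 2" by (rule r(2))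
qed

theorem theorem11:
  shows "\<exists>C\<^sub>1 C\<^sub>2 C\<^sub>3. \<forall>(n::nat) (p::nat) E A (D :: nat \<Rightarrow> 'b measure) F L\<^sub>f \<sigma>\<^sub>0 \<sigma>\<^sub>1 \<nu> \<gamma>
      \<kappa>\<^sub>\<eta> \<kappa>\<^sub>\<delta> d\<^sub>3 t\<^sub>1 \<eta> \<delta> x0 (M :: 'w measure) u \<xi>.
    let L = laplacian n A;
        f = global_obj n D F;
        x = (\<lambda>k \<omega>. zo_primal n p L F \<gamma> \<eta> \<delta> x0 (\<lambda>i k. u i k \<omega>) (\<lambda>i k. \<xi> i k \<omega>) k);
        problem = (L\<^sub>f, \<sigma>\<^sub>0, \<sigma>\<^sub>1, \<nu>, \<kappa>\<^sub>\<eta>, \<kappa>\<^sub>\<delta>, d\<^sub>3,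
          min_value p f, (\<Sum>i<n. min_value p (local_obj D F i)) / real n,
          f (avg n p x0), disagreement n p x0);
        network = (n, A, \<gamma>, t\<^sub>1)
    in
      1 \<le> n \<and> 1 \<le> p \<and>
      weighted_graph n E A \<and> connected_graph n E \<and>
      stochastic_functions n p D F \<and>
      minimizers p f \<noteq> {} \<and> bdd_below (f ` carrier_vec p) \<and>
      L\<^sub>f > 0 \<and> (\<forall>i<n. AE z in D i. smooth_with p L\<^sub>f (\<lambda>y. F i y z)) \<and>
      gradient_variance_bound n p D F \<sigma>\<^sub>0 \<sigma>\<^sub>1 \<and>
      \<nu> > 0 \<and> polyak_lojasiewicz p \<nu> f \<and>
      (\<forall>i<n. bdd_below (local_obj D F i ` carrier_vec p)) \<and>
      (\<forall>i<n. x0 i \<in> carrier_vec p) \<and>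
      independent_draws M n p D u \<xi> \<and>
      0 < \<gamma> \<and> \<gamma> < d1 L \<and>
      \<kappa>\<^sub>\<delta> > 0 \<and> d\<^sub>3 > 1 \<and> 8 / \<nu> < \<kappa>\<^sub>\<eta> \<and> \<kappa>\<^sub>\<eta> \<le> 8 * d\<^sub>3 / \<nu> \<and>
      t\<^sub>1 > d2_check n p L L\<^sub>f \<sigma>\<^sub>0 \<nu> \<kappa>\<^sub>\<eta> \<gamma> \<and>
      (\<forall>k. \<eta> k = \<kappa>\<^sub>\<eta> / (real k + t\<^sub>1)) \<and>
      (\<forall>i<n. \<forall>k. 0 < \<delta> i k \<and> \<delta> i k \<le> \<kappa>\<^sub>\<delta> * sqrt (real p * \<eta> k) / sqrt (real (n + p)))
      \<longrightarrow>
      (\<forall>T\<ge>1.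
        integrable M (\<lambda>\<omega>. disagreement n p (x T \<omega>)) \<and>
        (\<integral>\<omega>. disagreement n p (x T \<omega>) \<partial>M) \<le> C\<^sub>3 problem network * real p / real T ^ 2 \<and>
        integrable M (\<lambda>\<omega>. f (avg n p (x T \<omega>)) - min_value p f) \<and>
        (\<integral>\<omega>. (f (avg n p (x T \<omega>)) - min_value p f) \<partial>M)
          \<le> C\<^sub>1 problem * real p / (real n * real T) + C\<^sub>2 problem network * real p / real T ^ 2)"
proof -
  define C\<^sub>1 :: "real \<times> real \<times> real \<times> real \<times> real \<times> real \<times> real \<times> real \<times> real \<times> real \<times> real \<Rightarrow> real"
    where "C\<^sub>1 = (\<lambda>(L\<^sub>f, \<sigma>\<^sub>0, \<sigma>\<^sub>1, \<nu>, \<kappa>\<^sub>\<eta>, \<kappa>\<^sub>\<delta>, d\<^sub>3, fm, mm, f0, D0).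
      \<kappa>\<^sub>\<eta>\<^sup>2 * descent_noise L\<^sub>f \<sigma>\<^sub>0 \<sigma>\<^sub>1 \<kappa>\<^sub>\<delta> (fm - mm))"
  define C\<^sub>3 :: "real \<times> real \<times> real \<times> real \<times> real \<times> real \<times> real \<times> real \<times> real \<times> real \<times> real \<Rightarrow>
      nat \<times> real mat \<times> real \<times> real \<Rightarrow> real"
    where "C\<^sub>3 = (\<lambda>(L\<^sub>f, \<sigma>\<^sub>0, \<sigma>\<^sub>1, \<nu>, \<kappa>\<^sub>\<eta>, \<kappa>\<^sub>\<delta>, d\<^sub>3, fm, mm, f0, D0) (n, A, \<gamma>, t).
      consensus_const L\<^sub>f \<sigma>\<^sub>0 \<sigma>\<^sub>1 \<kappa>\<^sub>\<delta> (fm - mm) \<kappa>\<^sub>\<eta> D0 (f0 - fm) (eps1 (laplacian n A) \<gamma>) (eps2 (laplacian n A) \<gamma>) t)"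
  define C\<^sub>2 :: "real \<times> real \<times> real \<times> real \<times> real \<times> real \<times> real \<times> real \<times> real \<times> real \<times> real \<Rightarrow>
      nat \<times> real mat \<times> real \<times> real \<Rightarrow> real"
    where "C\<^sub>2 = (\<lambda>(L\<^sub>f, \<sigma>\<^sub>0, \<sigma>\<^sub>1, \<nu>, \<kappa>\<^sub>\<eta>, \<kappa>\<^sub>\<delta>, d\<^sub>3, fm, mm, f0, D0) (n, A, \<gamma>, t).
      (f0 - fm) * t\<^sup>2 + 2 * \<kappa>\<^sub>\<eta> * L\<^sub>f\<^sup>2 * C\<^sub>3 (L\<^sub>f, \<sigma>\<^sub>0, \<sigma>\<^sub>1, \<nu>, \<kappa>\<^sub>\<eta>, \<kappa>\<^sub>\<delta>, d\<^sub>3, fm, mm, f0, D0) (n, A, \<gamma>, t))"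
  show ?thesis
    unfolding Let_def
  proof (rule exI[of _ C\<^sub>1], rule exI[of _ C\<^sub>2], rule exI[of _ C\<^sub>3], intro allI impI, elim conjE)
    fix n p :: nat and E and A :: "real mat" and D :: "nat \<Rightarrow> 'b measure" and F :: "nat \<Rightarrow> real vec \<Rightarrow> 'b \<Rightarrow> real"
      and L\<^sub>f \<sigma>\<^sub>0 \<sigma>\<^sub>1 \<nu> \<gamma> \<kappa>\<^sub>\<eta> \<kappa>\<^sub>\<delta> d\<^sub>3 t\<^sub>1 :: real and \<eta> :: "nat \<Rightarrow> real" and \<delta> :: "nat \<Rightarrow> nat \<Rightarrow> real"
      and x0 :: "nat \<Rightarrow> real vec" and M :: "'w measure" and u :: "nat \<Rightarrow> nat \<Rightarrow> 'w \<Rightarrow> real vec"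
      and \<xi> :: "nat \<Rightarrow> nat \<Rightarrow> 'w \<Rightarrow> 'b" and T :: nat
    assume h: "1 \<le> n" "1 \<le> p" "weighted_graph n E A" "connected_graph n E" "stochastic_functions n p D F"
      "minimizers p (global_obj n D F) \<noteq> {}" "0 < L\<^sub>f"
      "\<forall>i<n. AE z in D i. smooth_with p L\<^sub>f (\<lambda>y. F i y z)" "gradient_variance_bound n p D F \<sigma>\<^sub>0 \<sigma>\<^sub>1"
      "0 < \<nu>" "polyak_lojasiewicz p \<nu> (global_obj n D F)"
      "\<forall>i<n. bdd_below (local_obj D F i ` carrier_vec p)" "\<forall>i<n. x0 i \<in> carrier_vec p"
      "independent_draws M n p D u \<xi>" "0 < \<gamma>" "\<gamma> < d1 (laplacian n A)"
      "8 / \<nu> < \<kappa>\<^sub>\<eta>" "d2_check n p (laplacian n A) L\<^sub>f \<sigma>\<^sub>0 \<nu> \<kappa>\<^sub>\<eta> \<gamma> < t\<^sub>1"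
      "\<forall>k. \<eta> k = \<kappa>\<^sub>\<eta> / (real k + t\<^sub>1)"
      "\<forall>i<n. \<forall>k. 0 < \<delta> i k \<and> \<delta> i k \<le> \<kappa>\<^sub>\<delta> * sqrt (real p * \<eta> k) / sqrt (real (n + p))"
      and T: "1 \<le> T"
    interpret net: network n E A by unfold_locales (use h in auto)
    interpret alg: algorithm M n p D u \<xi> F L\<^sub>f \<sigma>\<^sub>0 \<sigma>\<^sub>1 E A \<gamma> \<nu> \<eta> \<delta> x0
    proof unfold_locales
      have e1: "0 < eps1 (laplacian n A) \<gamma>" by (rule net.eps1_pos[OF h(15,16)])
      have "0 < 8 / \<nu>" using h(10) by simp
      then have \<kappa>: "0 < \<kappa>\<^sub>\<eta>" using h(17) by linarith
      have "0 < 1 / eps1 (laplacian n A) \<gamma>" using e1 by simp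
      moreover have "1 / eps1 (laplacian n A) \<gamma> < t\<^sub>1" using h(18) by (simp add: d2_check_def)
      ultimately have t: "0 < t\<^sub>1" by linarith
      show \<eta>: "0 \<le> \<eta> k" for k using h(19) \<kappa> t by simp
      have e2: "0 \<le> eps2 (laplacian n A) \<gamma>"
        using net.spec_pos[OF h(15,16)] h(15) by (simp add: eps2_def)
      \<comment> \<open>The condition on the offset gives
        \<open>\<kappa>\<^sub>\<eta> * q < t\<^sub>1\<close>, and \<open>q\<close> dominates
        \<open>L\<^sub>f\<close>; this is where \<open>L\<^sub>f * \<eta> k \<le> 1\<close> comes
        from.\<close>
      define q where "q = 4 * real p * (1 + \<sigma>\<^sub>0\<^sup>2) * (2 * eps2 (laplacian n A) \<gamma> + L\<^sub>f)"
      have "1 * 1 * L\<^sub>f \<le> (4 * real p) * (1 + \<sigma>\<^sub>0\<^sup>2) * (2 * eps2 (laplacian n A) \<gamma> + L\<^sub>f)"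
        using h(2,7) e2 by (intro mult_mono) auto
      then have q: "L\<^sub>f \<le> q" by (simp add: q_def)
      have tilde: "d2_tilde p (laplacian n A) L\<^sub>f \<sigma>\<^sub>0 \<gamma> \<le> 1 / q" "0 < d2_tilde p (laplacian n A) L\<^sub>f \<sigma>\<^sub>0 \<gamma>"
        using e1 h(7) q by (auto simp: d2_tilde_def q_def[symmetric])
      have "\<kappa>\<^sub>\<eta> / d2_tilde p (laplacian n A) L\<^sub>f \<sigma>\<^sub>0 \<gamma> < t\<^sub>1" using h(18) by (simp add: d2_check_def)
      then have "\<kappa>\<^sub>\<eta> < t\<^sub>1 * d2_tilde p (laplacian n A) L\<^sub>f \<sigma>\<^sub>0 \<gamma>" using tilde(2) by (simp add: pos_divide_less_eq)
      also have "\<dots> \<le> t\<^sub>1 * (1 / q)" using t tilde(1) by (intro mult_left_mono) auto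
      finally have "\<kappa>\<^sub>\<eta> * q < t\<^sub>1" using q h(7) by (simp add: pos_less_divide_eq)
      moreover have "L\<^sub>f * \<kappa>\<^sub>\<eta> \<le> \<kappa>\<^sub>\<eta> * q" using q \<kappa> by (simp add: mult.commute mult_left_mono)
      ultimately have "L\<^sub>f * \<kappa>\<^sub>\<eta> \<le> real k + t\<^sub>1" for k :: nat by (simp add: add_increasing)
      then show "L\<^sub>f * \<eta> k \<le> 1" for k
        using h(19) t by (simp add: pos_divide_le_eq add_nonneg_pos)
    qed (use h in auto)
    have X: "alg.X k \<omega> = zo_primal n p (laplacian n A) F \<gamma> \<eta> \<delta> x0 (\<lambda>i k. u i k \<omega>) (\<lambda>i k. \<xi> i k \<omega>) k" for k \<omega>
      by (simp add: alg.X_def)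
    note r = alg.rates[of \<kappa>\<^sub>\<eta> t\<^sub>1 \<kappa>\<^sub>\<delta> T]
    have \<delta>: "\<delta> i k \<le> \<kappa>\<^sub>\<delta> * sqrt (real p * \<eta> k) / sqrt (real (n + p))" if "i < n" for i k
      using h(20) that by blast
    note R = r[OF h(19)[rule_format] h(17,18) \<delta> T]
    let ?x = "zo_primal n p (laplacian n A) F \<gamma> \<eta> \<delta> x0"
    let ?D = "\<lambda>\<omega>. disagreement n p (?x (\<lambda>i k. u i k \<omega>) (\<lambda>i k. \<xi> i k \<omega>) T)"
    let ?W = "\<lambda>\<omega>. global_obj n D F (avg n p (?x (\<lambda>i k. u i k \<omega>) (\<lambda>i k. \<xi> i k \<omega>) T)) - min_value p (global_obj n D F)"
    let ?problem = "(L\<^sub>f, \<sigma>\<^sub>0, \<sigma>\<^sub>1, \<nu>, \<kappa>\<^sub>\<eta>, \<kappa>\<^sub>\<delta>, d\<^sub>3,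
          min_value p (global_obj n D F), (\<Sum>i<n. min_value p (local_obj D F i)) / real n,
          global_obj n D F (avg n p x0), disagreement n p x0)"
    let ?network = "(n, A, \<gamma>, t\<^sub>1)"
    have 1: "integrable M ?D" and 2: "integrable M ?W"
      using alg.disagreement_integrable[of T] alg.f_gap_integrable[of T] by (simp_all only: X)
    have 3: "(\<integral>\<omega>. ?D \<omega> \<partial>M) \<le> C\<^sub>3 ?problem ?network * real p / real T ^ 2"
      using R(1) by (simp only: X C\<^sub>3_def prod.case)
    have 4: "(\<integral>\<omega>. ?W \<omega> \<partial>M) \<le> C\<^sub>1 ?problem * real p / (real n * real T) + C\<^sub>2 ?problem ?network * real p / real T ^ 2"
      using R(2) by (simp only: X C\<^sub>1_def C\<^sub>2_def C\<^sub>3_def prod.case)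
    show "integrable M ?D \<and> (\<integral>\<omega>. ?D \<omega> \<partial>M) \<le> C\<^sub>3 ?problem ?network * real p / real T ^ 2 \<and>
        integrable M ?W \<and>
        (\<integral>\<omega>. ?W \<omega> \<partial>M) \<le> C\<^sub>1 ?problem * real p / (real n * real T) + C\<^sub>2 ?problem ?network * real p / real T ^ 2"
      using 1 2 3 4 by blast
  qed
qed

end
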